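(* Let $r>0$, $\sigma>0$, $\mu\in\mathbb{R}$, $\nu=\frac{r-1}{2}$, $Z\sim\mathrm{SVG}(r,\sigma,\mu)$, and for a function $h:\mathbb{R}\to\mathbb{R}$ with $\mathbb{E}|h(Z)|<\infty$ let $f=f_h$ be the solution of the $\mathrm{SVG}(r,\sigma,\mu)$ Stein equation defined in the context. (a) If $h$ is bounded and measurable, then $$\|(x-\mu)f(x)\|\le\Big(\frac32+\frac1{2r}\Big)\|\tilde h\|,\quad \|(x-\mu)f'(x)\|\le\frac1\sigma\Big(1+\frac1{2r}\Big)\|\tilde h\|,\quad \|(x-\mu)f''(x)\|\le\frac1{2\sigma^2}\Big(9+\frac1r\Big)\|\tilde h\|.$$ (b) If $h$ is Lipschitz, then $$\|f\|\le\frac72\|h'\|,\quad \|f'\|\le\frac{9}{2\sigma}\Big(\frac1{r+1}+\frac{\pi\Gamma(\frac{r+1}{2})}{2\Gamma(\frac r2+1)}\Big)\|h'\|,\quad \|f''\|\le\frac{9}{\sigma^2(r+1)}\|h'\|,$$ and $$\|(x-\mu)f'(x)\|\le\frac92\Big(\frac32+\frac1{2(r+1)}\Big)\|h'\|,\quad \|(x-\mu)f''(x)\|\le\frac9{2\sigma}\Big(1+\frac1{2(r+1)}\Big)\|h'\|,$$ $$\|(x-\mu)f^{(3)}(x)\|\le\frac9{4\sigma^2}\Big(9+\frac1{r+1}\Big)\|h'\|.$$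
   Context: $\mathrm{SVG}(r,\sigma,\mu)$ ($r>0,\sigma>0,\mu\in\mathbb{R}$) is the distribution with density $p(x)=\frac{1}{\sigma\sqrt{\pi}\Gamma(r/2)}\big(\frac{|x-\mu|}{2\sigma}\big)^{\frac{r-1}{2}}K_{\frac{r-1}{2}}\big(\frac{|x-\mu|}{\sigma}\big)$, where $I_\nu(x)=\sum_{k\ge0}\frac{(x/2)^{\nu+2k}}{\Gamma(\nu+k+1)k!}$ and $K_\nu(x)=\int_0^\infty e^{-x\cosh t}\cosh(\nu t)\,dt$ are the modified Bessel functions of the first and second kind. Write $\tilde h(x)=h(x)-\mathbb{E}h(Z)$. The $\mathrm{SVG}(r,\sigma,\mu)$ Stein equation is $$\sigma^2(x-\mu)f''(x)+\sigma^2 r f'(x)-(x-\mu)f(x)=\tilde h(x),$$ and its solution $f_h$ is defined, with $y=x-\mu$ and $\nu=\frac{r-1}{2}$, by $$f_h(x)=-\frac{K_\nu(|y|/\sigma)}{\sigma^2|y|^\nu}\int_0^y|t|^\nu I_\nu(|t|/\sigma)\tilde h(t+\mu)\,dt-\frac{I_\nu(|y|/\sigma)}{\sigma^2|y|^\nu}\int_y^\infty|t|^\nu K_\nu(|t|/\sigma)\tilde h(t+\mu)\,dt.$$ $\|\cdot\|$ denotes the supremum norm over $\mathbb{R}$; for Lipschitz $h$, $\|h'\|$ denotes its Lipschitz constant (the sup norm of its a.e. derivative). Expressions such as $\|(x-\mu)f(x)\|$ denote the sup norm of the function $x\mapsto(x-\mu)f(x)$. *)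

theory Defs
  imports "HOL-Analysis.Analysis"
begin

text \<open>Modified Bessel function of the first kind (series definition; used for x > 0).\<close>
definition bessel_I :: "real \<Rightarrow> real \<Rightarrow> real" where
  "bessel_I \<nu> x = (\<Sum>k. (x / 2) powr (\<nu> + 2 * real k) / (Gamma (\<nu> + real k + 1) * fact k))"

definition bessel_K :: "real \<Rightarrow> real \<Rightarrow> real" where
  "bessel_K \<nu> x = (LINT t:{0..}|lborel. exp (- x * cosh t) * cosh (\<nu> * t))"

definition svg_pdf :: "real \<Rightarrow> real \<Rightarrow> real \<Rightarrow> real \<Rightarrow> real" where
  "svg_pdf r \<sigma> \<mu> x =
     1 / (\<sigma> * sqrt pi * Gamma (r / 2)) * (\<bar>x - \<mu>\<bar> / (2 * \<sigma>)) powr ((r - 1) / 2)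
       * bessel_K ((r - 1) / 2) (\<bar>x - \<mu>\<bar> / \<sigma>)"

definition svg_expect :: "real \<Rightarrow> real \<Rightarrow> real \<Rightarrow> (real \<Rightarrow> real) \<Rightarrow> real" where
  "svg_expect r \<sigma> \<mu> h = (LINT x|lborel. svg_pdf r \<sigma> \<mu> x * h x)"

text \<open>The defining formula of the Stein solution, valid for x \<noteq> mu.\<close>
definition svg_stein_formula :: "real \<Rightarrow> real \<Rightarrow> real \<Rightarrow> (real \<Rightarrow> real) \<Rightarrow> real \<Rightarrow> real" where
  "svg_stein_formula r \<sigma> \<mu> h x =
     (let y = x - \<mu>; \<nu> = (r - 1) / 2; ht = (\<lambda>t. h t - svg_expect r \<sigma> \<mu> h) in
      - (bessel_K \<nu> (\<bar>y\<bar> / \<sigma>) / (\<sigma>\<^sup>2 * \<bar>y\<bar> powr \<nu>))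
          * (LBINT t=ereal 0..ereal y. \<bar>t\<bar> powr \<nu> * bessel_I \<nu> (\<bar>t\<bar> / \<sigma>) * ht (t + \<mu>))
      - (bessel_I \<nu> (\<bar>y\<bar> / \<sigma>) / (\<sigma>\<^sup>2 * \<bar>y\<bar> powr \<nu>))
          * (LBINT t=ereal y..PInfty. \<bar>t\<bar> powr \<nu> * bessel_K \<nu> (\<bar>t\<bar> / \<sigma>) * ht (t + \<mu>)))"

definition svg_stein_sol :: "real \<Rightarrow> real \<Rightarrow> real \<Rightarrow> (real \<Rightarrow> real) \<Rightarrow> real \<Rightarrow> real" where
  "svg_stein_sol r \<sigma> \<mu> h x =
     (if x = \<mu> then Lim (at \<mu>) (svg_stein_formula r \<sigma> \<mu> h) else svg_stein_formula r \<sigma> \<mu> h x)"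

fun has_nth_deriv :: "(real \<Rightarrow> real) \<Rightarrow> nat \<Rightarrow> real \<Rightarrow> real \<Rightarrow> bool" where
  "has_nth_deriv f 0 x D = (D = f x)"
| "has_nth_deriv f (Suc n) x D =
     (\<exists>g. (\<forall>\<^sub>F t in nhds x. has_nth_deriv f n t (g t)) \<and> (g has_real_derivative D) (at x))"

end

theory Submission
  imports Defs
begin

text \<open>
  Put \<open>\<nu> = (r - 1) / 2\<close>. After centring and rescaling the test function to \<open>k\<close>, both half-lines are
  treated alike: on \<open>x > 0\<close> the solution is \<open>G k = - b X - a Y\<close>, where \<open>a = x\<^sup>-\<^sup>\<nu> I\<^sub>\<nu>\<close> and
  \<open>b = x\<^sup>-\<^sup>\<nu> K\<^sub>\<nu>\<close> solve the homogeneous equation \<open>x u'' + r u' - x u = 0\<close> and \<open>X\<close>, \<open>Y\<close> are the integrals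
  of \<open>t\<^sup>r\<^sup>-\<^sup>1 a k\<close> over \<open>(0, x]\<close> and of \<open>t\<^sup>r\<^sup>-\<^sup>1 b k\<close> over \<open>(x, \<infinity>)\<close>. The left half-line uses that the
  centred test function has mean zero.

  The function \<open>E(x) = \<integral>\<^sub>0\<^sup>1 (1 - u\<^sup>2)\<^sup>r\<^sup>/\<^sup>2\<^sup>-\<^sup>1 exp (- x u) du\<close> solves \<open>x E'' + r E' - x E = - 1\<close>, so
  \<open>E = - G 1\<close>, and Lagrange's identity expresses the integrals \<open>P\<close> of \<open>t\<^sup>r\<^sup>-\<^sup>1 a\<close> and \<open>Q\<close> of \<open>t\<^sup>r\<^sup>-\<^sup>1 b\<close>
  through \<open>E\<close>; in particular the density has mass one and the mean absolute value of the standardised law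
  is \<open>1 / E(0)\<close>. Part (a) then follows from the Wronskian, elementary monotonicity bounds for \<open>P\<close> and
  \<open>Q\<close>, and \<open>x I\<^sub>\<nu>\<^sub>+\<^sub>1 K\<^sub>\<nu>\<^sub>+\<^sub>1 \<le> 1/2\<close>.

  If \<open>k\<close> has Lipschitz constant \<open>\<lambda>\<close>, then \<open>|k(t)| \<le> \<lambda> (t + 1 / E(0))\<close>, and \<open>G\<close> maps \<open>t\<close> to the constant
  \<open>- 1\<close>, hence \<open>|f| \<le> 2 \<lambda>\<close> for \<open>f = G k\<close>. The derivative \<open>f'\<close> solves the equation of order \<open>r + 1\<close> with
  right-hand side \<open>k' + f\<close>, so part (a) with \<open>r + 1\<close> bounds it and its derivatives; \<open>k\<close> is first made
  differentiable by averaging over short intervals.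
\<close>

subsection \<open>Parameter integrals and indefinite integrals\<close>

lemma integral_dominated_convergence_at_within:
  fixes s :: "real \<Rightarrow> 'a \<Rightarrow> real" and f w :: "'a \<Rightarrow> real"
  assumes meas: "f \<in> borel_measurable M" "\<And>t. t \<in> S - {a} \<Longrightarrow> s t \<in> borel_measurable M"
    and w: "integrable M w"
    and lim: "\<And>x. ((\<lambda>t. s t x) \<longlongrightarrow> f x) (at a within S)"
    and bound: "\<And>t x. t \<in> S - {a} \<Longrightarrow> \<bar>s t x\<bar> \<le> w x"
  shows "((\<lambda>t. \<integral>x. s t x \<partial>M) \<longlongrightarrow> (\<integral>x. f x \<partial>M)) (at a within S)"
  unfolding tendsto_at_iff_sequentially o_def
proof (intro allI impI)
  fix X assume X: "\<forall>i. X i \<in> S - {a}" "X \<longlonglongrightarrow> a"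
  show "(\<lambda>i. \<integral>x. s (X i) x \<partial>M) \<longlonglongrightarrow> (\<integral>x. f x \<partial>M)"
  proof (rule integral_dominated_convergence[where w = w])
    show "AE x in M. (\<lambda>i. s (X i) x) \<longlonglongrightarrow> f x"
      using lim X by (intro AE_I2) (auto simp: tendsto_at_iff_sequentially o_def)
  qed (use meas w bound X in auto)
qed

lemma abs_exp_diff_le:
  fixes u v w :: real
  assumes "u \<le> w" "v \<le> w"
  shows "\<bar>exp u - exp v\<bar> \<le> \<bar>u - v\<bar> * exp w"
  using assms
proof (induction u v rule: linorder_wlog)
  case (le u v)
  have "exp v - exp u = exp v * (1 - exp (u - v))"
    by (simp add: right_diff_distrib flip: exp_add)
  also have "\<dots> \<le> exp v * (v - u)"
    using exp_ge_add_one_self[of "u - v"] by (intro mult_left_mono) (simp_all add: algebra_simps)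
  also have "\<dots> \<le> exp w * (v - u)"
    using le by (intro mult_right_mono) auto
  finally show ?case using le by (simp add: mult.commute)
qed (simp add: abs_minus_commute)

lemma mult_exp_uminus_le:
  fixes x y :: real
  assumes "x > 0"
  shows "y * exp (- (x * y)) \<le> 2 / x * exp (- (x / 2 * y))"
proof -
  have "x / 2 * y \<le> exp (x / 2 * y)" using exp_ge_add_one_self[of "x / 2 * y"] by linarith
  then have "x / 2 * y * exp (- (x * y)) \<le> exp (x / 2 * y) * exp (- (x * y))"
    by (intro mult_right_mono) auto
  also have "\<dots> = exp (- (x / 2 * y))" by (simp flip: exp_add)
  finally show ?thesis using assms by (simp add: field_simps)
qed

lemma abs_exp_uminus_quotient_le:
  fixes x y z a :: real
  assumes y: "y \<ge> 0" and "a \<le> x" "a \<le> z" "z \<noteq> x"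
  shows "\<bar>(exp (- (z * y)) - exp (- (x * y))) / (z - x)\<bar> \<le> y * exp (- (a * y))"
proof -
  have "\<bar>exp (- (z * y)) - exp (- (x * y))\<bar> \<le> \<bar>- (z * y) - - (x * y)\<bar> * exp (- (a * y))"
    using assms by (intro abs_exp_diff_le le_imp_neg_le mult_right_mono) auto
  also have "- (z * y) - - (x * y) = - (y * (z - x))" by (simp add: algebra_simps)
  finally have "\<bar>exp (- (z * y)) - exp (- (x * y))\<bar> \<le> y * exp (- (a * y)) * \<bar>z - x\<bar>"
    using y by (simp only: abs_minus_cancel abs_mult abs_of_nonneg mult_ac)
  then show ?thesis using assms(4) by (subst abs_divide, subst pos_divide_le_eq) auto
qed

lemma tendsto_exp_uminus_quotient:
  fixes x y :: real
  shows "((\<lambda>z. (exp (- (z * y)) - exp (- (x * y))) / (z - x)) \<longlongrightarrow> - y * exp (- (x * y))) (at x within S)"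
proof -
  have "((\<lambda>z. exp (- (z * y))) has_real_derivative - y * exp (- (x * y))) (at x within S)"
    by (auto intro!: derivative_eq_intros)
  then show ?thesis by (simp add: has_field_derivative_iff)
qed

lemma integrable_laplace_deriv:
  fixes w nonneg :: "'a \<Rightarrow> real"
  assumes int: "\<And>x. x > 0 \<Longrightarrow> integrable M (\<lambda>t. w t * exp (- (x * c t)))"
    and nonneg: "\<And>t. w t \<noteq> 0 \<Longrightarrow> 0 \<le> c t"
    and [measurable]: "w \<in> borel_measurable M" "c \<in> borel_measurable M"
    and x: "x > 0"
  shows "integrable M (\<lambda>t. w t * c t * exp (- (x * c t)))"
proof (rule Bochner_Integration.integrable_bound)
  show "integrable M (\<lambda>t. 2 / x * (w t * exp (- (x / 2 * c t))))"
    using int[of "x / 2"] x by (intro integrable_mult_right) simp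
  have "\<bar>w t * c t * exp (- (x * c t))\<bar> \<le> \<bar>2 / x * (w t * exp (- (x / 2 * c t)))\<bar>" for t
  proof (cases "w t = 0")
    case False
    show ?thesis
      using mult_left_mono[OF mult_exp_uminus_le[OF x, of "c t"] abs_ge_zero[of "w t"]] nonneg[OF False] x
      by (simp add: abs_mult mult_ac)
  qed simp
  then show "AE t in M. norm (w t * c t * exp (- (x * c t))) \<le> norm (2 / x * (w t * exp (- (x / 2 * c t))))"
    by simp
qed measurable

lemma has_real_derivative_laplace:
  fixes w nonneg :: "'a \<Rightarrow> real"
  assumes int: "\<And>x. x > 0 \<Longrightarrow> integrable M (\<lambda>t. w t * exp (- (x * c t)))"
    and nonneg: "\<And>t. w t \<noteq> 0 \<Longrightarrow> 0 \<le> c t"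
    and [measurable]: "w \<in> borel_measurable M" "c \<in> borel_measurable M"
    and x: "x > 0"
  shows "((\<lambda>x. \<integral>t. w t * exp (- (x * c t)) \<partial>M) has_real_derivative
    - (\<integral>t. w t * c t * exp (- (x * c t)) \<partial>M)) (at x)"
proof -
  let ?f = "\<lambda>z t. w t * exp (- (z * c t))"
    and ?q = "\<lambda>z t. w t * ((exp (- (z * c t)) - exp (- (x * c t))) / (z - x))"
  let ?S = "{x / 2..2 * x}"
  have "((\<lambda>z. \<integral>t. ?q z t \<partial>M) \<longlongrightarrow> (\<integral>t. w t * (- c t * exp (- (x * c t))) \<partial>M)) (at x within ?S)"
  proof (rule integral_dominated_convergence_at_within)
    show "integrable M (\<lambda>t. \<bar>w t * c t * exp (- (x / 2 * c t))\<bar>)"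
      using x by (intro integrable_abs integrable_laplace_deriv[OF int nonneg]) auto
    show "((\<lambda>z. ?q z t) \<longlongrightarrow> w t * (- c t * exp (- (x * c t)))) (at x within ?S)" for t
      by (intro tendsto_mult tendsto_const tendsto_exp_uminus_quotient)
    show "\<bar>?q z t\<bar> \<le> \<bar>w t * c t * exp (- (x / 2 * c t))\<bar>" if z: "z \<in> ?S - {x}" for z t
    proof (cases "w t = 0")
      case False
      then have "0 \<le> c t" by (rule nonneg)
      moreover have "x / 2 \<le> z" "z \<noteq> x" using z by auto
      ultimately have "\<bar>(exp (- (z * c t)) - exp (- (x * c t))) / (z - x)\<bar> \<le> c t * exp (- (x / 2 * c t))"
        using x by (intro abs_exp_uminus_quotient_le) auto
      from mult_left_mono[OF this abs_ge_zero[of "w t"]] show ?thesis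
        using \<open>0 \<le> c t\<close> by (simp add: abs_mult mult_ac)
    qed simp
  qed auto
  also have "at x within ?S = at x" using x by (intro at_within_Icc_at) auto
  finally have "((\<lambda>z. \<integral>t. ?q z t \<partial>M) \<longlongrightarrow> - (\<integral>t. w t * c t * exp (- (x * c t)) \<partial>M)) (at x)"
    by (simp add: mult.assoc)
  moreover have "\<forall>\<^sub>F z in at x. (\<integral>t. ?q z t \<partial>M) = ((\<integral>t. ?f z t \<partial>M) - (\<integral>t. ?f x t \<partial>M)) / (z - x)"
  proof -
    have "\<forall>\<^sub>F z in at x. 0 < z" using x eventually_at_in_open'[of "{0<..}" x] by simp
    then show ?thesis
    proof eventually_elim
      case (elim z)
      have "?q z = (\<lambda>t. (?f z t - ?f x t) / (z - x))" by (simp add: right_diff_distrib)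
      then show ?case using int[OF elim] int[OF x] by simp
    qed
  qed
  ultimately show ?thesis
    unfolding has_field_derivative_iff by (rule Lim_transform_eventually)
qed

lemma
  fixes f g :: "real \<Rightarrow> real"
  assumes g: "set_integrable lborel S g" and [measurable]: "f \<in> borel_measurable borel" "S \<in> sets borel"
    and bound: "\<And>t. t \<in> S \<Longrightarrow> \<bar>f t\<bar> \<le> g t"
  shows set_integrable_abs_bound: "set_integrable lborel S f"
    and abs_set_integral_le: "\<bar>LINT t:S|lborel. f t\<bar> \<le> (LINT t:S|lborel. g t)"
proof -
  show f: "set_integrable lborel S f"
    by (rule set_integrable_bound[OF g]) (auto simp: set_borel_measurable_def dest!: bound)
  have "\<bar>LINT t:S|lborel. f t\<bar> \<le> (LINT t:S|lborel. \<bar>f t\<bar>)"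
    using set_integral_norm_bound[OF f] by simp
  also have "\<dots> \<le> (LINT t:S|lborel. g t)"
    by (intro set_integral_mono set_integrable_abs f g bound)
  finally show "\<bar>LINT t:S|lborel. f t\<bar> \<le> (LINT t:S|lborel. g t)" .
qed

lemma tendsto_set_integral_Ioi_at_right:
  fixes f :: "real \<Rightarrow> real"
  assumes f: "set_integrable lborel {a<..} f"
  shows "((\<lambda>x. LINT t:{x<..}|lborel. f t) \<longlongrightarrow> (LINT t:{a<..}|lborel. f t)) (at_right a)"
  unfolding set_lebesgue_integral_def
proof (rule integral_dominated_convergence_at_within)
  show "integrable lborel (\<lambda>t. \<bar>indicator {a<..} t *\<^sub>R f t\<bar>)"
    using f unfolding set_integrable_def by (rule integrable_abs)
  show "(\<lambda>t. indicat_real {a<..} t *\<^sub>R f t) \<in> borel_measurable lborel"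
    using f unfolding set_integrable_def by (rule borel_measurable_integrable)
  show "(\<lambda>t. indicat_real {x<..} t *\<^sub>R f t) \<in> borel_measurable lborel" if "x \<in> {a<..} - {a}" for x
    using set_integrable_subset[OF f, of "{x<..}"] that
    unfolding set_integrable_def by (auto intro: borel_measurable_integrable)
  show "((\<lambda>x. indicat_real {x<..} t *\<^sub>R f t) \<longlongrightarrow> indicat_real {a<..} t *\<^sub>R f t) (at_right a)" for t
  proof (rule tendsto_eventually)
    show "\<forall>\<^sub>F x in at_right a. indicat_real {x<..} t *\<^sub>R f t = indicat_real {a<..} t *\<^sub>R f t"
    proof (cases "a < t")
      case True
      from eventually_at_right_real[OF this] show ?thesis by eventually_elim auto
    next
      case False
      show ?thesis using eventually_at_right_less[of a] by eventually_elim (use False in auto)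
    qed
  qed
qed (auto simp: indicator_def)

definition indefinite_integral :: "real \<Rightarrow> (real \<Rightarrow> real) \<Rightarrow> (real \<Rightarrow> real) \<Rightarrow> bool" where
  "indefinite_integral a F f \<longleftrightarrow> (\<forall>x z. a < x \<and> x \<le> z \<longrightarrow>
     set_integrable lborel {x<..z} f \<and> F z - F x = (LINT t:{x<..z}|lborel. f t))"

lemma indefinite_integral_Ioc:
  fixes f :: "real \<Rightarrow> real"
  assumes f: "\<And>x. a < x \<Longrightarrow> set_integrable lborel {a<..x} f"
  shows "indefinite_integral a (\<lambda>x. LINT t:{a<..x}|lborel. f t) f"
  unfolding indefinite_integral_def
proof (intro allI impI)
  fix x z assume xz: "a < x \<and> x \<le> z"
  then have split: "{a<..z} = {a<..x} \<union> {x<..z}" by auto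
  have int: "set_integrable lborel {x<..z} f"
    using xz by (intro set_integrable_subset[OF f[of z]]) auto
  with xz show "set_integrable lborel {x<..z} f \<and>
      (LINT t:{a<..z}|lborel. f t) - (LINT t:{a<..x}|lborel. f t) = (LINT t:{x<..z}|lborel. f t)"
    unfolding split by (subst set_integral_Un[OF _ f int]) auto
qed

lemma indefinite_integral_Ioi:
  fixes f :: "real \<Rightarrow> real"
  assumes f: "\<And>x. a < x \<Longrightarrow> set_integrable lborel {x<..} f"
  shows "indefinite_integral a (\<lambda>x. LINT t:{x<..}|lborel. f t) (\<lambda>t. - f t)"
  unfolding indefinite_integral_def
proof (intro allI impI)
  fix x z assume xz: "a < x \<and> x \<le> z"
  then have split: "{x<..} = {x<..z} \<union> {z<..}" by auto
  have int: "set_integrable lborel {x<..z} f"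
    using xz by (intro set_integrable_subset[OF f[of x]]) auto
  have "set_integrable lborel {x<..z} (\<lambda>t. - 1 * f t)" by (intro set_integrable_mult_right int)
  moreover have "(LINT t:{x<..}|lborel. f t) = (LINT t:{x<..z}|lborel. f t) + (LINT t:{z<..}|lborel. f t)"
    unfolding split using xz by (intro set_integral_Un int f) auto
  ultimately show "set_integrable lborel {x<..z} (\<lambda>t. - f t) \<and>
      (LINT t:{z<..}|lborel. f t) - (LINT t:{x<..}|lborel. f t) = (LINT t:{x<..z}|lborel. - f t)"
    by (simp add: set_integral_uminus[OF int])
qed

lemma indefinite_integral_lincomb:
  assumes "indefinite_integral a F f" "indefinite_integral a G g"
  shows "indefinite_integral a (\<lambda>x. c * F x + d * G x) (\<lambda>t. c * f t + d * g t)"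
  unfolding indefinite_integral_def
proof (intro allI impI)
  fix x z assume xz: "a < x \<and> x \<le> z"
  have f: "set_integrable lborel {x<..z} f" "F z - F x = (LINT t:{x<..z}|lborel. f t)"
    and g: "set_integrable lborel {x<..z} g" "G z - G x = (LINT t:{x<..z}|lborel. g t)"
    using assms xz unfolding indefinite_integral_def by blast+
  have "c * F z + d * G z - (c * F x + d * G x) = c * (F z - F x) + d * (G z - G x)"
    by (simp add: algebra_simps)
  then show "set_integrable lborel {x<..z} (\<lambda>t. c * f t + d * g t) \<and>
      c * F z + d * G z - (c * F x + d * G x) = (LINT t:{x<..z}|lborel. c * f t + d * g t)"
    unfolding f(2) g(2) using f(1) g(1) by simp
qed

lemma indefinite_integral_increment:
  assumes F: "indefinite_integral a F f" and xz: "a < x" "a < z"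
    and near: "\<And>t. min x z \<le> t \<Longrightarrow> t \<le> max x z \<Longrightarrow> \<bar>f t - c\<bar> \<le> e"
  shows "\<bar>F z - F x - c * (z - x)\<bar> \<le> e * \<bar>z - x\<bar>"
  using xz near
proof (induction x z rule: linorder_wlog)
  case (le x z)
  have f: "set_integrable lborel {x<..z} f" "F z - F x = (LINT t:{x<..z}|lborel. f t)"
    using F le unfolding indefinite_integral_def by auto
  have const: "set_integrable lborel {x<..z} (\<lambda>t. b)" "(LINT t:{x<..z}|lborel. b) = b * (z - x)" for b :: real
    using le by (simp_all add: set_integrable_def set_lebesgue_integral_def)
  have "F z - F x - c * (z - x) = (LINT t:{x<..z}|lborel. f t - c)"
    unfolding f(2) by (simp add: f(1) const)
  also have "\<bar>\<dots>\<bar> \<le> (LINT t:{x<..z}|lborel. \<bar>f t - c\<bar>)"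
    using set_integral_norm_bound[of lborel "{x<..z}" "\<lambda>t. f t - c"] f(1) const(1) by simp
  also have "\<dots> \<le> (LINT t:{x<..z}|lborel. e)"
    using le by (intro set_integral_mono set_integrable_abs set_integral_diff f(1) const(1)) auto
  finally show ?case using le by (simp add: const)
next
  case (sym x z)
  show ?case
    using sym(1)[OF sym(3,2)] sym(4)
    by (simp add: min.commute max.commute abs_minus_commute algebra_simps)
qed

lemma has_real_derivative_epsI:
  fixes f :: "real \<Rightarrow> real"
  assumes "\<And>e. e > 0 \<Longrightarrow> \<forall>\<^sub>F z in at x. \<bar>f z - f x - c * (z - x)\<bar> \<le> e * \<bar>z - x\<bar>"
  shows "(f has_real_derivative c) (at x)"
  unfolding has_field_derivative_iff
proof (rule tendstoI)
  fix e :: real assume "e > 0"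
  then have "\<forall>\<^sub>F z in at x. \<bar>f z - f x - c * (z - x)\<bar> \<le> e / 2 * \<bar>z - x\<bar>" by (intro assms) simp
  moreover have "\<forall>\<^sub>F z in at x. z \<noteq> x" by (simp add: eventually_at_filter)
  ultimately show "\<forall>\<^sub>F z in at x. dist ((f z - f x) / (z - x)) c < e"
  proof eventually_elim
    case (elim z)
    have "(f z - f x) / (z - x) - c = (f z - f x - c * (z - x)) / (z - x)"
      using elim by (simp add: field_simps)
    then have "\<bar>(f z - f x) / (z - x) - c\<bar> \<le> e / 2"
      using elim by (simp add: abs_divide field_simps)
    then show ?case using \<open>e > 0\<close> by (simp add: dist_real_def)
  qed
qed

lemma eventually_between_in_nhds:
  fixes x :: real
  assumes "\<forall>\<^sub>F t in nhds x. P t"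
  shows "\<forall>\<^sub>F z in at x. \<forall>t. min x z \<le> t \<and> t \<le> max x z \<longrightarrow> P t"
proof -
  obtain d where d: "d > 0" "\<And>t. dist t x < d \<Longrightarrow> P t"
    using assms unfolding eventually_nhds_metric by blast
  have "P t" if "dist z x < d" "min x z \<le> t" "t \<le> max x z" for z t
    using that by (intro d(2)) (auto simp: dist_real_def)
  then show ?thesis unfolding eventually_at using d(1) by blast
qed

lemma indefinite_integral_has_real_derivative:
  assumes F: "indefinite_integral a F f" and x: "a < x" and f: "isCont f x"
  shows "(F has_real_derivative f x) (at x)"
proof (rule has_real_derivative_epsI)
  fix e :: real assume "e > 0"
  then have "\<forall>\<^sub>F t in nhds x. \<bar>f t - f x\<bar> \<le> e"
    using f unfolding continuous_at_eps_delta eventually_nhds_metric dist_real_def by (meson less_imp_le)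
  then have "\<forall>\<^sub>F z in at x. \<forall>t. min x z \<le> t \<and> t \<le> max x z \<longrightarrow> \<bar>f t - f x\<bar> \<le> e"
    by (rule eventually_between_in_nhds)
  moreover have "\<forall>\<^sub>F z in at x. a < z" using x eventually_at_in_open'[of "{a<..}" x] by simp
  ultimately show "\<forall>\<^sub>F z in at x. \<bar>F z - F x - f x * (z - x)\<bar> \<le> e * \<bar>z - x\<bar>"
    by eventually_elim (rule indefinite_integral_increment[OF F x], auto)
qed

lemma indefinite_integral_locally_lipschitz:
  assumes F: "indefinite_integral a F f" and x: "a < x"
    and g: "isCont g x" "\<And>t. a < t \<Longrightarrow> \<bar>f t\<bar> \<le> g t" and e: "e > 0"
  shows "\<forall>\<^sub>F z in at x. \<bar>F z - F x\<bar> \<le> (g x + e) * \<bar>z - x\<bar>"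
proof -
  have "\<forall>\<^sub>F t in nhds x. dist (g t) (g x) < e"
    using g(1) e unfolding continuous_at_eps_delta eventually_nhds_metric dist_real_def by blast
  moreover have "\<forall>\<^sub>F t in nhds x. a < t" using x eventually_nhds_in_open[of "{a<..}" x] by simp
  ultimately have "\<forall>\<^sub>F t in nhds x. \<bar>f t - 0\<bar> \<le> g x + e"
    by eventually_elim (use g(2) in \<open>force simp: dist_real_def\<close>)
  then have "\<forall>\<^sub>F z in at x. \<forall>t. min x z \<le> t \<and> t \<le> max x z \<longrightarrow> \<bar>f t - 0\<bar> \<le> g x + e"
    by (rule eventually_between_in_nhds)
  moreover have "\<forall>\<^sub>F z in at x. a < z" using x eventually_at_in_open'[of "{a<..}" x] by simp
  ultimately have "\<forall>\<^sub>F z in at x. \<bar>F z - F x - 0 * (z - x)\<bar> \<le> (g x + e) * \<bar>z - x\<bar>"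
    by eventually_elim (rule indefinite_integral_increment[OF F x], auto)
  then show ?thesis by simp
qed

lemma indefinite_integral_isCont:
  assumes F: "indefinite_integral a F f" and x: "a < x"
    and g: "isCont g x" "\<And>t. a < t \<Longrightarrow> \<bar>f t\<bar> \<le> g t"
  shows "isCont F x"
  unfolding isCont_def
proof (rule LIM_zero_cancel, rule Lim_null_comparison)
  show "\<forall>\<^sub>F z in at x. norm (F z - F x) \<le> (g x + 1) * \<bar>z - x\<bar>"
    unfolding real_norm_def by (rule indefinite_integral_locally_lipschitz[OF F x g zero_less_one])
  show "((\<lambda>z. (g x + 1) * \<bar>z - x\<bar>) \<longlongrightarrow> 0) (at x)"
    by (intro tendsto_mult_right_zero tendsto_rabs_zero LIM_zero tendsto_ident_at)
qed

lemma abs_deriv_le_of_increment: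
  fixes f :: "real \<Rightarrow> real"
  assumes D: "(f has_real_derivative D) (at x)"
    and incr: "\<forall>\<^sub>F z in at x. \<bar>f z - f x\<bar> \<le> M * \<bar>z - x\<bar>"
  shows "\<bar>D\<bar> \<le> M"
proof (rule tendsto_upperbound)
  show "((\<lambda>z. \<bar>(f z - f x) / (z - x)\<bar>) \<longlongrightarrow> \<bar>D\<bar>) (at x)"
    using D unfolding has_field_derivative_iff by (rule tendsto_rabs)
  show "\<forall>\<^sub>F z in at x. \<bar>(f z - f x) / (z - x)\<bar> \<le> M"
    using incr eventually_neq_at_within[of x x UNIV] by eventually_elim (simp add: abs_divide field_simps)
qed simp

lemma abs_deriv_indefinite_integral_le:
  assumes F: "indefinite_integral a F f" and x: "a < x"
    and g: "isCont g x" "\<And>t. a < t \<Longrightarrow> \<bar>f t\<bar> \<le> g t"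
    and D: "(F has_real_derivative D) (at x)"
  shows "\<bar>D\<bar> \<le> g x"
proof (rule field_le_epsilon)
  fix e :: real assume "e > 0"
  show "\<bar>D\<bar> \<le> g x + e"
    by (rule abs_deriv_le_of_increment[OF D indefinite_integral_locally_lipschitz[OF F x g \<open>e > 0\<close>]])
qed

text \<open>
  The linear combination of \<open>F\<close> and \<open>G\<close> with coefficients frozen at \<open>x\<close> may be differentiable although
  neither \<open>F\<close> nor \<open>G\<close> is.
\<close>

lemma has_real_derivative_frozen_coefficients:
  fixes u v F G :: "real \<Rightarrow> real"
  assumes "(u has_real_derivative u') (at x)" "(v has_real_derivative v') (at x)" "isCont F x" "isCont G x"
  shows "((\<lambda>z. u z * F z + v z * G z - (u x * F z + v x * G z)) has_real_derivative u' * F x + v' * G x) (at x)"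
proof -
  obtain p where p: "\<And>z. u z - u x = p z * (z - x)" "isCont p x" "p x = u'"
    using assms(1) unfolding CARAT_DERIV by blast
  obtain q where q: "\<And>z. v z - v x = q z * (z - x)" "isCont q x" "q x = v'"
    using assms(2) unfolding CARAT_DERIV by blast
  have "u z * F z + v z * G z - (u x * F z + v x * G z) = (p z * F z + q z * G z) * (z - x)" for z
  proof -
    have "u z * F z + v z * G z - (u x * F z + v x * G z) = (u z - u x) * F z + (v z - v x) * G z"
      by (simp add: algebra_simps)
    then show ?thesis unfolding p(1) q(1) by (simp add: algebra_simps)
  qed
  then show ?thesis
    unfolding CARAT_DERIV using p(2,3) q(2,3) assms(3,4)
    by (intro exI[of _ "\<lambda>z. p z * F z + q z * G z"]) (auto intro!: continuous_intros)
qed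

lemma lim_at_right_le_of_deriv_nonneg:
  fixes f f' :: "real \<Rightarrow> real"
  assumes "\<And>x. x > a \<Longrightarrow> (f has_real_derivative f' x) (at x)" "\<And>x. x > a \<Longrightarrow> f' x \<ge> 0"
    and "(f \<longlongrightarrow> l) (at_right a)" "x > a"
  shows "l \<le> f x"
proof (rule tendsto_upperbound[OF assms(3)])
  show "\<forall>\<^sub>F t in at_right a. f t \<le> f x"
    using eventually_at_right_real[OF \<open>x > a\<close>]
  proof eventually_elim
    case (elim t)
    then show ?case
      by (intro DERIV_nonneg_imp_nondecreasing[of t x f]) (use assms in \<open>auto intro: less_le_trans\<close>)
  qed
qed simp

lemma lim_at_top_le_of_deriv_nonpos:
  fixes f f' :: "real \<Rightarrow> real"
  assumes "\<And>x. x > a \<Longrightarrow> (f has_real_derivative f' x) (at x)" "\<And>x. x > a \<Longrightarrow> f' x \<le> 0"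
    and "(f \<longlongrightarrow> l) at_top" "x > a"
  shows "l \<le> f x"
proof (rule tendsto_upperbound[OF assms(3)])
  show "\<forall>\<^sub>F t in at_top. f t \<le> f x"
    using eventually_gt_at_top[of x]
  proof eventually_elim
    case (elim t)
    then show ?case
      by (intro DERIV_nonpos_imp_nonincreasing[of x t f]) (use assms in \<open>auto intro: less_le_trans\<close>)
  qed
qed simp

lemma abs_le_of_abs_deriv_le_at_right:
  fixes f g f' g' :: "real \<Rightarrow> real"
  assumes f: "\<And>x. x > a \<Longrightarrow> (f has_real_derivative f' x) (at x)" "(f \<longlongrightarrow> 0) (at_right a)"
    and g: "\<And>x. x > a \<Longrightarrow> (g has_real_derivative g' x) (at x)" "(g \<longlongrightarrow> 0) (at_right a)"
    and deriv_le: "\<And>x. x > a \<Longrightarrow> \<bar>f' x\<bar> \<le> g' x" and x: "x > a"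
  shows "\<bar>f x\<bar> \<le> g x"
proof -
  have "0 \<le> g x - f x"
  proof (rule lim_at_right_le_of_deriv_nonneg[OF DERIV_diff[OF g(1) f(1)] _ _ x])
    show "((\<lambda>x. g x - f x) \<longlongrightarrow> 0) (at_right a)" using tendsto_diff[OF g(2) f(2)] by simp
  qed (use deriv_le in force)+
  moreover have "0 \<le> g x + f x"
  proof (rule lim_at_right_le_of_deriv_nonneg[OF DERIV_add[OF g(1) f(1)] _ _ x])
    show "((\<lambda>x. g x + f x) \<longlongrightarrow> 0) (at_right a)" using tendsto_add[OF g(2) f(2)] by simp
  qed (use deriv_le in force)+
  ultimately show ?thesis by linarith
qed

lemma abs_le_of_abs_deriv_le_at_top:
  fixes f g f' g' :: "real \<Rightarrow> real"
  assumes f: "\<And>x. x > a \<Longrightarrow> (f has_real_derivative f' x) (at x)" "(f \<longlongrightarrow> 0) at_top"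
    and g: "\<And>x. x > a \<Longrightarrow> (g has_real_derivative - g' x) (at x)" "(g \<longlongrightarrow> 0) at_top"
    and deriv_le: "\<And>x. x > a \<Longrightarrow> \<bar>f' x\<bar> \<le> g' x" and x: "x > a"
  shows "\<bar>f x\<bar> \<le> g x"
proof -
  have "0 \<le> g x - f x"
  proof (rule lim_at_top_le_of_deriv_nonpos[OF DERIV_diff[OF g(1) f(1)] _ _ x])
    show "((\<lambda>x. g x - f x) \<longlongrightarrow> 0) at_top" using tendsto_diff[OF g(2) f(2)] by simp
  qed (use deriv_le in force)+
  moreover have "0 \<le> g x + f x"
  proof (rule lim_at_top_le_of_deriv_nonpos[OF DERIV_add[OF g(1) f(1)] _ _ x])
    show "((\<lambda>x. g x + f x) \<longlongrightarrow> 0) at_top" using tendsto_add[OF g(2) f(2)] by simp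
  qed (use deriv_le in force)+
  ultimately show ?thesis by linarith
qed

lemma
  fixes F f :: "real \<Rightarrow> real"
  assumes F: "\<And>x. x > a \<Longrightarrow> (F has_real_derivative f x) (at x)" "(F \<longlongrightarrow> l) (at_right a)"
    and f: "\<And>x. x > a \<Longrightarrow> isCont f x" "\<And>x. x > a \<Longrightarrow> f x \<ge> 0" and b: "a < b"
  shows set_integrable_FTC_Ioc: "set_integrable lborel {a<..b} f"
    and set_integral_FTC_Ioc: "(LINT t:{a<..b}|lborel. f t) = F b - l"
proof -
  have "isCont F b" using F(1)[OF b] by (rule DERIV_isCont)
  then have "(F \<longlongrightarrow> F b) (at_left b)" by (simp add: isCont_def filterlim_at_split)
  then have "set_integrable lborel (einterval (ereal a) (ereal b)) f"
    and FTC: "(LBINT t=ereal a..ereal b. f t) = F b - l"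
    using assms by (intro interval_integral_FTC_nonneg; auto simp: ereal_tendsto_simps)+
  then have "set_integrable lborel {a<..<b} f" by simp
  moreover have "set_integrable lborel {b} f"
    using borel_integrable_compact[of "{b}" f]
    by (simp add: set_integrable_def indicator_def if_distrib)
  ultimately have "set_integrable lborel ({a<..<b} \<union> {b}) f"
    by (intro set_integrable_Un) auto
  also have "{a<..<b} \<union> {b} = {a<..b}" using b by auto
  finally show "set_integrable lborel {a<..b} f" .
  show "(LINT t:{a<..b}|lborel. f t) = F b - l"
    using FTC b by (simp add: interval_integral_Ioc)
qed

lemma
  fixes F f :: "real \<Rightarrow> real"
  assumes F: "\<And>x. x > a \<Longrightarrow> (F has_real_derivative - f x) (at x)" "(F \<longlongrightarrow> l) (at_right a)" "(F \<longlongrightarrow> 0) at_top"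
    and f: "\<And>x. x > a \<Longrightarrow> isCont f x" "\<And>x. x > a \<Longrightarrow> f x \<ge> 0"
  shows set_integrable_FTC_Ioi: "set_integrable lborel {a<..} f"
    and set_integral_FTC_Ioi: "(LINT t:{a<..}|lborel. f t) = l"
proof -
  have "((\<lambda>x. - F x) has_real_derivative f x) (at x)" if "x > a" for x
    using F(1)[OF that] by (auto intro!: derivative_eq_intros)
  moreover have "((\<lambda>x. - F x) \<longlongrightarrow> - l) (at_right a)" "((\<lambda>x. - F x) \<longlongrightarrow> 0) at_top"
    using F(2,3) by (auto intro!: tendsto_eq_intros)
  ultimately have "set_integrable lborel (einterval (ereal a) \<infinity>) f" "(LBINT t=ereal a..\<infinity>. f t) = 0 - (- l)"
    using f by (intro interval_integral_FTC_nonneg[where F = "\<lambda>x. - F x"]; auto simp: ereal_tendsto_simps)+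
  then show "set_integrable lborel {a<..} f" "(LINT t:{a<..}|lborel. f t) = l"
    by (simp_all add: interval_integral_to_infinity_eq)
qed

lemma
  fixes f :: "real \<Rightarrow> real"
  assumes [measurable]: "f \<in> borel_measurable borel"
  shows integrable_lborel_iff_half_lines:
      "integrable lborel f \<longleftrightarrow> set_integrable lborel {0<..} f \<and> set_integrable lborel {0<..} (\<lambda>t. f (- t))"
    and integral_lborel_half_lines: "integrable lborel f \<Longrightarrow>
      (LINT t|lborel. f t) = (LINT t:{0<..}|lborel. f t) + (LINT t:{0<..}|lborel. f (- t))"
proof -
  have AE_split: "AE t in lborel. f t = indicat_real {0<..} t * f t + indicat_real {..<0} t * f t"
    using AE_lborel_singleton[of 0] by eventually_elim (auto simp: indicator_def)
  have reflect: "(\<lambda>t. indicat_real {..<0} (0 + -1 * t) * f (0 + -1 * t)) = (\<lambda>t. indicat_real {0<..} t * f (- t))"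
    by (auto simp: indicator_def)
  have "integrable lborel f \<longleftrightarrow> integrable lborel (\<lambda>t. indicat_real {0<..} t * f t) \<and>
      integrable lborel (\<lambda>t. indicat_real {..<0} t * f t)"
  proof
    assume f: "integrable lborel f"
    show "integrable lborel (\<lambda>t. indicat_real {0<..} t * f t) \<and>
        integrable lborel (\<lambda>t. indicat_real {..<0} t * f t)"
      using integrable_mult_indicator[OF _ f] by auto
  next
    assume "integrable lborel (\<lambda>t. indicat_real {0<..} t * f t) \<and>
        integrable lborel (\<lambda>t. indicat_real {..<0} t * f t)"
    then show "integrable lborel f"
      by (subst integrable_cong_AE[OF _ _ AE_split]) auto
  qed
  also have "integrable lborel (\<lambda>t. indicat_real {..<0} t * f t) \<longleftrightarrow>
      integrable lborel (\<lambda>t. indicat_real {0<..} t * f (- t))"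
    unfolding reflect[symmetric] by (rule lborel_integrable_real_affine_iff[symmetric]) simp
  finally show "integrable lborel f \<longleftrightarrow> set_integrable lborel {0<..} f \<and>
      set_integrable lborel {0<..} (\<lambda>t. f (- t))"
    unfolding set_integrable_def by simp
  assume f: "integrable lborel f"
  have "(LINT t|lborel. f t) = (LINT t|lborel. indicat_real {0<..} t * f t + indicat_real {..<0} t * f t)"
    by (intro integral_cong_AE AE_split) auto
  also have "\<dots> = (LINT t|lborel. indicat_real {0<..} t * f t) + (LINT t|lborel. indicat_real {..<0} t * f t)"
    using integrable_mult_indicator[OF _ f] by (intro Bochner_Integration.integral_add) auto
  also have "(LINT t|lborel. indicat_real {..<0} t * f t) = (LINT t|lborel. indicat_real {0<..} t * f (- t))"
    using lborel_integral_real_affine[of "-1" "\<lambda>t. indicat_real {..<0} t * f t" 0] unfolding reflect by simp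
  finally show "(LINT t|lborel. f t) = (LINT t:{0<..}|lborel. f t) + (LINT t:{0<..}|lborel. f (- t))"
    unfolding set_lebesgue_integral_def by simp
qed

subsection \<open>Iterated derivatives\<close>

lemma has_nth_deriv_unique:
  assumes "has_nth_deriv f n x D" "has_nth_deriv f n x E"
  shows "D = E"
  using assms
proof (induction n arbitrary: x D E)
  case (Suc n)
  obtain g where g: "\<forall>\<^sub>F t in nhds x. has_nth_deriv f n t (g t)" "(g has_real_derivative D) (at x)"
    using Suc.prems(1) by auto
  obtain h where h: "\<forall>\<^sub>F t in nhds x. has_nth_deriv f n t (h t)" "(h has_real_derivative E) (at x)"
    using Suc.prems(2) by auto
  have "\<forall>\<^sub>F t in nhds x. g t = h t"
    using g(1) h(1) by eventually_elim (rule Suc.IH)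
  then have "(g has_real_derivative D) (at x) \<longleftrightarrow> (h has_real_derivative D) (at x)"
    by (intro DERIV_cong_ev refl)
  with g(2) h(2) show ?case using DERIV_unique by simp
qed simp

lemma has_nth_deriv_cong_ev:
  assumes "\<forall>\<^sub>F t in nhds x. f t = g t"
  shows "has_nth_deriv f n x D \<longleftrightarrow> has_nth_deriv g n x D"
  using assms
proof (induction n arbitrary: x D)
  case 0
  then have "f x = g x" by (rule eventually_nhds_x_imp_x)
  then show ?case by simp
next
  case (Suc n)
  have "\<forall>\<^sub>F t in nhds x. \<forall>\<^sub>F u in nhds t. f u = g u"
    using Suc.prems by (simp add: eventually_eventually)
  then have iff: "\<forall>\<^sub>F t in nhds x. \<forall>E. has_nth_deriv f n t E \<longleftrightarrow> has_nth_deriv g n t E"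
    by eventually_elim (use Suc.IH in blast)
  have "(\<forall>\<^sub>F t in nhds x. has_nth_deriv f n t (p t)) \<longleftrightarrow> (\<forall>\<^sub>F t in nhds x. has_nth_deriv g n t (p t))" for p
    by (rule eventually_cong[OF iff]) blast
  then show ?case by simp
qed

lemma has_nth_deriv_Suc_0_iff: "has_nth_deriv f (Suc 0) x D \<longleftrightarrow> (f has_real_derivative D) (at x)"
proof -
  have "(\<forall>\<^sub>F t in nhds x. g t = f t) \<and> (g has_real_derivative D) (at x) \<longleftrightarrow>
      (\<forall>\<^sub>F t in nhds x. g t = f t) \<and> (f has_real_derivative D) (at x)" for g
    by (intro conj_cong DERIV_cong_ev refl)
  then show ?thesis by (auto intro: exI[of _ f])
qed

lemma has_nth_deriv_Suc_iff:
  assumes "open S" "\<And>t. t \<in> S \<Longrightarrow> (f has_real_derivative f' t) (at t)" "x \<in> S"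
  shows "has_nth_deriv f (Suc n) x D \<longleftrightarrow> has_nth_deriv f' n x D"
  using assms(3)
proof (induction n arbitrary: x D)
  case 0
  show ?case
    unfolding has_nth_deriv_Suc_0_iff using assms(2)[OF 0] by (auto dest: DERIV_unique)
next
  case (Suc n)
  have "\<forall>\<^sub>F t in nhds x. t \<in> S" using assms(1) Suc.prems by (intro eventually_nhds_in_open)
  then have iff: "\<forall>\<^sub>F t in nhds x. \<forall>E. has_nth_deriv f (Suc n) t E \<longleftrightarrow> has_nth_deriv f' n t E"
    by eventually_elim (use Suc.IH in blast)
  have "(\<forall>\<^sub>F t in nhds x. has_nth_deriv f (Suc n) t (p t)) \<longleftrightarrow> (\<forall>\<^sub>F t in nhds x. has_nth_deriv f' n t (p t))" for p
    by (rule eventually_cong[OF iff]) blast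
  then show ?case
    unfolding has_nth_deriv.simps(2)[of f "Suc n"] has_nth_deriv.simps(2)[of f' n] by simp
qed

lemma has_nth_deriv_affine:
  assumes "has_nth_deriv f n (a + b * x) D"
  shows "has_nth_deriv (\<lambda>t. c * f (a + b * t)) n x (c * b ^ n * D)"
  using assms
proof (induction n arbitrary: x D)
  case (Suc n)
  obtain g where g: "\<forall>\<^sub>F t in nhds (a + b * x). has_nth_deriv f n t (g t)"
    "(g has_real_derivative D) (at (a + b * x))"
    using Suc.prems by auto
  have "filterlim (\<lambda>t. a + b * t) (nhds (a + b * x)) (nhds x)"
    by (intro tendsto_intros filterlim_ident)
  then have "\<forall>\<^sub>F t in nhds x. has_nth_deriv f n (a + b * t) (g (a + b * t))"
    using g(1) by (rule eventually_compose_filterlim[rotated])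
  then have "\<forall>\<^sub>F t in nhds x. has_nth_deriv (\<lambda>t. c * f (a + b * t)) n t (c * b ^ n * g (a + b * t))"
    by eventually_elim (rule Suc.IH)
  moreover have "((\<lambda>t. g (a + b * t)) has_real_derivative D * b) (at x)"
    by (rule DERIV_chain2[where g = "\<lambda>t. a + b * t", OF g(2)]) (auto intro!: derivative_eq_intros)
  from DERIV_cmult[OF this, of "c * b ^ n"]
  have "((\<lambda>t. c * b ^ n * g (a + b * t)) has_real_derivative c * b ^ Suc n * D) (at x)"
    by (simp add: mult_ac)
  ultimately show ?case by auto
qed simp

lemma has_nth_deriv_affine_iff:
  assumes "b \<noteq> 0" "c \<noteq> 0"
  shows "has_nth_deriv (\<lambda>t. c * f (a + b * t)) n x D \<longleftrightarrow> has_nth_deriv f n (a + b * x) (D / (c * b ^ n))"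
proof
  assume "has_nth_deriv f n (a + b * x) (D / (c * b ^ n))"
  from has_nth_deriv_affine[OF this, of c] show "has_nth_deriv (\<lambda>t. c * f (a + b * t)) n x D"
    using assms by simp
next
  assume D: "has_nth_deriv (\<lambda>t. c * f (a + b * t)) n x D"
  have inv: "- a / b + 1 / b * (a + b * t) = t" for t
    using assms by (simp add: field_simps)
  have inv': "a + b * (- a / b + 1 / b * t) = t" for t
    using assms by (simp add: field_simps)
  have "has_nth_deriv (\<lambda>t. 1 / c * (c * f (a + b * (- a / b + 1 / b * t)))) n (a +
      b * x) (1 / c * (1 / b) ^ n * D)"
    by (rule has_nth_deriv_affine[where f = "\<lambda>t. c * f (a + b * t)"]) (unfold inv, fact D)
  then show "has_nth_deriv f n (a + b * x) (D / (c * b ^ n))"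
    unfolding inv' using assms by (simp add: power_divide)
qed

lemma abs_deriv_le_of_punctured:
  fixes f :: "real \<Rightarrow> real"
  assumes D: "(f has_real_derivative D) (at x)"
    and bound: "\<forall>\<^sub>F t in at x. \<exists>E. (f has_real_derivative E) (at t) \<and> \<bar>E\<bar> \<le> M"
  shows "\<bar>D\<bar> \<le> M"
proof (rule abs_deriv_le_of_increment[OF D])
  obtain d where d: "d > 0" "\<And>t. t \<noteq> x \<Longrightarrow> \<bar>t - x\<bar> < d \<Longrightarrow> \<exists>E. (f has_real_derivative E) (at t) \<and> \<bar>E\<bar> \<le> M"
    using bound unfolding eventually_at dist_real_def by auto
  have cont: "isCont f t" if "\<bar>t - x\<bar> < d" for t
    using that d(2)[of t] D by (cases "t = x") (auto intro: DERIV_isCont)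
  have incr: "\<bar>f b - f a\<bar> \<le> M * \<bar>b - a\<bar>" if "a < b" "a = x \<or> b = x" "\<bar>a - x\<bar> < d" "\<bar>b - x\<bar> < d" for a b
  proof -
    have "\<exists>l z. a < z \<and> z < b \<and> (f has_real_derivative l) (at z) \<and> f b - f a = (b - a) * l"
    proof (rule MVT[OF \<open>a < b\<close>])
      show "continuous_on {a..b} f"
        using that by (intro continuous_at_imp_continuous_on ballI cont) auto
      fix t assume "a < t" "t < b"
      then have "t \<noteq> x" "\<bar>t - x\<bar> < d" using that by auto
      then show "f differentiable at t" using d(2) unfolding real_differentiable_def by blast
    qed
    then obtain l z where z: "a < z" "z < b" "(f has_real_derivative l) (at z)" "f b - f a = (b - a) * l"
      by blast
    then have "z \<noteq> x" "\<bar>z - x\<bar> < d" using that by auto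
    then have "\<bar>l\<bar> \<le> M" using d(2) z(3) DERIV_unique by blast
    then show ?thesis unfolding z(4) abs_mult by (simp add: mult.commute mult_right_mono)
  qed
  show "\<forall>\<^sub>F z in at x. \<bar>f z - f x\<bar> \<le> M * \<bar>z - x\<bar>"
    unfolding eventually_at
  proof (intro exI[of _ d] conjI ballI impI d(1))
    fix z assume "z \<noteq> x \<and> dist z x < d"
    then show "\<bar>f z - f x\<bar> \<le> M * \<bar>z - x\<bar>"
      using incr[of x z] incr[of z x] d(1) by (cases "x < z") (auto simp: dist_real_def abs_minus_commute)
  qed
qed

lemma abs_nth_deriv_le_of_punctured:
  assumes D: "has_nth_deriv f (Suc n) x D"
    and bound: "\<forall>\<^sub>F t in at x. \<exists>E. has_nth_deriv f (Suc n) t E \<and> \<bar>E\<bar> \<le> M"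
  shows "\<bar>D\<bar> \<le> M"
proof -
  obtain g where g: "\<forall>\<^sub>F t in nhds x. has_nth_deriv f n t (g t)" "(g has_real_derivative D) (at x)"
    using D by auto
  have "\<forall>\<^sub>F t in at x. \<forall>\<^sub>F u in nhds t. has_nth_deriv f n u (g u)"
    using g(1) by (subst (asm) eventually_eventually[symmetric])
        (auto simp: eventually_at_filter elim: eventually_mono)
  with bound have "\<forall>\<^sub>F t in at x. \<exists>E. (g has_real_derivative E) (at t) \<and> \<bar>E\<bar> \<le> M"
  proof eventually_elim
    case (elim t)
    then obtain E h where E: "\<bar>E\<bar> \<le> M" "(h has_real_derivative E) (at t)"
      and h: "\<forall>\<^sub>F u in nhds t. has_nth_deriv f n u (h u)"
      by auto
    have "\<forall>\<^sub>F u in nhds t. h u = g u"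
      using h elim(2) by eventually_elim (rule has_nth_deriv_unique)
    then have "(h has_real_derivative E) (at t) \<longleftrightarrow> (g has_real_derivative E) (at t)"
      by (intro DERIV_cong_ev refl)
    with E show ?case by blast
  qed
  then show ?thesis by (rule abs_deriv_le_of_punctured[OF g(2)])
qed

subsection \<open>The modified Bessel function of the second kind\<close>

lemma borel_measurable_cosh [measurable]: "(cosh :: real \<Rightarrow> real) \<in> borel_measurable borel"
  by (intro borel_measurable_continuous_onI continuous_intros)

lemma set_integrable_exp_uminus: "set_integrable lborel {0<..} (\<lambda>t::real. exp (- t))"
proof (rule set_integrable_FTC_Ioi[where F = "\<lambda>t. exp (- t)" and l = 1])
  show "((\<lambda>t::real. exp (- t)) \<longlongrightarrow> 1) (at_right 0)"
    by (auto intro!: tendsto_eq_intros)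
  show "((\<lambda>t::real. exp (- t)) \<longlongrightarrow> 0) at_top"
    by (rule filterlim_compose[OF exp_at_bot filterlim_uminus_at_bot_at_top])
qed (auto intro!: derivative_eq_intros continuous_intros)

lemma cosh_le_exp_abs: "cosh x \<le> exp \<bar>x\<bar>" for x :: real
proof -
  have "(exp x + exp (- x)) / 2 \<le> (exp \<bar>x\<bar> + exp \<bar>x\<bar>) / 2"
    by (intro divide_right_mono add_mono) auto
  then show ?thesis by (simp add: cosh_field_def)
qed

lemma bessel_K_integrand_le:
  fixes x \<nu> :: real
  assumes x: "x > 0"
  obtains C where "\<And>t. t \<ge> 0 \<Longrightarrow> exp (- (x * cosh t)) * cosh (\<nu> * t) \<le> C * exp (- t)"
proof
  define n where "n = \<bar>\<nu>\<bar> + 1"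
  define c where "c = ln (2 * n / x)"
  fix t :: real assume t: "t \<ge> 0"
  have n: "n > 0" unfolding n_def by simp
  have "n * (1 + (t - c)) \<le> n * exp (t - c)"
    using n by (intro mult_left_mono exp_ge_add_one_self) auto
  also have "\<dots> = x * (exp t / 2)"
    unfolding c_def using n x by (simp add: exp_diff field_simps)
  also have "\<dots> \<le> x * cosh t"
    using x by (intro mult_left_mono) (auto simp: cosh_def)
  finally have "exp (- (x * cosh t)) * cosh (\<nu> * t) \<le> exp (- (n * (1 + (t - c)))) * exp \<bar>\<nu> * t\<bar>"
    by (intro mult_mono cosh_le_exp_abs) auto
  also have "\<dots> = exp (- (n * (1 - c))) * exp (- t)"
    unfolding n_def using t by (simp add: abs_mult algebra_simps flip: exp_add)
  finally show "exp (- (x * cosh t)) * cosh (\<nu> * t) \<le> exp (- (n * (1 - c))) * exp (- t)" .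
qed

lemma set_integrable_bessel_K:
  fixes x \<nu> :: real
  assumes "x > 0"
  shows "set_integrable lborel {0<..} (\<lambda>t. exp (- (x * cosh t)) * cosh (\<nu> * t))"
proof -
  obtain C where C: "\<And>t. t \<ge> 0 \<Longrightarrow> exp (- (x * cosh t)) * cosh (\<nu> * t) \<le> C * exp (- t)"
    using bessel_K_integrand_le[OF assms] by blast
  have "set_integrable lborel {0<..} (\<lambda>t. C * exp (- t))"
    by (intro set_integrable_mult_right set_integrable_exp_uminus)
  then show ?thesis
    by (rule set_integrable_abs_bound) (use C in \<open>auto simp: abs_mult\<close>)
qed

lemma bessel_K_eq: "bessel_K \<nu> x = (LINT t:{0<..}|lborel. exp (- (x * cosh t)) * cosh (\<nu> * t))"
  unfolding bessel_K_def set_lebesgue_integral_def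
proof (rule integral_cong_AE)
  show "AE t in lborel. indicat_real {0..} t *\<^sub>R (exp (- x * cosh t) * cosh (\<nu> * t)) =
      indicat_real {0<..} t *\<^sub>R (exp (- (x * cosh t)) * cosh (\<nu> * t))"
    using AE_lborel_singleton[of 0] by eventually_elim (auto simp: indicator_def)
qed measurable

lemma bessel_K_nonneg: "bessel_K \<nu> x \<ge> 0"
  unfolding bessel_K_def set_lebesgue_integral_def by (intro Bochner_Integration.integral_nonneg) simp

lemma bessel_K_mono_order:
  assumes "x > 0" "\<bar>\<nu>\<bar> \<le> \<bar>\<mu>\<bar>"
  shows "bessel_K \<nu> x \<le> bessel_K \<mu> x"
  unfolding bessel_K_eq
proof (rule set_integral_mono)
  fix t :: real assume t: "t \<in> {0<..}"
  have "cosh \<bar>\<nu> * t\<bar> \<le> cosh \<bar>\<mu> * t\<bar>"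
    using assms t by (subst cosh_real_nonneg_le_iff) (auto simp: abs_mult)
  then show "exp (- (x * cosh t)) * cosh (\<nu> * t) \<le> exp (- (x * cosh t)) * cosh (\<mu> * t)" by simp
qed (intro set_integrable_bessel_K assms)+

lemma bessel_K_decay:
  assumes "x \<ge> 1"
  shows "bessel_K \<nu> x \<le> exp (1 - x) * bessel_K \<nu> 1"
proof -
  have "bessel_K \<nu> x \<le> (LINT t:{0<..}|lborel. exp (1 - x) * (exp (- (1 * cosh t)) * cosh (\<nu> * t)))"
    unfolding bessel_K_eq
  proof (rule set_integral_mono)
    fix t :: real
    have "(x - 1) * 1 \<le> (x - 1) * cosh t"
      using assms cosh_real_ge_1[of t] by (intro mult_left_mono) auto
    then have "exp (- (x * cosh t)) \<le> exp (1 - x) * exp (- (1 * cosh t))"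
      by (simp add: algebra_simps flip: exp_add)
    then show "exp (- (x * cosh t)) * cosh (\<nu> * t) \<le> exp (1 - x) * (exp (- (1 * cosh t)) * cosh (\<nu> * t))"
      by (simp flip: mult.assoc)
  qed (use assms in \<open>intro set_integrable_bessel_K set_integrable_mult_right; simp\<close>)+
  also have "\<dots> = exp (1 - x) * bessel_K \<nu> 1"
    unfolding bessel_K_eq by (rule set_integral_mult_right)
  finally show ?thesis .
qed

lemma has_real_derivative_bessel_K:
  assumes x: "x > 0"
  shows "(bessel_K \<nu> has_real_derivative - (bessel_K (\<nu> - 1) x + bessel_K (\<nu> + 1) x) / 2) (at x)"
proof -
  define w where "w = (\<lambda>t. indicator {0<..} t * cosh (\<nu> * t) :: real)"
  have K: "bessel_K \<nu> = (\<lambda>x. LINT t|lborel. w t * exp (- (x * cosh t)))"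
    unfolding bessel_K_eq w_def set_lebesgue_integral_def by (simp add: ac_simps)
  have "(bessel_K \<nu> has_real_derivative - (LINT t|lborel. w t * cosh t * exp (- (x * cosh t)))) (at x)"
    unfolding K
  proof (rule has_real_derivative_laplace[OF _ _ _ _ x])
    show "integrable lborel (\<lambda>t. w t * exp (- (z * cosh t)))" if "z > 0" for z
      using set_integrable_bessel_K[OF that, of \<nu>] unfolding w_def set_integrable_def by (simp add: ac_simps)
  qed (auto simp: w_def)
  also have "(LINT t|lborel. w t * cosh t * exp (- (x * cosh t))) =
      (LINT t:{0<..}|lborel. (exp (- (x * cosh t)) * cosh ((\<nu> - 1) * t) +
          exp (- (x * cosh t)) * cosh ((\<nu> + 1) * t)) / 2)"
    unfolding set_lebesgue_integral_def w_def
    by (intro Bochner_Integration.integral_cong refl)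
      (simp add: algebra_simps cosh_add cosh_diff)
  also have "\<dots> = (bessel_K (\<nu> - 1) x + bessel_K (\<nu> + 1) x) / 2"
    unfolding bessel_K_eq by (simp add: set_integrable_bessel_K[OF x])
  finally show ?thesis by (simp only: minus_divide_left)
qed

lemma bessel_K_recurrence:
  assumes x: "x > 0"
  shows "bessel_K (\<nu> + 1) x = bessel_K (\<nu> - 1) x + 2 * \<nu> / x * bessel_K \<nu> x"
proof -
  let ?e = "\<lambda>p t. exp (- (x * cosh t)) * cosh (p * t)"
  let ?F = "\<lambda>t. exp (- (x * cosh t)) * sinh (\<nu> * t)"
  let ?f = "\<lambda>t. \<nu> * ?e \<nu> t + x / 2 * ?e (\<nu> - 1) t - x / 2 * ?e (\<nu> + 1) t"
  obtain C where C: "\<And>t. t \<ge> 0 \<Longrightarrow> ?e \<nu> t \<le> C * exp (- t)"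
    using bessel_K_integrand_le[OF x] by blast
  have "(LBINT t=ereal 0..\<infinity>. ?f t) = 0 - 0"
  proof (rule interval_integral_FTC_integrable[where F = ?F])
    have "(?F has_real_derivative ?f t) (at t)" for t
      by (auto intro!: derivative_eq_intros simp: algebra_simps cosh_add cosh_diff)
    then show "(?F has_vector_derivative ?f t) (at t)" for t
      by (simp only: has_real_derivative_iff_has_vector_derivative)
    show "set_integrable lborel (einterval (ereal 0) \<infinity>) ?f"
      by (simp add: set_integrable_bessel_K[OF x])
    show "((?F \<circ> real_of_ereal) \<longlongrightarrow> 0) (at_right (ereal 0))"
      unfolding ereal_tendsto_simps by (auto intro!: tendsto_eq_intros)
    have "(?F \<longlongrightarrow> 0) at_top"
    proof (rule Lim_null_comparison)
      show "((\<lambda>t. C * exp (- t)) \<longlongrightarrow> 0) at_top"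
        by (intro tendsto_mult_right_zero filterlim_compose[OF exp_at_bot filterlim_uminus_at_bot_at_top])
      show "\<forall>\<^sub>F t in at_top. norm (?F t) \<le> C * exp (- t)"
        using eventually_ge_at_top[of 0]
      proof eventually_elim
        case (elim t)
        have "\<bar>sinh (\<nu> * t)\<bar> \<le> cosh (\<nu> * t)" by (simp add: sinh_def cosh_def abs_le_iff field_simps)
        then have "norm (?F t) \<le> ?e \<nu> t" by (simp add: abs_mult)
        also have "\<dots> \<le> C * exp (- t)" by (rule C[OF elim])
        finally show ?case .
      qed
    qed
    then show "((?F \<circ> real_of_ereal) \<longlongrightarrow> 0) (at_left \<infinity>)" unfolding ereal_tendsto_simps .
  qed (auto intro!: continuous_intros)
  then have "0 = (LINT t:{0<..}|lborel. ?f t)" by (simp add: interval_integral_to_infinity_eq)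
  also have "\<dots> = \<nu> * bessel_K \<nu> x + x / 2 * bessel_K (\<nu> - 1) x - x / 2 * bessel_K (\<nu> + 1) x"
    unfolding bessel_K_eq by (simp add: set_integrable_bessel_K[OF x])
  finally show ?thesis using x by (simp add: field_simps)
qed

lemma
  fixes \<mu> :: real
  assumes "\<mu> > 0"
  shows set_integrable_Gamma: "set_integrable lborel {0<..} (\<lambda>s. s powr (\<mu> - 1) * exp (- s))"
    and set_integral_Gamma: "(LINT s:{0<..}|lborel. s powr (\<mu> - 1) * exp (- s)) = Gamma \<mu>"
proof -
  have "has_bochner_integral lborel (\<lambda>s. indicator {0<..} s *\<^sub>R (s powr (\<mu> - 1) * exp (- s))) (Gamma \<mu>)"
  proof (rule has_bochner_integral_nn_integral)
    have "ennreal (Gamma \<mu>) = (\<integral>\<^sup>+s. ennreal (indicator {0..} s * s powr (\<mu> - 1) / exp s) \<partial>lborel)"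
      using Gamma_conv_nn_integral_real[OF assms] by (simp add: nn_integral_completion)
    also have "\<dots> = (\<integral>\<^sup>+s. ennreal (indicator {0<..} s *\<^sub>R (s powr (\<mu> - 1) * exp (- s))) \<partial>lborel)"
      by (intro nn_integral_cong) (auto simp: indicator_def exp_minus field_simps)
    finally show "(\<integral>\<^sup>+s. ennreal (indicator {0<..} s *\<^sub>R (s powr (\<mu> - 1) * exp (- s))) \<partial>lborel) =
        ennreal (Gamma \<mu>)" ..
  qed (use assms in \<open>auto intro!: AE_I2 simp: less_imp_le Gamma_real_pos\<close>)
  then show "set_integrable lborel {0<..} (\<lambda>s. s powr (\<mu> - 1) * exp (- s))"
    "(LINT s:{0<..}|lborel. s powr (\<mu> - 1) * exp (- s)) = Gamma \<mu>"
    unfolding set_integrable_def set_lebesgue_integral_def by (auto simp: has_bochner_integral_iff)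
qed

lemma
  assumes x: "x > 0"
  shows integrable_bessel_K_UNIV: "integrable lborel (\<lambda>t. exp (\<nu> * t - x * cosh t))"
    and integral_bessel_K_UNIV: "(LINT t|lborel. exp (\<nu> * t - x * cosh t)) = 2 * bessel_K \<nu> x"
proof -
  let ?f = "\<lambda>t. exp (\<nu> * t - x * cosh t)" and ?e = "\<lambda>t. exp (- (x * cosh t)) * cosh (\<nu> * t)"
  have sum: "?f t + ?f (- t) = 2 * ?e t" for t
    by (simp add: cosh_field_def[of "\<nu> * t"] exp_diff exp_minus field_simps)
  have dominating: "set_integrable lborel {0<..} (\<lambda>t. 2 * ?e t)"
    by (intro set_integrable_mult_right set_integrable_bessel_K x)
  have "?f t \<le> 2 * ?e t" "?f (- t) \<le> 2 * ?e t" for t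
    unfolding sum[symmetric] by simp_all
  then have halves: "set_integrable lborel {0<..} ?f" "set_integrable lborel {0<..} (\<lambda>t. ?f (- t))"
    by (auto intro: set_integrable_abs_bound[OF dominating])
  then show int: "integrable lborel ?f"
    by (subst integrable_lborel_iff_half_lines) auto
  have "(LINT t|lborel. ?f t) = (LINT t:{0<..}|lborel. ?f t) + (LINT t:{0<..}|lborel. ?f (- t))"
    by (intro integral_lborel_half_lines int) simp
  also have "\<dots> = (LINT t:{0<..}|lborel. ?f t + ?f (- t))"
    using halves by (rule set_integral_add(2)[symmetric])
  finally show "(LINT t|lborel. ?f t) = 2 * bessel_K \<nu> x"
    unfolding sum bessel_K_eq by simp
qed

lemma
  fixes \<mu> x :: real
  assumes x: "x > 0"
  shows set_integrable_bessel_K_Gamma_form: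
      "set_integrable lborel {0<..} (\<lambda>s. s powr (\<mu> - 1) * exp (- s - x\<^sup>2 / (4 * s)))"
    and bessel_K_Gamma_form:
      "x powr \<mu> * bessel_K \<mu> x =
          2 powr (\<mu> - 1) * (LINT s:{0<..}|lborel. s powr (\<mu> - 1) * exp (- s - x\<^sup>2 / (4 * s)))"
proof -
  let ?f = "\<lambda>s. s powr (\<mu> - 1) * exp (- s - x\<^sup>2 / (4 * s))" and ?g = "\<lambda>t. x / 2 * exp t"
  have fg: "?f (?g t) * ?g t = (x / 2) powr \<mu> * exp (\<mu> * t - x * cosh t)" for t
  proof -
    have exponent: "- ?g t - x\<^sup>2 / (4 * ?g t) = - (x * cosh t)"
      using x by (simp add: cosh_field_def exp_minus field_simps power2_eq_square)
    have "?f (?g t) * ?g t = ?g t powr (\<mu> - 1) * ?g t * exp (- (x * cosh t))"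
      unfolding exponent by (simp only: mult_ac)
    also have "?g t powr (\<mu> - 1) * ?g t = ?g t powr \<mu>" using x by (simp add: powr_diff)
    also have "\<dots> = (x / 2) powr \<mu> * exp (\<mu> * t)"
      by (subst powr_mult) (simp add: powr_def mult.commute)
    finally show ?thesis by (simp add: mult.assoc flip: exp_add)
  qed
  have lim0: "((ereal \<circ> ?g \<circ> real_of_ereal) \<longlongrightarrow> ereal 0) (at_right (- \<infinity>))"
    using tendsto_mult_right_zero[OF exp_at_bot, of "x / 2"] by (simp add: ereal_tendsto_simps)
  have "filterlim ?g at_top at_top"
    using x by (intro filterlim_tendsto_pos_mult_at_top[OF tendsto_const _ exp_at_top]) auto
  then have limtop: "((ereal \<circ> ?g \<circ> real_of_ereal) \<longlongrightarrow> \<infinity>) (at_left \<infinity>)"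
    by (simp add: ereal_tendsto_simps)
  have einterval_UNIV: "einterval (- \<infinity>) \<infinity> = UNIV" by (simp add: einterval_def)
  have int: "set_integrable lborel (einterval (- \<infinity>) \<infinity>) (\<lambda>t. ?f (?g t) * ?g t)"
    unfolding fg using integrable_bessel_K_UNIV[OF x] by (simp add: einterval_UNIV set_integrable_def)
  note substitution = interval_integral_substitution_nonneg
    [where f = ?f and g = ?g and g' = ?g, OF _ _ _ _ _ _ lim0 limtop int]
  have "set_integrable lborel (einterval (ereal 0) \<infinity>) ?f"
    by (rule substitution(1)) (use x in \<open>auto intro!: derivative_eq_intros continuous_intros\<close>)
  then show "set_integrable lborel {0<..} ?f" by simp
  have "(LBINT s=ereal 0..\<infinity>. ?f s) = (LBINT t=-\<infinity>..\<infinity>. ?f (?g t) * ?g t)"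
    by (rule substitution(2)) (use x in \<open>auto intro!: derivative_eq_intros continuous_intros\<close>)
  then have "(LINT s:{0<..}|lborel. ?f s) = (x / 2) powr \<mu> * (2 * bessel_K \<mu> x)"
    using integral_bessel_K_UNIV[OF x] unfolding fg interval_integral_to_infinity_eq
    by (simp add: interval_lebesgue_integral_def einterval_UNIV set_lebesgue_integral_def)
  then show "x powr \<mu> * bessel_K \<mu> x = 2 powr (\<mu> - 1) * (LINT s:{0<..}|lborel. ?f s)"
    using x by (simp add: powr_divide powr_diff)
qed

lemma bessel_K_le_Gamma:
  fixes \<mu> x :: real
  assumes \<mu>: "\<mu> > 0" and x: "x > 0"
  shows "x powr \<mu> * bessel_K \<mu> x \<le> 2 powr (\<mu> - 1) * Gamma \<mu>"
  unfolding bessel_K_Gamma_form[OF x] set_integral_Gamma[OF \<mu>, symmetric]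
  by (intro mult_left_mono set_integral_mono set_integrable_bessel_K_Gamma_form set_integrable_Gamma \<mu> x)
    (auto intro!: mult_left_mono)

lemma bessel_K_at_0:
  fixes \<mu> :: real
  assumes \<mu>: "\<mu> > 0"
  shows "((\<lambda>x. x powr \<mu> * bessel_K \<mu> x) \<longlongrightarrow> 2 powr (\<mu> - 1) * Gamma \<mu>) (at_right 0)"
proof -
  let ?J = "\<lambda>x. (LINT s:{0<..}|lborel. s powr (\<mu> - 1) * exp (- s - x\<^sup>2 / (4 * s)))"
  have "(?J \<longlongrightarrow> Gamma \<mu>) (at_right 0)"
    unfolding set_integral_Gamma[OF \<mu>, symmetric] set_lebesgue_integral_def
  proof (rule integral_dominated_convergence_at_within)
    show "integrable lborel (\<lambda>s. indicator {0<..} s *\<^sub>R (s powr (\<mu> - 1) * exp (- s)))"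
      using set_integrable_Gamma[OF \<mu>] by (simp add: set_integrable_def)
    show "((\<lambda>x. indicat_real {0<..} s *\<^sub>R (s powr (\<mu> - 1) * exp (- s - x\<^sup>2 / (4 * s))))
        \<longlongrightarrow> indicat_real {0<..} s *\<^sub>R (s powr (\<mu> - 1) * exp (- s))) (at_right 0)" for s :: real
      by (cases "s > 0") (auto intro!: tendsto_eq_intros)
  qed (auto simp: indicator_def abs_mult intro!: mult_left_mono)
  then have "((\<lambda>x. 2 powr (\<mu> - 1) * ?J x) \<longlongrightarrow> 2 powr (\<mu> - 1) * Gamma \<mu>) (at_right 0)"
    by (intro tendsto_intros)
  moreover have "\<forall>\<^sub>F x in at_right 0. 2 powr (\<mu> - 1) * ?J x = x powr \<mu> * bessel_K \<mu> x"
    using eventually_at_right_less[of 0] by eventually_elim (simp add: bessel_K_Gamma_form)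
  ultimately show ?thesis by (rule Lim_transform_eventually)
qed

subsection \<open>Normalised Bessel functions\<close>

text \<open>
  With \<open>\<nu> = (r - 1) / 2\<close>, the functions \<open>nbessel_I r\<close> and \<open>nbessel_K r\<close> are \<open>x\<^sup>-\<^sup>\<nu> I\<^sub>\<nu>\<close> and \<open>x\<^sup>-\<^sup>\<nu> K\<^sub>\<nu>\<close>,
  so that raising \<open>\<nu>\<close> by one raises \<open>r\<close> by two. At \<open>x = 0\<close> the series gives the limit of \<open>x\<^sup>-\<^sup>\<nu> I\<^sub>\<nu>\<close>, but
  \<open>nbessel_K r 0 = 0\<close> is a junk value.
\<close>

definition nbessel_I_coeff :: "real \<Rightarrow> nat \<Rightarrow> real" where
  "nbessel_I_coeff r k = 2 powr ((1 - r) / 2) / (4 ^ k * Gamma ((r + 1) / 2 + real k) * fact k)"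

definition nbessel_I :: "real \<Rightarrow> real \<Rightarrow> real" where
  "nbessel_I r x = (\<Sum>k. nbessel_I_coeff r k * (x\<^sup>2) ^ k)"

definition nbessel_K :: "real \<Rightarrow> real \<Rightarrow> real" where
  "nbessel_K r x = x powr ((1 - r) / 2) * bessel_K ((r - 1) / 2) x"

lemma powr_half_add2:
  fixes x r :: real
  assumes "x > 0"
  shows "x powr ((1 - (r + 2)) / 2) = x powr ((1 - r) / 2) / x"
proof -
  have "(1 - (r + 2)) / 2 = (1 - r) / 2 - 1" by (simp add: field_simps)
  then show ?thesis using assms by (simp only: powr_diff powr_one)
qed

lemma nbessel_I_coeff_pos: "r > - 1 \<Longrightarrow> nbessel_I_coeff r k > 0"
  unfolding nbessel_I_coeff_def by (intro divide_pos_pos mult_pos_pos Gamma_real_pos) (auto intro: add_pos_nonneg)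

lemma nbessel_I_coeff_eq_add2:
  assumes "r > - 1"
  shows "nbessel_I_coeff r k = (r + 1 + 2 * real k) * nbessel_I_coeff (r + 2) k"
proof -
  define g where "g = (r + 1) / 2 + real k"
  have g: "g > 0" "r + 1 + 2 * real k = 2 * g" "(r + 2 + 1) / 2 + real k = g + 1"
    unfolding g_def using assms by (simp_all add: field_simps add_pos_nonneg)
  have "Gamma (g + 1) = g * Gamma g" using g(1) by (intro Gamma_plus1) (auto elim!: nonpos_Ints_cases)
  then show ?thesis
    unfolding nbessel_I_coeff_def g(2,3) g_def[symmetric] powr_half_add2[OF zero_less_numeral] using g(1) by simp
qed

lemma nbessel_I_coeff_Suc: "2 * real (Suc k) * nbessel_I_coeff r (Suc k) = nbessel_I_coeff (r + 2) k"
proof -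
  have shift: "(r + 2 + 1) / 2 + real k = (r + 1) / 2 + real (Suc k)" by (simp add: field_simps)
  show ?thesis
    unfolding nbessel_I_coeff_def fact_Suc power_Suc powr_half_add2[OF zero_less_numeral] shift
    by (simp add: field_simps del: of_nat_Suc)
qed

lemma nbessel_I_coeff_le:
  assumes "r > - 1"
  shows "nbessel_I_coeff r k \<le> nbessel_I_coeff r 0 * inverse (fact k) * (1 / (2 * (r + 1))) ^ k"
proof (induction k)
  case (Suc k)
  define q where "q = 1 / (2 * (r + 1))"
  have k: "real (Suc k) > 0" "r + 1 > 0" using assms by auto
  have pos: "nbessel_I_coeff r (Suc k) > 0" using assms by (rule nbessel_I_coeff_pos)
  have "(r + 1) * (2 * real (Suc k) * nbessel_I_coeff r (Suc k)) \<le>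
      (r + 1 + 2 * real k) * (2 * real (Suc k) * nbessel_I_coeff r (Suc k))"
    using k pos by (intro mult_right_mono) auto
  also have "\<dots> = nbessel_I_coeff r k"
    unfolding nbessel_I_coeff_Suc nbessel_I_coeff_eq_add2[OF assms, of k] ..
  finally have "nbessel_I_coeff r (Suc k) * (2 * (r + 1) * real (Suc k)) \<le> nbessel_I_coeff r k"
    by (simp only: mult_ac)
  then have "nbessel_I_coeff r (Suc k) \<le> nbessel_I_coeff r k / (2 * (r + 1) * real (Suc k))"
    using k by (subst pos_le_divide_eq) auto
  also have "\<dots> = nbessel_I_coeff r k * (q / real (Suc k))"
    unfolding q_def by simp
  also have "\<dots> \<le> nbessel_I_coeff r 0 * inverse (fact k) * q ^ k * (q / real (Suc k))"
    using Suc k unfolding q_def by (intro mult_right_mono) auto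
  also have "\<dots> = nbessel_I_coeff r 0 * inverse (fact (Suc k)) * q ^ Suc k"
    by (simp add: field_simps)
  finally show ?case unfolding q_def .
qed simp

lemma summable_nbessel_I:
  assumes "r > - 1"
  shows "summable (\<lambda>k. nbessel_I_coeff r k * z ^ k)"
proof (rule summable_comparison_test')
  define q where "q = 1 / (2 * (r + 1))"
  show "summable (\<lambda>k. nbessel_I_coeff r 0 * (inverse (fact k) * (q * \<bar>z\<bar>) ^ k))"
    by (intro summable_mult summable_exp)
  show "norm (nbessel_I_coeff r k * z ^ k) \<le> nbessel_I_coeff r 0 * (inverse (fact k) * (q * \<bar>z\<bar>) ^ k)"
    if "k \<ge> 0" for k
    using mult_right_mono[OF nbessel_I_coeff_le[OF assms, of k], of "\<bar>z\<bar> ^ k"] nbessel_I_coeff_pos[OF assms, of k]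
    unfolding q_def[symmetric] by (simp add: abs_mult power_abs power_mult_distrib mult_ac)
qed

lemma has_real_derivative_nbessel_I:
  assumes "r > - 1"
  shows "(nbessel_I r has_real_derivative x * nbessel_I (r + 2) x) (at x)"
proof -
  have diffs: "diffs (nbessel_I_coeff r) k = 1 / 2 * nbessel_I_coeff (r + 2) k" for k
    unfolding diffs_def nbessel_I_coeff_Suc[symmetric] by simp
  have "((\<lambda>z. \<Sum>k. nbessel_I_coeff r k * z ^ k) has_real_derivative (\<Sum>k. diffs (nbessel_I_coeff r) k * (x\<^sup>2) ^ k))
      (at (x\<^sup>2))"
    by (rule termdiffs_strong_converges_everywhere) (rule summable_nbessel_I[OF assms])
  also have "(\<Sum>k. diffs (nbessel_I_coeff r) k * (x\<^sup>2) ^ k) = 1 / 2 * nbessel_I (r + 2) x"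
    unfolding nbessel_I_def diffs mult.assoc using assms by (intro suminf_mult summable_nbessel_I) simp
  finally have "((\<lambda>x. \<Sum>k. nbessel_I_coeff r k * (x\<^sup>2) ^ k) has_real_derivative
      1 / 2 * nbessel_I (r + 2) x * (2 * x))
      (at x)"
    by (rule DERIV_chain2) (auto intro!: derivative_eq_intros)
  then show ?thesis unfolding nbessel_I_def by (simp add: ac_simps)
qed

lemma isCont_nbessel_I: "r > - 1 \<Longrightarrow> isCont (nbessel_I r) x"
  by (rule DERIV_isCont[OF has_real_derivative_nbessel_I])

lemma borel_measurable_nbessel_I [measurable]: "r > - 1 \<Longrightarrow> nbessel_I r \<in> borel_measurable borel"
  by (intro borel_measurable_continuous_onI continuous_at_imp_continuous_on ballI isCont_nbessel_I)

lemma nbessel_I_recurrence: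
  assumes r: "r > - 1"
  shows "nbessel_I r x = (r + 1) * nbessel_I (r + 2) x + x\<^sup>2 * nbessel_I (r + 4) x"
proof -
  let ?c = "nbessel_I_coeff (r + 2)" and ?z = "x\<^sup>2"
  have summable_add2: "summable (\<lambda>k. ?c k * ?z ^ k)"
    and summable_add4: "summable (\<lambda>k. nbessel_I_coeff (r + 4) k * ?z ^ k)"
    using r by (auto intro: summable_nbessel_I)
  have shift: "2 * real (Suc k) * ?c (Suc k) * ?z ^ Suc k = ?z * (nbessel_I_coeff (r + 4) k * ?z ^ k)" for k
    using nbessel_I_coeff_Suc[of k "r + 2"] by (simp add: add.assoc mult_ac)
  then have summable_weighted: "summable (\<lambda>k. 2 * real k * ?c k * ?z ^ k)"
    using summable_mult[OF summable_add4, of ?z]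
    by (subst summable_Suc_iff[symmetric]) (simp del: of_nat_Suc power_Suc)
  have "nbessel_I r x = (\<Sum>k. (r + 1) * (?c k * ?z ^ k) + 2 * real k * ?c k * ?z ^ k)"
    unfolding nbessel_I_def nbessel_I_coeff_eq_add2[OF r] by (simp add: algebra_simps)
  also have "\<dots> = (r + 1) * (\<Sum>k. ?c k * ?z ^ k) + (\<Sum>k. 2 * real k * ?c k * ?z ^ k)"
    using suminf_add[OF summable_mult[OF summable_add2] summable_weighted] suminf_mult[OF summable_add2] by metis
  also have "(\<Sum>k. 2 * real k * ?c k * ?z ^ k) = (\<Sum>k. ?z * (nbessel_I_coeff (r + 4) k * ?z ^ k))"
    using suminf_split_head[OF summable_weighted] unfolding shift by simp
  also have "\<dots> = ?z * (\<Sum>k. nbessel_I_coeff (r + 4) k * ?z ^ k)"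
    by (rule suminf_mult[OF summable_add4])
  finally show ?thesis unfolding nbessel_I_def .
qed

lemma nbessel_I_0: "nbessel_I r 0 = nbessel_I_coeff r 0"
  unfolding nbessel_I_def by (simp add: powser_zero)

lemma nbessel_I_pos:
  assumes "r > - 1"
  shows "nbessel_I r x > 0"
proof -
  have "0 < nbessel_I_coeff r 0" by (rule nbessel_I_coeff_pos[OF assms])
  also have "\<dots> = (\<Sum>k<1. nbessel_I_coeff r k * (x\<^sup>2) ^ k)" by simp
  also have "\<dots> \<le> nbessel_I r x"
    unfolding nbessel_I_def using nbessel_I_coeff_pos[OF assms]
    by (intro sum_le_suminf summable_nbessel_I assms) (auto simp: less_imp_le)
  finally show ?thesis .
qed

lemma nbessel_I_add2_le: "r > - 1 \<Longrightarrow> (r + 1) * nbessel_I (r + 2) x \<le> nbessel_I r x"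
  using nbessel_I_recurrence[of r x] nbessel_I_pos[of "r + 4" x] by simp

lemma nbessel_I_at_0: "r > - 1 \<Longrightarrow> (nbessel_I r \<longlongrightarrow> nbessel_I r 0) (at_right 0)"
  using isCont_nbessel_I[of r 0] by (simp add: isCont_def filterlim_at_split)

lemma bessel_I_eq_nbessel_I:
  assumes "r > - 1" "x > 0"
  shows "bessel_I ((r - 1) / 2) x = x powr ((r - 1) / 2) * nbessel_I r x"
proof -
  have "(x / 2) powr ((r - 1) / 2 + 2 * real k) / (Gamma ((r - 1) / 2 + real k + 1) * fact k)
      = x powr ((r - 1) / 2) * (nbessel_I_coeff r k * (x\<^sup>2) ^ k)" for k
  proof -
    have "(x / 2) powr ((r - 1) / 2 + 2 * real k) = (x / 2) powr ((r - 1) / 2) * (x / 2) ^ (2 * k)"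
      using assms by (simp add: powr_add powr_realpow[symmetric])
    also have "(x / 2) powr ((r - 1) / 2) = x powr ((r - 1) / 2) * 2 powr ((1 - r) / 2)"
      using assms powr_minus_divide[of 2 "(r - 1) / 2"] by (simp add: powr_divide minus_divide_left)
    also have "(x / 2) ^ (2 * k) = (x\<^sup>2) ^ k / 4 ^ k"
      by (simp add: power_mult power_divide)
    finally have "(x / 2) powr ((r - 1) / 2 + 2 * real k) =
        x powr ((r - 1) / 2) * 2 powr ((1 - r) / 2) * ((x\<^sup>2) ^ k / 4 ^ k)" .
    moreover have index: "(r - 1) / 2 + real k + 1 = (r + 1) / 2 + real k" by (simp add: field_simps)
    ultimately show ?thesis unfolding nbessel_I_coeff_def index by simp
  qed
  then show ?thesis
    unfolding bessel_I_def nbessel_I_def by (simp add: suminf_mult[OF summable_nbessel_I[OF assms(1)]])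
qed

lemma borel_measurable_nbessel_K [measurable]: "nbessel_K r \<in> borel_measurable borel"
  unfolding nbessel_K_def[abs_def] bessel_K_def[abs_def] set_lebesgue_integral_def by measurable

lemma nbessel_K_nonneg: "nbessel_K r x \<ge> 0"
  unfolding nbessel_K_def by (intro mult_nonneg_nonneg bessel_K_nonneg) auto

lemma mult_nbessel_K_add2:
  assumes "x > 0"
  shows "x * nbessel_K (r + 2) x = x powr ((1 - r) / 2) * bessel_K ((r - 1) / 2 + 1) x"
proof -
  have order: "(r + 2 - 1) / 2 = (r - 1) / 2 + 1" by (simp add: field_simps)
  show ?thesis using assms unfolding nbessel_K_def powr_half_add2[OF assms] order by simp
qed

lemma has_real_derivative_nbessel_K:
  assumes x: "x > 0"
  shows "(nbessel_K r has_real_derivative - (x * nbessel_K (r + 2) x)) (at x)"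
proof -
  define n where "n = (r - 1) / 2"
  have n: "(1 - r) / 2 = - n" unfolding n_def by (simp add: field_simps)
  have "((\<lambda>x. x powr (- n) * bessel_K n x) has_real_derivative
      (- n * x powr (- n - 1)) * bessel_K n x +
          - (bessel_K (n - 1) x + bessel_K (n + 1) x) / 2 * x powr (- n)) (at x)"
    using x by (intro DERIV_mult has_real_derivative_powr has_real_derivative_bessel_K)
  moreover have "(- n * x powr (- n - 1)) * bessel_K n x +
      - (bessel_K (n - 1) x + bessel_K (n + 1) x) / 2 * x powr (- n)
      = - (x powr (- n) * bessel_K (n + 1) x)"
    unfolding bessel_K_recurrence[OF x, of n] using x by (simp add: powr_diff field_simps)
  ultimately show ?thesis
    unfolding mult_nbessel_K_add2[OF x] unfolding nbessel_K_def[abs_def] n n_def[symmetric] by simp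
qed

lemma isCont_nbessel_K: "x > 0 \<Longrightarrow> isCont (nbessel_K r) x"
  by (rule DERIV_isCont[OF has_real_derivative_nbessel_K])

lemma nbessel_K_recurrence:
  assumes x: "x > 0"
  shows "x\<^sup>2 * nbessel_K (r + 4) x = nbessel_K r x + (r + 1) * nbessel_K (r + 2) x"
proof -
  define n where "n = (r - 1) / 2"
  have n: "r + 1 = 2 * (n + 1)" "(r + 2 - 1) / 2 + 1 = n + 1 + 1" unfolding n_def by (simp_all add: field_simps)
  have "r + 4 = r + 2 + 2" by simp
  then have "x\<^sup>2 * nbessel_K (r + 4) x = x * (x * nbessel_K (r + 2 + 2) x)"
    by (simp only: power2_eq_square mult.assoc)
  also have "\<dots> = x powr ((1 - r) / 2) * bessel_K (n + 1 + 1) x"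
    unfolding mult_nbessel_K_add2[OF x] n(2) powr_half_add2[OF x] using x by simp
  also have "\<dots> = x powr ((1 - r) / 2) * bessel_K n x + (r + 1) / x * (x powr ((1 - r) / 2) * bessel_K (n + 1) x)"
    unfolding bessel_K_recurrence[OF x, of "n + 1"] n(1) by (simp add: algebra_simps)
  also have "\<dots> = nbessel_K r x + (r + 1) / x * (x * nbessel_K (r + 2) x)"
    unfolding mult_nbessel_K_add2[OF x] nbessel_K_def[of r] n_def ..
  finally show ?thesis using x by simp
qed

lemma nbessel_K_le_mult_add2:
  assumes "x > 0" "r \<ge> 0"
  shows "nbessel_K r x \<le> x * nbessel_K (r + 2) x"
  unfolding mult_nbessel_K_add2[OF assms(1)] unfolding nbessel_K_def
  using assms by (intro mult_left_mono bessel_K_mono_order) (auto simp: abs_if field_simps)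

lemma nbessel_K_decay: "((\<lambda>x. x powr p * nbessel_K r x) \<longlongrightarrow> 0) at_top"
proof -
  obtain n :: nat where n: "p + (1 - r) / 2 \<le> real n" using real_arch_simple by blast
  let ?C = "exp 1 * bessel_K ((r - 1) / 2) 1"
  show ?thesis
  proof (rule Lim_null_comparison)
    show "((\<lambda>x. ?C * (x ^ n / exp x)) \<longlongrightarrow> 0) at_top"
      by (intro tendsto_mult_right_zero tendsto_power_div_exp_0)
    show "\<forall>\<^sub>F x in at_top. norm (x powr p * nbessel_K r x) \<le> ?C * (x ^ n / exp x)"
      using eventually_ge_at_top[of 1]
    proof eventually_elim
      case (elim x)
      have "x powr p * nbessel_K r x = x powr (p + (1 - r) / 2) * bessel_K ((r - 1) / 2) x"
        unfolding nbessel_K_def by (simp add: powr_add)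
      also have "\<dots> \<le> x ^ n * (exp (1 - x) * bessel_K ((r - 1) / 2) 1)"
      proof (intro mult_mono bessel_K_decay elim)
        show "x powr (p + (1 - r) / 2) \<le> x ^ n"
          using powr_mono[OF n elim] elim by (simp add: powr_realpow)
      qed (use elim in \<open>auto simp: bessel_K_nonneg\<close>)
      also have "\<dots> = ?C * (x ^ n / exp x)" by (simp add: exp_diff)
      finally show ?case using nbessel_K_nonneg[of r x] by simp
    qed
  qed
qed

lemma tendsto_powr_at_right_0: "p > 0 \<Longrightarrow> ((\<lambda>x::real. x powr p) \<longlongrightarrow> 0) (at_right 0)"
  by (rule tendsto_zero_powrI) (auto intro!: tendsto_eq_intros eventually_at_rightI[of 0 1])

lemma nbessel_K_at_0:
  assumes "r > 0"
  shows "((\<lambda>x. x powr r * nbessel_K r x) \<longlongrightarrow> 0) (at_right 0)"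
proof -
  define n where "n = (r - 1) / 2"
  define m where "m = (\<bar>n\<bar> + (n + 1)) / 2"
  have "\<bar>n\<bar> < n + 1" unfolding n_def using assms by (auto simp: abs_if field_simps)
  then have m: "m > 0" "\<bar>n\<bar> \<le> m" "m < n + 1" unfolding m_def by auto
  let ?C = "2 powr (m - 1) * Gamma m"
  show ?thesis
  proof (rule Lim_null_comparison)
    show "((\<lambda>x. ?C * x powr (n + 1 - m)) \<longlongrightarrow> 0) (at_right 0)"
      using m by (intro tendsto_mult_right_zero tendsto_powr_at_right_0) simp
    show "\<forall>\<^sub>F x in at_right 0. norm (x powr r * nbessel_K r x) \<le> ?C * x powr (n + 1 - m)"
      using eventually_at_right_less[of 0]
    proof eventually_elim
      case (elim x)
      have "x powr r * nbessel_K r x = x powr (n + 1) * bessel_K n x"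
        unfolding nbessel_K_def n_def by (simp add: powr_add[symmetric] mult.assoc[symmetric] field_simps)
      also have "\<dots> = x powr (n + 1 - m) * (x powr m * bessel_K n x)"
        by (simp add: powr_add[symmetric] mult.assoc[symmetric])
      also have "\<dots> \<le> x powr (n + 1 - m) * (x powr m * bessel_K m x)"
        using m elim by (intro mult_left_mono bessel_K_mono_order) auto
      also have "\<dots> \<le> x powr (n + 1 - m) * ?C"
        using m elim by (intro mult_left_mono bessel_K_le_Gamma) auto
      finally show ?case using nbessel_K_nonneg[of r x] by (simp add: ac_simps)
    qed
  qed
qed

lemma nbessel_K_add2_at_0:
  assumes "r > - 1"
  shows "((\<lambda>x. x powr (r + 1) * nbessel_K (r + 2) x) \<longlongrightarrow> 1 / nbessel_I r 0) (at_right 0)"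
proof -
  define n where "n = (r - 1) / 2"
  have n: "n + 1 > 0" "(r + 1) / 2 = n + 1" "(1 - r) / 2 = - n" "(r + 2 - 1) / 2 = n + 1"
    "r + 1 + (1 - (r + 2)) / 2 = n + 1"
    unfolding n_def using assms by (simp_all add: field_simps)
  have "1 / nbessel_I r 0 = 2 powr n * Gamma (n + 1)"
    unfolding nbessel_I_0 nbessel_I_coeff_def n(2,3) by (simp add: powr_minus_divide)
  then have "((\<lambda>x. x powr (n + 1) * bessel_K (n + 1) x) \<longlongrightarrow> 1 / nbessel_I r 0) (at_right 0)"
    using bessel_K_at_0[OF n(1)] by simp
  moreover have "x powr (r + 1) * nbessel_K (r + 2) x = x powr (n + 1) * bessel_K (n + 1) x" for x
    unfolding nbessel_K_def n(4) mult.assoc[symmetric] powr_add[symmetric] n(5) ..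
  ultimately show ?thesis by simp
qed

subsection \<open>A normalised Struve function\<close>

text \<open>
  Up to a constant factor, \<open>nstruve 0 r\<close> is \<open>x\<^sup>-\<^sup>\<nu> (I\<^sub>\<nu> - L\<^sub>\<nu>)\<close> with the modified Struve function \<open>L\<^sub>\<nu>\<close>,
  and \<open>nstruve n r\<close> is \<open>(- 1)\<^sup>n\<close> times its \<open>n\<close>-th derivative.
\<close>

definition nstruve :: "nat \<Rightarrow> real \<Rightarrow> real \<Rightarrow> real" where
  "nstruve n r x = (LINT u:{0<..<1}|lborel. (1 - u\<^sup>2) powr (r / 2 - 1) * u ^ n * exp (- (x * u)))"

lemma
  fixes a b :: real
  assumes "a > 0" "b > 0"
  shows set_integrable_Beta: "set_integrable lborel {0<..<1} (\<lambda>t::real. t powr (a - 1) * (1 - t) powr (b - 1))"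
    and set_integral_Beta: "(LINT t:{0<..<1}|lborel. t powr (a - 1) * (1 - t) powr (b - 1)) = Beta a b"
proof -
  let ?f = "\<lambda>t. t powr (a - 1) * (1 - t) powr (b - 1)"
  have "has_bochner_integral lborel (\<lambda>t. indicator {0..1} t * ?f t) (Beta a b)"
  proof (rule has_bochner_integral_nn_integral)
    show "(\<integral>\<^sup>+t. ennreal (indicator {0..1} t * ?f t) \<partial>lborel) = ennreal (Beta a b)"
      using nn_integral_has_integral_lebesgue[OF _ has_integral_Beta_real[OF assms]] by simp
    show "Beta a b \<ge> 0"
      using assms by (auto simp: Beta_def intro!: divide_nonneg_nonneg mult_nonneg_nonneg Gamma_real_nonneg)
  qed auto
  also have "(\<lambda>t. indicator {0..1} t * ?f t) = (\<lambda>t. indicator {0<..<1} t *\<^sub>R ?f t)"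
    by (auto simp: fun_eq_iff indicator_def)
  finally show "set_integrable lborel {0<..<1} ?f" "(LINT t:{0<..<1}|lborel. ?f t) = Beta a b"
    unfolding set_integrable_def set_lebesgue_integral_def by (auto simp: has_bochner_integral_iff)
qed

lemma
  fixes r :: real
  assumes r: "r > 0"
  shows set_integrable_nstruve_weight: "set_integrable lborel {0<..<1} (\<lambda>u. (1 - u\<^sup>2) powr (r / 2 - 1))"
    and set_integral_nstruve_weight:
      "(LINT u:{0<..<1}|lborel. (1 - u\<^sup>2) powr (r / 2 - 1)) = Beta (1 / 2) (r / 2) / 2"
proof -
  let ?f = "\<lambda>u. (1 - u\<^sup>2) powr (r / 2 - 1)" and ?g' = "\<lambda>v. 1 / (2 * sqrt v)"
  let ?\<beta> = "\<lambda>v. v powr (1 / 2 - 1) * (1 - v) powr (r / 2 - 1) / 2"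
  have fg: "?f (sqrt v) * ?g' v = ?\<beta> v" if "v \<in> {0<..<1}" for v
    using that by (simp add: powr_minus_divide powr_half_sqrt)
  have "set_integrable lborel {0<..<1} ?\<beta>"
    using r by (intro set_integrable_divide set_integrable_Beta) auto
  then have "set_integrable lborel {0<..<1} (\<lambda>v. ?f (sqrt v) * ?g' v)"
    by (subst set_integrable_cong[OF refl refl fg])
  then have int: "set_integrable lborel (einterval (ereal 0) (ereal 1)) (\<lambda>v. ?f (sqrt v) * ?g' v)" by simp
  have lim: "((ereal \<circ> sqrt \<circ> real_of_ereal) \<longlongrightarrow> ereal 0) (at_right (ereal 0))"
    "((ereal \<circ> sqrt \<circ> real_of_ereal) \<longlongrightarrow> ereal 1) (at_left (ereal 1))"
    by (auto simp: ereal_tendsto_simps intro!: tendsto_eq_intros)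
  have deriv: "(sqrt has_real_derivative ?g' v) (at v)" if "ereal 0 < ereal v" for v
    using DERIV_real_sqrt[of v] that by (simp add: field_simps)
  have cont: "isCont ?f (sqrt v)" "isCont ?g' v" if "ereal 0 < ereal v" "ereal v < ereal 1" for v
    using that by (intro continuous_intros; simp)+
  note substitution = interval_integral_substitution_nonneg
    [where f = ?f and g = sqrt and g' = ?g', OF _ deriv cont(1) cont(2) _ _ lim int, simplified]
  show "set_integrable lborel {0<..<1} ?f" using substitution(1) by simp
  have "(LBINT u=ereal 0..ereal 1. ?f u) = (LBINT v=ereal 0..ereal 1. ?f (sqrt v) * ?g' v)"
    using substitution(2) by simp
  then have "(LINT u:{0<..<1}|lborel. ?f u) = (LINT v:{0<..<1}|lborel. ?f (sqrt v) * ?g' v)"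
    by (simp add: interval_integral_Ioo)
  also have "\<dots> = (LINT v:{0<..<1}|lborel. ?\<beta> v)"
    by (intro set_lebesgue_integral_cong allI impI fg) simp
  also have "\<dots> = Beta (1 / 2) (r / 2) / 2"
    using set_integral_Beta[of "1 / 2" "r / 2"] r by simp
  finally show "(LINT u:{0<..<1}|lborel. ?f u) = Beta (1 / 2) (r / 2) / 2" .
qed

lemma nstruve_integrand_le:
  fixes r u x :: real
  assumes "u \<in> {0<..<1}" "x \<ge> 0"
  shows "\<bar>(1 - u\<^sup>2) powr (r / 2 - 1) * u ^ n * exp (- (x * u))\<bar> \<le> (1 - u\<^sup>2) powr (r / 2 - 1)"
proof -
  have "u ^ n * exp (- (x * u)) \<le> 1"
    using assms by (intro mult_le_one power_le_one) auto
  then have "(1 - u\<^sup>2) powr (r / 2 - 1) * (u ^ n * exp (- (x * u))) \<le> (1 - u\<^sup>2) powr (r / 2 - 1) * 1"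
    by (intro mult_left_mono) auto
  then show ?thesis using assms by (simp add: abs_mult)
qed

lemma set_integrable_nstruve:
  fixes r x :: real
  assumes "r > 0" "x \<ge> 0"
  shows "set_integrable lborel {0<..<1} (\<lambda>u. (1 - u\<^sup>2) powr (r / 2 - 1) * u ^ n * exp (- (x * u)))"
  by (rule set_integrable_abs_bound[OF set_integrable_nstruve_weight[OF assms(1)]])
    (use nstruve_integrand_le assms(2) in auto)

lemma nstruve_0: "r > 0 \<Longrightarrow> nstruve 0 r 0 = Beta (1 / 2) (r / 2) / 2"
  unfolding nstruve_def by (simp add: set_integral_nstruve_weight)

lemma nstruve_0_pos: "r > 0 \<Longrightarrow> nstruve 0 r 0 > 0"
  by (simp add: nstruve_0 Beta_def Gamma_real_pos)

lemma nstruve_nonneg: "nstruve n r x \<ge> 0"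
  unfolding nstruve_def set_lebesgue_integral_def
  by (intro Bochner_Integration.integral_nonneg) (auto simp: indicator_def)

lemma nstruve_le:
  assumes "r > 0" "x \<ge> 0"
  shows "nstruve n r x \<le> nstruve 0 r 0"
  unfolding nstruve_def
proof (intro set_integral_mono set_integrable_nstruve assms order_refl)
  fix u :: real assume "u \<in> {0<..<1}"
  from nstruve_integrand_le[OF this assms(2), of r n]
  show "(1 - u\<^sup>2) powr (r / 2 - 1) * u ^ n * exp (- (x * u)) \<le>
      (1 - u\<^sup>2) powr (r / 2 - 1) * u ^ 0 * exp (- (0 * u))"
    by simp
qed

lemma has_real_derivative_nstruve:
  assumes "r > 0" "x > 0"
  shows "(nstruve n r has_real_derivative - nstruve (Suc n) r x) (at x)"
proof -
  define w where "w = (\<lambda>u. indicator {0<..<1} u * ((1 - u\<^sup>2) powr (r / 2 - 1) * u ^ n) :: real)"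
  have eq: "nstruve n r = (\<lambda>x. LINT u|lborel. w u * exp (- (x * u)))"
    "nstruve (Suc n) r x = (LINT u|lborel. w u * u * exp (- (x * u)))"
    unfolding nstruve_def set_lebesgue_integral_def w_def by (simp_all add: mult_ac)
  show ?thesis
    unfolding eq
  proof (rule has_real_derivative_laplace[OF _ _ _ _ assms(2)])
    show "integrable lborel (\<lambda>u. w u * exp (- (z * u)))" if "z > 0" for z
      using set_integrable_nstruve[OF assms(1), of z n] that
      unfolding set_integrable_def w_def by (simp add: mult_ac)
    show "0 \<le> u" if "w u \<noteq> 0" for u
      using that by (auto simp: w_def indicator_def split: if_splits)
  qed (auto simp: w_def)
qed

lemma nstruve_at_0:
  assumes "r > 0"
  shows "(nstruve n r \<longlongrightarrow> nstruve n r 0) (at_right 0)"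
  unfolding nstruve_def[abs_def] set_lebesgue_integral_def
proof (rule integral_dominated_convergence_at_within)
  show "integrable lborel (\<lambda>u. indicat_real {0<..<1} u *\<^sub>R (1 - u\<^sup>2) powr (r / 2 - 1))"
    using set_integrable_nstruve_weight[OF assms] unfolding set_integrable_def .
  show "((\<lambda>x. indicat_real {0<..<1} u *\<^sub>R ((1 - u\<^sup>2) powr (r / 2 - 1) * u ^ n * exp (- (x * u)))) \<longlongrightarrow>
      indicat_real {0<..<1} u *\<^sub>R ((1 - u\<^sup>2) powr (r / 2 - 1) * u ^ n * exp (- (0 * u)))) (at_right 0)" for u
    by (intro tendsto_intros)
qed (use nstruve_integrand_le in \<open>auto simp: indicator_def\<close>)

lemma one_minus_power2_powr_at_left_1:
  fixes p :: real
  assumes "p > 0"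
  shows "((\<lambda>u. (1 - u\<^sup>2) powr p) \<longlongrightarrow> 0) (at_left 1)"
proof (rule tendsto_zero_powrI[OF _ tendsto_const _ assms])
  show "((\<lambda>u::real. 1 - u\<^sup>2) \<longlongrightarrow> 0) (at_left 1)" by (auto intro!: tendsto_eq_intros)
  show "\<forall>\<^sub>F u::real in at_left 1. 0 \<le> 1 - u\<^sup>2"
    by (rule eventually_at_leftI[of 0]) (auto simp: power_le_one)
qed

lemma nstruve_ode:
  assumes r: "r > 0" and x: "x > 0"
  shows "r * nstruve 1 r x - x * nstruve 2 r x = 1 - x * nstruve 0 r x"
proof -
  let ?w = "\<lambda>u. (1 - u\<^sup>2) powr (r / 2 - 1)" and ?e = "\<lambda>u. exp (- (x * u))"
  let ?F = "\<lambda>u. - ((1 - u\<^sup>2) powr (r / 2) * ?e u)"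
  let ?f = "\<lambda>u. r * (?w u * u ^ 1 * ?e u) + x * (?w u * u ^ 0 * ?e u) - x * (?w u * u\<^sup>2 * ?e u)"
  have f: "?f u = r * ?w u * u * ?e u + x * (1 - u\<^sup>2) powr (r / 2) * ?e u" if "0 < u" "u < 1" for u :: real
  proof -
    have "1 - u\<^sup>2 > 0" using that by (simp add: power_less_one_iff abs_square_less_1)
    then have "(1 - u\<^sup>2) powr (r / 2) = (1 - u\<^sup>2) * ?w u" by (simp add: powr_diff)
    then show ?thesis by (simp add: left_diff_distrib right_diff_distrib mult_ac)
  qed
  have "(LBINT u=ereal 0..ereal 1. ?f u) = 0 - - 1"
  proof (rule interval_integral_FTC_nonneg(2)[where F = ?F])
    fix u assume "ereal 0 < ereal u" "ereal u < ereal 1"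
    then have u: "0 < u" "u < 1" by auto
    then have pos: "1 - u\<^sup>2 > 0" by (simp add: power_less_one_iff abs_square_less_1)
    show "(?F has_real_derivative ?f u) (at u)"
      unfolding f[OF u] using pos by (auto intro!: derivative_eq_intros simp: field_simps)
    show "isCont ?f u" using pos by (intro continuous_intros) auto
  next
    show "AE u in lborel. ereal 0 < ereal u \<longrightarrow> ereal u < ereal 1 \<longrightarrow> 0 \<le> ?f u"
    proof (intro AE_I2 impI)
      fix u :: real assume "ereal 0 < ereal u" "ereal u < ereal 1"
      then have u: "0 < u" "u < 1" by auto
      show "0 \<le> ?f u" unfolding f[OF u] using r x u by simp
    qed
    have "(?F \<longlongrightarrow> - ((1 - 0\<^sup>2) powr (r / 2) * exp (- (x * 0)))) (at_right 0)"
      by (intro tendsto_intros) auto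
    then show "((?F \<circ> real_of_ereal) \<longlongrightarrow> - 1) (at_right (ereal 0))" by (simp add: ereal_tendsto_simps)
    have "(?F \<longlongrightarrow> - (0 * exp (- (x * 1)))) (at_left 1)"
      using r by (intro tendsto_intros one_minus_power2_powr_at_left_1) simp
    then show "((?F \<circ> real_of_ereal) \<longlongrightarrow> 0) (at_left (ereal 1))" by (simp add: ereal_tendsto_simps)
  qed simp
  then have "1 = (LINT u:{0<..<1}|lborel. ?f u)" by (simp add: interval_integral_Ioo)
  also have "\<dots> = r * nstruve 1 r x + x * nstruve 0 r x - x * nstruve 2 r x"
    unfolding nstruve_def using set_integrable_nstruve[OF r less_imp_le[OF x]]
    by (simp only: set_integral_add set_integral_diff set_integral_mult_right set_integrable_mult_right simp_thms)
  finally show ?thesis by linarith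
qed

subsection \<open>Wronskian and weighted integrals of the normalised Bessel functions\<close>

lemma powr_add_one: "x > 0 \<Longrightarrow> x powr (r + 1) = x * x powr r" for x r :: real
  by (simp add: powr_add)

lemma has_real_derivative_powr':
  fixes x :: real
  assumes "x > 0"
  shows "((\<lambda>x. x powr p) has_real_derivative p * x powr p / x) (at x)"
  using has_real_derivative_powr[OF assms, of p] assms by (simp add: powr_diff)

lemma has_real_derivative_weighted_nbessel_I:
  assumes "r > - 1" "x > 0"
  shows "((\<lambda>x. x powr (r + 1) * nbessel_I (r + 2) x) has_real_derivative x powr r * nbessel_I r x) (at x)"
proof -
  have "((\<lambda>x. x powr (r + 1) * nbessel_I (r + 2) x) has_real_derivative
      ((r + 1) * x powr (r + 1) / x) * nbessel_I (r + 2) x +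
          (x * nbessel_I (r + 2 + 2) x) * x powr (r + 1)) (at x)"
    using assms by (intro DERIV_mult has_real_derivative_powr' has_real_derivative_nbessel_I) auto
  also have "r + 2 + 2 = r + 4" by simp
  also have "((r + 1) * x powr (r + 1) / x) * nbessel_I (r + 2) x + (x * nbessel_I (r + 4) x) * x powr (r + 1)
      = x powr r * nbessel_I r x"
    unfolding nbessel_I_recurrence[OF assms(1), of x] powr_add_one[OF assms(2)]
    using assms by (simp add: field_simps power2_eq_square)
  finally show ?thesis .
qed

lemma has_real_derivative_weighted_nbessel_K:
  assumes "x > 0"
  shows "((\<lambda>x. x powr (r + 1) * nbessel_K (r + 2) x) has_real_derivative - (x powr r * nbessel_K r x)) (at x)"
proof -
  have "((\<lambda>x. x powr (r + 1) * nbessel_K (r + 2) x) has_real_derivative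
      ((r + 1) * x powr (r + 1) / x) * nbessel_K (r + 2) x +
          (- (x * nbessel_K (r + 2 + 2) x)) * x powr (r + 1)) (at x)"
    by (intro DERIV_mult has_real_derivative_powr' has_real_derivative_nbessel_K assms)
  also have "r + 2 + 2 = r + 4" by simp
  also have "((r + 1) * x powr (r + 1) / x) * nbessel_K (r + 2) x + (- (x * nbessel_K (r + 4) x)) * x powr (r + 1)
      = x powr r * ((r + 1) * nbessel_K (r + 2) x - x\<^sup>2 * nbessel_K (r + 4) x)"
    unfolding powr_add_one[OF assms] using assms by (simp add: field_simps power2_eq_square)
  also have "\<dots> = - (x powr r * nbessel_K r x)"
    unfolding nbessel_K_recurrence[OF assms] by (simp add: algebra_simps)
  finally show ?thesis .
qed

lemma nbessel_wronskian:
  assumes r: "r > 0" and x: "x > 0"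
  shows "x powr (r + 1) * (nbessel_I (r + 2) x * nbessel_K r x + nbessel_I r x * nbessel_K (r + 2) x) = 1"
proof -
  let ?W = "\<lambda>x. (x powr (r + 1) * nbessel_I (r + 2) x) * nbessel_K r x +
      nbessel_I r x * (x powr (r + 1) * nbessel_K (r + 2) x)"
  have "(?W has_real_derivative 0) (at x)" if "x > 0" for x
  proof -
    have "(?W has_real_derivative
        (x powr r * nbessel_I r x) * nbessel_K r x +
            (- (x * nbessel_K (r + 2) x)) * (x powr (r + 1) * nbessel_I (r + 2) x) +
        ((x * nbessel_I (r + 2) x) * (x powr (r + 1) * nbessel_K (r + 2) x) +
            (- (x powr r * nbessel_K r x)) * nbessel_I r x))
        (at x)"
      using r that
      by (intro DERIV_add DERIV_mult has_real_derivative_weighted_nbessel_I has_real_derivative_weighted_nbessel_K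
          has_real_derivative_nbessel_I has_real_derivative_nbessel_K) auto
    then show ?thesis by (simp add: algebra_simps)
  qed
  then have deriv: "((\<lambda>x. ?W x - 1) has_real_derivative 0) (at x)" if "x > 0" for x
    using DERIV_diff[OF _ DERIV_const[of 1]] that by fastforce
  have "((\<lambda>x. x * nbessel_I (r + 2) x * (x powr r * nbessel_K r x) +
      nbessel_I r x * (x powr (r + 1) * nbessel_K (r + 2) x))
      \<longlongrightarrow> 0 * nbessel_I (r + 2) 0 * 0 + nbessel_I r 0 * (1 / nbessel_I r 0)) (at_right 0)"
    using r by (intro tendsto_intros nbessel_I_at_0 nbessel_K_at_0 nbessel_K_add2_at_0) auto
  moreover have "\<forall>\<^sub>F x in at_right 0. x * nbessel_I (r + 2) x * (x powr r * nbessel_K r x) +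
      nbessel_I r x * (x powr (r + 1) * nbessel_K (r + 2) x) = ?W x"
    using eventually_at_right_less[of 0] by eventually_elim (simp add: powr_add_one)
  ultimately have "(?W \<longlongrightarrow> 0 * nbessel_I (r + 2) 0 * 0 + nbessel_I r 0 * (1 / nbessel_I r 0)) (at_right 0)"
    by (rule Lim_transform_eventually)
  moreover have "nbessel_I r 0 > 0" using r by (intro nbessel_I_pos) simp
  ultimately have lim: "((\<lambda>x. ?W x - 1) \<longlongrightarrow> 0) (at_right 0)" by (intro LIM_zero) simp
  have "\<bar>?W x - 1\<bar> \<le> 0"
    by (rule abs_le_of_abs_deriv_le_at_right[where g = "\<lambda>_. 0" and g' = "\<lambda>_. 0", OF deriv lim]) (use x in auto)
  then show ?thesis by (simp add: algebra_simps)
qed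

text \<open>
  Both are \<open>x\<^sup>r\<close> times the Wronskian of a homogeneous solution and \<open>g\<close>: the derivatives of \<open>nbessel_I r\<close> and
  \<open>nbessel_K r\<close> are \<open>x * nbessel_I (r + 2) x\<close> and \<open>- (x * nbessel_K (r + 2) x)\<close>.
\<close>

definition lagrange_I :: "real \<Rightarrow> (real \<Rightarrow> real) \<Rightarrow> (real \<Rightarrow> real) \<Rightarrow> real \<Rightarrow> real" where
  "lagrange_I r g g' x = x powr r * g' x * nbessel_I r x - x powr (r + 1) * nbessel_I (r + 2) x * g x"

definition lagrange_K :: "real \<Rightarrow> (real \<Rightarrow> real) \<Rightarrow> (real \<Rightarrow> real) \<Rightarrow> real \<Rightarrow> real" where
  "lagrange_K r g g' x = x powr r * g' x * nbessel_K r x + x powr (r + 1) * nbessel_K (r + 2) x * g x"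

lemma has_real_derivative_lagrange:
  assumes r: "r > - 1" and x: "x > 0"
    and g: "(g has_real_derivative g' x) (at x)" "(g' has_real_derivative g'') (at x)"
  shows has_real_derivative_lagrange_I: "(lagrange_I r g g' has_real_derivative
      x powr (r - 1) * nbessel_I r x * (x * g'' + r * g' x - x * g x)) (at x)"
    and has_real_derivative_lagrange_K: "(lagrange_K r g g' has_real_derivative
      x powr (r - 1) * nbessel_K r x * (x * g'' + r * g' x - x * g x)) (at x)"
proof -
  have weighted: "((\<lambda>x. x powr r * g' x) has_real_derivative (r * x powr r / x) * g' x + g'' * x powr r) (at x)"
    by (intro DERIV_mult has_real_derivative_powr' g x)
  have "(lagrange_I r g g' has_real_derivative
      ((r * x powr r / x) * g' x + g'' * x powr r) * nbessel_I r x + (x * nbessel_I (r + 2) x) * (x powr r * g' x)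
      - ((x powr r * nbessel_I r x) * g x + g' x * (x powr (r + 1) * nbessel_I (r + 2) x))) (at x)"
    unfolding lagrange_I_def[abs_def]
    by (intro DERIV_diff DERIV_mult[OF weighted] DERIV_mult has_real_derivative_nbessel_I
        has_real_derivative_weighted_nbessel_I g r x)
  then show "(lagrange_I r g g' has_real_derivative
      x powr (r - 1) * nbessel_I r x * (x * g'' + r * g' x - x * g x)) (at x)"
    by (rule DERIV_cong) (unfold powr_add_one[OF x], use x in \<open>simp add: powr_diff field_simps\<close>)
  have "(lagrange_K r g g' has_real_derivative
      ((r * x powr r / x) * g' x + g'' * x powr r) * nbessel_K r x +
          (- (x * nbessel_K (r + 2) x)) * (x powr r * g' x)
      + ((- (x powr r * nbessel_K r x)) * g x + g' x * (x powr (r + 1) * nbessel_K (r + 2) x))) (at x)"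
    unfolding lagrange_K_def[abs_def]
    by (intro DERIV_add DERIV_mult[OF weighted] DERIV_mult has_real_derivative_nbessel_K
        has_real_derivative_weighted_nbessel_K g x)
  then show "(lagrange_K r g g' has_real_derivative
      x powr (r - 1) * nbessel_K r x * (x * g'' + r * g' x - x * g x)) (at x)"
    by (rule DERIV_cong) (unfold powr_add_one[OF x], use x in \<open>simp add: powr_diff field_simps\<close>)
qed

lemma lagrange_inversion:
  assumes "r > 0" "x > 0"
  shows "nbessel_K r x * lagrange_I r g g' x - nbessel_I r x * lagrange_K r g g' x = - g x"
    and "x * nbessel_K (r + 2) x * lagrange_I r g g' x + x * nbessel_I (r + 2) x * lagrange_K r g g' x = g' x"
proof -
  let ?W = "x powr (r + 1) * (nbessel_I (r + 2) x * nbessel_K r x + nbessel_I r x * nbessel_K (r + 2) x)"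
  have "nbessel_K r x * lagrange_I r g g' x - nbessel_I r x * lagrange_K r g g' x = - (?W * g x)"
    unfolding lagrange_I_def lagrange_K_def by (simp add: algebra_simps)
  then show "nbessel_K r x * lagrange_I r g g' x - nbessel_I r x * lagrange_K r g g' x = - g x"
    by (simp add: nbessel_wronskian[OF assms])
  have "x * nbessel_K (r + 2) x * lagrange_I r g g' x + x * nbessel_I (r + 2) x * lagrange_K r g g' x = ?W * g' x"
    unfolding lagrange_I_def lagrange_K_def powr_add_one[OF assms(2)] by (simp add: algebra_simps)
  then show "x * nbessel_K (r + 2) x * lagrange_I r g g' x + x * nbessel_I (r + 2) x * lagrange_K r g g' x = g' x"
    by (simp add: nbessel_wronskian[OF assms])
qed

text \<open>
  As \<open>- nstruve 0 r\<close> solves \<open>x u'' + r u' - x u = 1\<close>, its Lagrange transforms are antiderivatives of the kernels.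
\<close>

lemma
  assumes "r > 0" "x > 0"
  shows has_real_derivative_lagrange_I_nstruve:
      "(lagrange_I r (\<lambda>x. - nstruve 0 r x) (nstruve 1 r) has_real_derivative
      x powr (r - 1) * nbessel_I r x) (at x)"
    and has_real_derivative_lagrange_K_nstruve:
      "(lagrange_K r (\<lambda>x. - nstruve 0 r x) (nstruve 1 r) has_real_derivative
      x powr (r - 1) * nbessel_K r x) (at x)"
proof -
  have r: "r > - 1" using assms by simp
  have "((\<lambda>x. - nstruve 0 r x) has_real_derivative nstruve 1 r x) (at x)"
    using DERIV_minus[OF has_real_derivative_nstruve[OF assms, of 0]] by simp
  moreover have "(nstruve 1 r has_real_derivative - nstruve 2 r x) (at x)"
    using has_real_derivative_nstruve[OF assms, of 1] by (simp add: numeral_2_eq_2)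
  moreover have "x * - nstruve 2 r x + r * nstruve 1 r x - x * - nstruve 0 r x = 1"
    using nstruve_ode[OF assms] by simp
  ultimately show "(lagrange_I r (\<lambda>x. - nstruve 0 r x) (nstruve 1 r) has_real_derivative
      x powr (r - 1) * nbessel_I r x) (at x)"
    "(lagrange_K r (\<lambda>x. - nstruve 0 r x) (nstruve 1 r) has_real_derivative x powr (r - 1) * nbessel_K r x) (at x)"
    using has_real_derivative_lagrange[OF r assms(2), of "\<lambda>x. - nstruve 0 r x" "nstruve 1 r" "- nstruve 2 r x"]
    by (simp_all only: mult_1_right)
qed

subsection \<open>The Green operator\<close>

definition green_lower :: "real \<Rightarrow> (real \<Rightarrow> real) \<Rightarrow> real \<Rightarrow> real" where
  "green_lower r k x = (LINT t:{0<..x}|lborel. t powr (r - 1) * nbessel_I r t * k t)"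

definition green_upper :: "real \<Rightarrow> (real \<Rightarrow> real) \<Rightarrow> real \<Rightarrow> real" where
  "green_upper r k x = (LINT t:{x<..}|lborel. t powr (r - 1) * nbessel_K r t * k t)"

lemma
  assumes r: "r > - 1" and x: "x > 0"
  shows set_integrable_green_lower_ident: "set_integrable lborel {0<..x} (\<lambda>t. t powr (r - 1) * nbessel_I r t * t)"
    and green_lower_ident: "green_lower r (\<lambda>t. t) x = x powr (r + 1) * nbessel_I (r + 2) x"
proof -
  let ?F = "\<lambda>x. x powr (r + 1) * nbessel_I (r + 2) x" and ?f = "\<lambda>t. t powr (r - 1) * nbessel_I r t * t"
  have F: "(?F has_real_derivative ?f t) (at t)" if "t > 0" for t
    using has_real_derivative_weighted_nbessel_I[OF r that] that by (simp add: powr_diff)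
  have lim: "(?F \<longlongrightarrow> 0) (at_right 0)"
    using tendsto_mult[OF tendsto_powr_at_right_0[of "r + 1"] nbessel_I_at_0[of "r + 2"]] r by simp
  have f: "isCont ?f t" "?f t \<ge> 0" if "t > 0" for t
    using that nbessel_I_pos[OF r, of t] by (auto intro!: continuous_intros isCont_nbessel_I r)
  show "set_integrable lborel {0<..x} ?f"
    by (rule set_integrable_FTC_Ioc[OF F lim f x])
  show "green_lower r (\<lambda>t. t) x = ?F x"
    unfolding green_lower_def using set_integral_FTC_Ioc[OF F lim f x] by simp
qed

lemma
  assumes r: "r > - 1"
  shows set_integrable_green_upper_ident: "set_integrable lborel {0<..} (\<lambda>t. t powr (r - 1) * nbessel_K r t * t)"
    and green_upper_ident_0: "green_upper r (\<lambda>t. t) 0 = 1 / nbessel_I r 0"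
    and green_upper_ident: "x > 0 \<Longrightarrow> green_upper r (\<lambda>t. t) x = x powr (r + 1) * nbessel_K (r + 2) x"
proof -
  let ?F = "\<lambda>x. x powr (r + 1) * nbessel_K (r + 2) x" and ?f = "\<lambda>t. t powr (r - 1) * nbessel_K r t * t"
  have F: "(?F has_real_derivative - ?f t) (at t)" if "t > 0" for t
    using has_real_derivative_weighted_nbessel_K[OF that, of r] that by (simp add: powr_diff)
  have f: "isCont ?f t" "?f t \<ge> 0" if "t > 0" for t
    using that nbessel_K_nonneg[of r t] by (auto intro!: continuous_intros isCont_nbessel_K)
  note lim0 = nbessel_K_add2_at_0[OF r]
  show "set_integrable lborel {0<..} ?f"
    by (rule set_integrable_FTC_Ioi[OF F lim0 nbessel_K_decay f])
  show "green_upper r (\<lambda>t. t) 0 = 1 / nbessel_I r 0"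
    unfolding green_upper_def by (rule set_integral_FTC_Ioi[OF F lim0 nbessel_K_decay f])
  show "green_upper r (\<lambda>t. t) x = ?F x" if x: "x > 0"
    unfolding green_upper_def
  proof (rule set_integral_FTC_Ioi[OF _ _ nbessel_K_decay])
    show "(?F \<longlongrightarrow> ?F x) (at_right x)"
      using DERIV_isCont[OF F[OF x]] by (simp add: isCont_def filterlim_at_split)
  qed (use F f x in auto)
qed

lemma
  assumes r: "r > 0"
  shows set_integrable_green_lower_one:
      "x > 0 \<Longrightarrow> set_integrable lborel {0<..x} (\<lambda>t. t powr (r - 1) * nbessel_I r t)"
    and green_lower_one: "x > 0 \<Longrightarrow>
      green_lower r (\<lambda>_. 1) x = lagrange_I r (\<lambda>x. - nstruve 0 r x) (nstruve 1 r) x"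
    and green_lower_one_at_0: "(green_lower r (\<lambda>_. 1) \<longlongrightarrow> 0) (at_right 0)"
proof -
  let ?F = "lagrange_I r (\<lambda>x. - nstruve 0 r x) (nstruve 1 r)" and ?f = "\<lambda>t. t powr (r - 1) * nbessel_I r t"
  note F = has_real_derivative_lagrange_I_nstruve[OF r]
  have f: "isCont ?f t" "?f t \<ge> 0" if "t > 0" for t
    using that r nbessel_I_pos[of r t] by (auto intro!: continuous_intros isCont_nbessel_I)
  have "(?F \<longlongrightarrow> 0 * nstruve 1 r 0 * nbessel_I r 0 - 0 * nbessel_I (r + 2) 0 * - nstruve 0 r 0) (at_right 0)"
    unfolding lagrange_I_def[abs_def] using r
    by (intro tendsto_intros nbessel_I_at_0 nstruve_at_0 tendsto_powr_at_right_0) auto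
  then have lim: "(?F \<longlongrightarrow> 0) (at_right 0)" by simp
  show "set_integrable lborel {0<..x} ?f" if "x > 0" for x
    by (rule set_integrable_FTC_Ioc[OF F lim f that])
  show eq: "green_lower r (\<lambda>_. 1) x = ?F x" if "x > 0" for x
    unfolding green_lower_def using set_integral_FTC_Ioc[OF F lim f that] by simp
  have "\<forall>\<^sub>F x in at_right 0. ?F x = green_lower r (\<lambda>_. 1) x"
    using eventually_at_right_less[of 0] by eventually_elim (rule eq[symmetric])
  with lim show "(green_lower r (\<lambda>_. 1) \<longlongrightarrow> 0) (at_right 0)" by (rule Lim_transform_eventually)
qed

lemma lagrange_K_at_top:
  assumes "\<forall>\<^sub>F x in at_top. \<bar>g x\<bar> \<le> C" "\<forall>\<^sub>F x in at_top. \<bar>g' x\<bar> \<le> C"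
  shows "(lagrange_K r g g' \<longlongrightarrow> 0) at_top"
proof -
  have "((\<lambda>x. x powr r * nbessel_K r x * g' x + x powr (r + 1) * nbessel_K (r + 2) x * g x) \<longlongrightarrow> 0 + 0) at_top"
    using assms by (intro tendsto_add lim_null_mult_right_bounded[OF nbessel_K_decay]) auto
  then show ?thesis unfolding lagrange_K_def[abs_def] by (simp add: mult_ac)
qed

lemma
  assumes r: "r > 0"
  shows set_integrable_green_upper_one: "set_integrable lborel {0<..} (\<lambda>t. t powr (r - 1) * nbessel_K r t)"
    and green_upper_one_0: "green_upper r (\<lambda>_. 1) 0 = nstruve 0 r 0 / nbessel_I r 0"
    and green_upper_one: "x > 0 \<Longrightarrow>
      green_upper r (\<lambda>_. 1) x = - lagrange_K r (\<lambda>x. - nstruve 0 r x) (nstruve 1 r) x"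
    and green_upper_one_at_top: "(green_upper r (\<lambda>_. 1) \<longlongrightarrow> 0) at_top"
proof -
  let ?G = "lagrange_K r (\<lambda>x. - nstruve 0 r x) (nstruve 1 r)" and ?f = "\<lambda>t. t powr (r - 1) * nbessel_K r t"
  let ?F = "\<lambda>x. - ?G x"
  have F: "(?F has_real_derivative - ?f t) (at t)" if "t > 0" for t
    by (intro DERIV_minus has_real_derivative_lagrange_K_nstruve[OF r that])
  have f: "isCont ?f t" "?f t \<ge> 0" if "t > 0" for t
    using that nbessel_K_nonneg[of r t] by (auto intro!: continuous_intros isCont_nbessel_K)
  have "((\<lambda>x. - (x powr r * nbessel_K r x * nstruve 1 r x +
      x powr (r + 1) * nbessel_K (r + 2) x * - nstruve 0 r x))
      \<longlongrightarrow> - (0 * nstruve 1 r 0 + 1 / nbessel_I r 0 * - nstruve 0 r 0)) (at_right 0)"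
    using r by (intro tendsto_intros nbessel_K_add2_at_0 nbessel_K_at_0 nstruve_at_0) auto
  then have lim0: "(?F \<longlongrightarrow> nstruve 0 r 0 / nbessel_I r 0) (at_right 0)"
    unfolding lagrange_K_def by (simp add: mult_ac)
  have "\<forall>\<^sub>F x in at_top. \<bar>nstruve n r x\<bar> \<le> nstruve 0 r 0" for n
    using eventually_ge_at_top[of 0] by eventually_elim (simp add: nstruve_nonneg nstruve_le[OF r])
  then have "(?G \<longlongrightarrow> 0) at_top" by (intro lagrange_K_at_top) (simp_all only: abs_minus_cancel)
  then have limtop: "(?F \<longlongrightarrow> 0) at_top" using tendsto_minus[of ?G 0] by simp
  show "set_integrable lborel {0<..} ?f"
    by (rule set_integrable_FTC_Ioi[OF F lim0 limtop f])
  show "green_upper r (\<lambda>_. 1) 0 = nstruve 0 r 0 / nbessel_I r 0"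
    unfolding green_upper_def using set_integral_FTC_Ioi[OF F lim0 limtop f] by simp
  show eq: "green_upper r (\<lambda>_. 1) x = ?F x" if x: "x > 0" for x
    unfolding green_upper_def mult_1_right
  proof (rule set_integral_FTC_Ioi[OF _ _ limtop])
    show "(?F \<longlongrightarrow> ?F x) (at_right x)"
      using DERIV_isCont[OF F[OF x]] by (simp add: isCont_def filterlim_at_split)
  qed (use F f x in auto)
  have "\<forall>\<^sub>F x in at_top. ?F x = green_upper r (\<lambda>_. 1) x"
    using eventually_gt_at_top[of 0] by eventually_elim (rule eq[symmetric])
  with limtop show "(green_upper r (\<lambda>_. 1) \<longlongrightarrow> 0) at_top" by (rule Lim_transform_eventually)
qed

lemma nstruve_0_eq_green:
  assumes "r > 0" "x > 0"
  shows "nbessel_K r x * green_lower r (\<lambda>_. 1) x + nbessel_I r x * green_upper r (\<lambda>_. 1) x = nstruve 0 r x"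
  unfolding green_lower_one[OF assms] green_upper_one[OF assms]
  using lagrange_inversion(1)[OF assms, of "\<lambda>x. - nstruve 0 r x" "nstruve 1 r"] by simp

definition linear_growth :: "real \<Rightarrow> real \<Rightarrow> (real \<Rightarrow> real) \<Rightarrow> bool" where
  "linear_growth A B k \<longleftrightarrow>
     k \<in> borel_measurable borel \<and> 0 \<le> A \<and> 0 \<le> B \<and> (\<forall>t>0. \<bar>k t\<bar> \<le> A + B * t)"

lemma linear_growthD:
  assumes "linear_growth A B k"
  shows "k \<in> borel_measurable borel" "0 \<le> A" "0 \<le> B" "t > 0 \<Longrightarrow> \<bar>k t\<bar> \<le> A + B * t"
  using assms unfolding linear_growth_def by auto

lemma linear_growth_set_integral:
  fixes w k :: "real \<Rightarrow> real"
  assumes k: "linear_growth A B k" and w: "w \<in> borel_measurable borel" "\<And>t. w t \<ge> 0"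
    and S: "S \<in> sets borel" "S \<subseteq> {0<..}"
    and int: "set_integrable lborel S w" "set_integrable lborel S (\<lambda>t. w t * t)"
  shows "set_integrable lborel S (\<lambda>t. w t * k t)"
    "\<bar>LINT t:S|lborel. w t * k t\<bar> \<le> A * (LINT t:S|lborel. w t) + B * (LINT t:S|lborel. w t * t)"
proof -
  note [measurable] = w(1) S(1) linear_growthD(1)[OF k]
  let ?g = "\<lambda>t. A * w t + B * (w t * t)"
  have dominating: "set_integrable lborel S ?g" by (intro set_integral_add set_integrable_mult_right int)
  have bound: "\<bar>w t * k t\<bar> \<le> ?g t" if "t \<in> S" for t
  proof -
    have "\<bar>w t * k t\<bar> = w t * \<bar>k t\<bar>" using w(2)[of t] by (simp add: abs_mult)
    also have "\<dots> \<le> w t * (A + B * t)"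
      using that S(2) by (intro mult_left_mono linear_growthD(4)[OF k] w(2)) auto
    also have "\<dots> = ?g t" by (simp add: algebra_simps)
    finally show ?thesis .
  qed
  show "set_integrable lborel S (\<lambda>t. w t * k t)"
    by (rule set_integrable_abs_bound[OF dominating]) (use bound in auto)
  have "\<bar>LINT t:S|lborel. w t * k t\<bar> \<le> (LINT t:S|lborel. ?g t)"
    by (rule abs_set_integral_le[OF dominating]) (use bound in auto)
  also have "\<dots> = A * (LINT t:S|lborel. w t) + B * (LINT t:S|lborel. w t * t)"
    by (simp add: int)
  finally show "\<bar>LINT t:S|lborel. w t * k t\<bar> \<le> A * (LINT t:S|lborel. w t) + B * (LINT t:S|lborel. w t * t)" .
qed

lemma
  assumes r: "r > 0" and k: "linear_growth A B k" and x: "x > 0"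
  shows set_integrable_green_lower: "set_integrable lborel {0<..x} (\<lambda>t. t powr (r - 1) * nbessel_I r t * k t)"
    and abs_green_lower_le:
      "\<bar>green_lower r k x\<bar> \<le> A * green_lower r (\<lambda>_. 1) x + B * green_lower r (\<lambda>t. t) x"
proof -
  have r_gt: "r > - 1" using r by simp
  have weight: "(\<lambda>t. t powr (r - 1) * nbessel_I r t) \<in> borel_measurable borel"
    "t powr (r - 1) * nbessel_I r t \<ge> 0" for t
    using r nbessel_I_pos[of r t] by auto
  note int = linear_growth_set_integral[OF k weight _ _ set_integrable_green_lower_one[OF r x]
      set_integrable_green_lower_ident[OF r_gt x]]
  show "set_integrable lborel {0<..x} (\<lambda>t. t powr (r - 1) * nbessel_I r t * k t)"
    by (rule int(1)) auto
  show "\<bar>green_lower r k x\<bar> \<le> A * green_lower r (\<lambda>_. 1) x + B * green_lower r (\<lambda>t. t) x"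
    unfolding green_lower_def mult_1_right by (rule int(2)) auto
qed

lemma
  assumes r: "r > 0" and k: "linear_growth A B k" and x: "x \<ge> 0"
  shows set_integrable_green_upper: "set_integrable lborel {x<..} (\<lambda>t. t powr (r - 1) * nbessel_K r t * k t)"
    and abs_green_upper_le:
      "\<bar>green_upper r k x\<bar> \<le> A * green_upper r (\<lambda>_. 1) x + B * green_upper r (\<lambda>t. t) x"
proof -
  have r_gt: "r > - 1" using r by simp
  have weight: "(\<lambda>t. t powr (r - 1) * nbessel_K r t) \<in> borel_measurable borel"
    "t powr (r - 1) * nbessel_K r t \<ge> 0" for t
    using nbessel_K_nonneg[of r t] by auto
  have subset: "{x<..} \<in> sets lborel" "{x<..} \<subseteq> {0<..}" using x by auto
  note int = linear_growth_set_integral[OF k weight _ subset(2)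
      set_integrable_subset[OF set_integrable_green_upper_one[OF r] subset]
      set_integrable_subset[OF set_integrable_green_upper_ident[OF r_gt] subset]]
  show "set_integrable lborel {x<..} (\<lambda>t. t powr (r - 1) * nbessel_K r t * k t)"
    by (rule int(1)) auto
  show "\<bar>green_upper r k x\<bar> \<le> A * green_upper r (\<lambda>_. 1) x + B * green_upper r (\<lambda>t. t) x"
    unfolding green_upper_def mult_1_right by (rule int(2)) auto
qed

lemma indefinite_integral_green_combination:
  assumes r: "r > 0" and k: "linear_growth A B k"
  shows "indefinite_integral 0 (\<lambda>z. \<alpha> * green_lower r k z + \<beta> * green_upper r k z)
    (\<lambda>t. t powr (r - 1) * (\<alpha> * nbessel_I r t - \<beta> * nbessel_K r t) * k t)"
proof -
  have "indefinite_integral 0 (\<lambda>z. \<alpha> * green_lower r k z + \<beta> * green_upper r k z)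
      (\<lambda>t. \<alpha> * (t powr (r - 1) * nbessel_I r t * k t) + \<beta> * - (t powr (r - 1) * nbessel_K r t * k t))"
    unfolding green_lower_def green_upper_def
    by (intro indefinite_integral_lincomb indefinite_integral_Ioc indefinite_integral_Ioi
        set_integrable_green_lower[OF r k] set_integrable_green_upper[OF r k]) auto
  then show ?thesis by (simp add: algebra_simps)
qed

definition green_density_bound ::
    "real \<Rightarrow> real \<Rightarrow> real \<Rightarrow> real \<Rightarrow> real \<Rightarrow> real \<Rightarrow> real" where
  "green_density_bound r A B \<alpha> \<beta> t = \<bar>t powr (r - 1) * (\<alpha> * nbessel_I r t - \<beta> * nbessel_K r t)\<bar> * (A + B * t)"

lemma isCont_green_density_bound: "r > - 1 \<Longrightarrow> t > 0 \<Longrightarrow> isCont (green_density_bound r A B \<alpha> \<beta>) t"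
  unfolding green_density_bound_def by (intro continuous_intros isCont_nbessel_I isCont_nbessel_K) auto

lemma abs_green_density_le:
  assumes "linear_growth A B k" "t > 0"
  shows "\<bar>t powr (r - 1) * (\<alpha> * nbessel_I r t - \<beta> * nbessel_K r t) * k t\<bar> \<le> green_density_bound r A B \<alpha> \<beta> t"
  unfolding green_density_bound_def abs_mult[of _ "k t"]
  using linear_growthD(4)[OF assms] by (intro mult_left_mono) auto

lemma isCont_green_combination:
  assumes "r > 0" "linear_growth A B k" "x > 0"
  shows "isCont (\<lambda>z. \<alpha> * green_lower r k z + \<beta> * green_upper r k z) x"
  using assms
  by (intro indefinite_integral_isCont[OF indefinite_integral_green_combination _ isCont_green_density_bound
        abs_green_density_le]) auto

lemma isCont_green_lower: "r > 0 \<Longrightarrow> linear_growth A B k \<Longrightarrow> x > 0 \<Longrightarrow> isCont (green_lower r k) x"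
  using isCont_green_combination[of r A B k x 1 0] by simp

lemma isCont_green_upper: "r > 0 \<Longrightarrow> linear_growth A B k \<Longrightarrow> x > 0 \<Longrightarrow> isCont (green_upper r k) x"
  using isCont_green_combination[of r A B k x 0 1] by simp

lemma has_real_derivative_green_combination:
  assumes r: "r > 0" and k: "linear_growth A B k" and x: "x > 0"
    and cont: "isCont (\<lambda>t. t powr (r - 1) * (\<alpha> * nbessel_I r t - \<beta> * nbessel_K r t) * k t) x"
  shows "((\<lambda>z. \<alpha> * green_lower r k z + \<beta> * green_upper r k z) has_real_derivative
     x powr (r - 1) * (\<alpha> * nbessel_I r x - \<beta> * nbessel_K r x) * k x) (at x)"
  by (rule indefinite_integral_has_real_derivative[OF indefinite_integral_green_combination[OF r k] x cont])

lemma linear_growth_one: "linear_growth 1 0 (\<lambda>_. 1)"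
  by (simp add: linear_growth_def)

lemma has_real_derivative_green_lower_one:
  assumes "r > 0" "x > 0"
  shows "(green_lower r (\<lambda>_. 1) has_real_derivative x powr (r - 1) * nbessel_I r x) (at x)"
proof -
  have "isCont (\<lambda>t. t powr (r - 1) * (1 * nbessel_I r t - 0 * nbessel_K r t) * 1) x"
    using assms by (auto intro!: continuous_intros isCont_nbessel_I)
  from has_real_derivative_green_combination[OF assms(1) linear_growth_one assms(2) this] show ?thesis by simp
qed

lemma has_real_derivative_green_upper_one:
  assumes "r > 0" "x > 0"
  shows "(green_upper r (\<lambda>_. 1) has_real_derivative - (x powr (r - 1) * nbessel_K r x)) (at x)"
proof -
  have "isCont (\<lambda>t. t powr (r - 1) * (0 * nbessel_I r t - 1 * nbessel_K r t) * 1) x"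
    using assms by (auto intro!: continuous_intros isCont_nbessel_K)
  from has_real_derivative_green_combination[OF assms(1) linear_growth_one assms(2) this] show ?thesis by simp
qed

subsection \<open>Monotonicity bounds\<close>

lemma green_lower_one_le:
  assumes r: "r > 0" and x: "x > 0"
  shows "green_lower r (\<lambda>_. 1) x \<le> x powr r * nbessel_I r x / r"
proof -
  let ?F = "\<lambda>x. x powr r * nbessel_I r x / r - green_lower r (\<lambda>_. 1) x"
  have "0 \<le> ?F x"
  proof (rule lim_at_right_le_of_deriv_nonneg[OF _ _ _ x])
    fix x :: real assume x: "x > 0"
    have "(?F has_real_derivative ((r * x powr r / x) * nbessel_I r x + (x * nbessel_I (r + 2) x) * x powr r) / r
        - x powr (r - 1) * nbessel_I r x) (at x)"
      using r x
      by (intro DERIV_diff DERIV_cdivide DERIV_mult has_real_derivative_powr' has_real_derivative_nbessel_I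
          has_real_derivative_green_lower_one) auto
    then show "(?F has_real_derivative x powr r * (x * nbessel_I (r + 2) x) / r) (at x)"
      using r x by (simp add: powr_diff field_simps)
    show "x powr r * (x * nbessel_I (r + 2) x) / r \<ge> 0" using x r nbessel_I_pos[of "r + 2" x] by simp
  next
    have "(?F \<longlongrightarrow> 0 * nbessel_I r 0 / r - 0) (at_right 0)"
      using r by (intro tendsto_intros tendsto_powr_at_right_0 nbessel_I_at_0 green_lower_one_at_0) auto
    then show "(?F \<longlongrightarrow> 0) (at_right 0)" by simp
  qed
  then show ?thesis by simp
qed

lemma green_lower_one_le_add2:
  assumes r: "r > 0" and x: "x > 0"
  shows "green_lower r (\<lambda>_. 1) x \<le> (1 + 1 / r) * (x powr r * nbessel_I (r + 2) x)"
proof -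
  let ?F = "\<lambda>x. (1 + 1 / r) * (x powr r * nbessel_I (r + 2) x) - green_lower r (\<lambda>_. 1) x"
  have "0 \<le> ?F x"
  proof (rule lim_at_right_le_of_deriv_nonneg[OF _ _ _ x])
    fix x :: real assume x: "x > 0"
    have "(?F has_real_derivative (1 + 1 / r) * ((r * x powr r / x) * nbessel_I (r + 2) x
        + (x * nbessel_I (r + 2 + 2) x) * x powr r) - x powr (r - 1) * nbessel_I r x) (at x)"
      using r x
      by (intro DERIV_diff DERIV_cmult DERIV_mult has_real_derivative_powr' has_real_derivative_nbessel_I
          has_real_derivative_green_lower_one) auto
    also have "r + 2 + 2 = r + 4" by simp
    also have "(1 + 1 / r) * ((r * x powr r / x) * nbessel_I (r + 2) x + (x * nbessel_I (r + 4) x) * x powr r)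
        - x powr (r - 1) * nbessel_I r x = x powr r * (x * nbessel_I (r + 4) x) / r"
      using r x nbessel_I_recurrence[of r x] by (simp add: powr_diff field_simps power2_eq_square)
    finally show "(?F has_real_derivative x powr r * (x * nbessel_I (r + 4) x) / r) (at x)" .
    show "x powr r * (x * nbessel_I (r + 4) x) / r \<ge> 0" using x r nbessel_I_pos[of "r + 4" x] by simp
  next
    have "(?F \<longlongrightarrow> (1 + 1 / r) * (0 * nbessel_I (r + 2) 0) - 0) (at_right 0)"
      using r by (intro tendsto_intros tendsto_powr_at_right_0 nbessel_I_at_0 green_lower_one_at_0) auto
    then show "(?F \<longlongrightarrow> 0) (at_right 0)" by simp
  qed
  then show ?thesis by simp
qed

lemma green_upper_one_le:
  assumes r: "r > 0" and x: "x > 0"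
  shows "green_upper r (\<lambda>_. 1) x \<le> x powr r * nbessel_K (r + 2) x"
proof -
  let ?F = "\<lambda>x. x powr r * nbessel_K (r + 2) x - green_upper r (\<lambda>_. 1) x"
  have "0 \<le> ?F x"
  proof (rule lim_at_top_le_of_deriv_nonpos[OF _ _ _ x])
    fix x :: real assume x: "x > 0"
    have "(?F has_real_derivative ((r * x powr r / x) * nbessel_K (r + 2) x +
        (- (x * nbessel_K (r + 2 + 2) x)) * x powr r)
        - - (x powr (r - 1) * nbessel_K r x)) (at x)"
      by (intro DERIV_diff DERIV_mult has_real_derivative_powr' has_real_derivative_nbessel_K
          has_real_derivative_green_upper_one r x)
    also have "r + 2 + 2 = r + 4" by simp
    also have "((r * x powr r / x) * nbessel_K (r + 2) x + (- (x * nbessel_K (r + 4) x)) * x powr r)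
        - - (x powr (r - 1) * nbessel_K r x)
        = x powr r / x * (r * nbessel_K (r + 2) x - x\<^sup>2 * nbessel_K (r + 4) x + nbessel_K r x)"
      using x by (simp add: powr_diff field_simps power2_eq_square)
    also have "\<dots> = - (x powr r * nbessel_K (r + 2) x / x)"
      unfolding nbessel_K_recurrence[OF x] using x by (simp add: field_simps)
    finally show "(?F has_real_derivative - (x powr r * nbessel_K (r + 2) x / x)) (at x)" .
    show "- (x powr r * nbessel_K (r + 2) x / x) \<le> 0" using x nbessel_K_nonneg[of "r + 2" x] by simp
  next
    have "(?F \<longlongrightarrow> 0 - 0) at_top"
      by (intro tendsto_diff nbessel_K_decay green_upper_one_at_top r)
    then show "(?F \<longlongrightarrow> 0) at_top" by simp
  qed
  then show ?thesis by simp
qed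

text \<open>
  The next two bounds say that \<open>p = x\<^sup>1\<^sup>/\<^sup>2 I\<^sub>\<nu>\<^sub>+\<^sub>1\<close> and \<open>q = x\<^sup>1\<^sup>/\<^sup>2 K\<^sub>\<nu>\<^sub>+\<^sub>1\<close> satisfy \<open>p' \<ge> p\<close> and \<open>q' \<le> - q\<close>:
  both solve \<open>u'' = V u\<close> with \<open>V \<ge> 1\<close>. As \<open>p' q - p q' = 1\<close>, this gives \<open>p q \<le> 1/2\<close>.
\<close>

lemma nbessel_I_ratio:
  assumes r: "r > 0" and x: "x > 0"
  shows "(x + r / 2) * nbessel_I (r + 2) x \<le> nbessel_I r x"
proof -
  let ?F = "\<lambda>x. (exp x * x powr (r / 2)) * (nbessel_I r x - (x + r / 2) * nbessel_I (r + 2) x)"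
  let ?F' = "\<lambda>x. (exp x * x powr (r / 2)) * (nbessel_I (r + 2) x * (r / 2 + r\<^sup>2 / 4) / x)"
  have "0 \<le> ?F x"
  proof (rule lim_at_right_le_of_deriv_nonneg[where f' = ?F', OF _ _ _ x])
    fix x :: real assume x: "x > 0"
    have deriv: "(?F has_real_derivative (exp x * x powr (r / 2) + (r / 2 * x powr (r / 2) / x) * exp x) *
        (nbessel_I r x - (x + r / 2) * nbessel_I (r + 2) x) +
            (x * nbessel_I (r + 2) x - ((1 + 0) * nbessel_I (r + 2) x
        + (x * nbessel_I (r + 2 + 2) x) * (x + r / 2))) * (exp x * x powr (r / 2))) (at x)"
      using r x
      by (intro DERIV_diff DERIV_mult DERIV_exp has_real_derivative_powr' has_real_derivative_nbessel_I DERIV_add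
          DERIV_ident DERIV_const) auto
    have recurrence: "nbessel_I (r + 2 + 2) x = (nbessel_I r x - (r + 1) * nbessel_I (r + 2) x) / x\<^sup>2"
      using nbessel_I_recurrence[of r x] r x by (simp add: field_simps)
    show "(?F has_real_derivative ?F' x) (at x)"
      by (rule DERIV_cong[OF deriv]) (unfold recurrence, use x in \<open>simp add: field_simps power2_eq_square\<close>)
    show "?F' x \<ge> 0" using x r nbessel_I_pos[of "r + 2" x] by simp
  next
    have "(?F \<longlongrightarrow> (exp 0 * 0) * (nbessel_I r 0 - (0 + r / 2) * nbessel_I (r + 2) 0)) (at_right 0)"
      using r by (intro tendsto_intros tendsto_powr_at_right_0 nbessel_I_at_0) auto
    then show "(?F \<longlongrightarrow> 0) (at_right 0)" by simp
  qed
  moreover have "exp x * x powr (r / 2) > 0" using x by simp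
  ultimately have "0 \<le> nbessel_I r x - (x + r / 2) * nbessel_I (r + 2) x" by (simp add: zero_le_mult_iff)
  then show ?thesis by simp
qed

lemma nbessel_K_ratio:
  assumes r: "r > 0" and x: "x > 0"
  shows "(x - r / 2) * nbessel_K (r + 2) x \<le> nbessel_K r x"
proof -
  let ?F = "\<lambda>x. (exp (- x) * x powr (r / 2)) * (nbessel_K r x - (x - r / 2) * nbessel_K (r + 2) x)"
  let ?F' = "\<lambda>x. - ((exp (- x) * x powr (r / 2)) * (nbessel_K (r + 2) x * (r / 2 + r\<^sup>2 / 4) / x))"
  have "0 \<le> ?F x"
  proof (rule lim_at_top_le_of_deriv_nonpos[where f' = ?F', OF _ _ _ x])
    fix x :: real assume x: "x > 0"
    have deriv: "(?F has_real_derivative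
        ((exp (- x) * - 1) * x powr (r / 2) + (r / 2 * x powr (r / 2) / x) * exp (- x)) *
        (nbessel_K r x - (x - r / 2) * nbessel_K (r + 2) x) +
            (- (x * nbessel_K (r + 2) x) - ((1 - 0) * nbessel_K (r + 2) x
        + (- (x * nbessel_K (r + 2 + 2) x)) * (x - r / 2))) * (exp (- x) * x powr (r / 2))) (at x)"
      by (intro DERIV_diff DERIV_mult DERIV_fun_exp DERIV_minus
          has_real_derivative_powr' has_real_derivative_nbessel_K
          DERIV_ident DERIV_const x)
    have recurrence: "nbessel_K (r + 2 + 2) x = (nbessel_K r x + (r + 1) * nbessel_K (r + 2) x) / x\<^sup>2"
      using nbessel_K_recurrence[OF x, of r] x by (simp add: field_simps)
    show "(?F has_real_derivative ?F' x) (at x)"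
      by (rule DERIV_cong[OF deriv]) (unfold recurrence, use x in \<open>simp add: field_simps power2_eq_square\<close>)
    show "?F' x \<le> 0" using x r nbessel_K_nonneg[of "r + 2" x] by simp
  next
    have exp_decay: "((\<lambda>x::real. exp (- x)) \<longlongrightarrow> 0) at_top"
      by (rule filterlim_compose[OF exp_at_bot filterlim_uminus_at_bot_at_top])
    have "((\<lambda>x. exp (- x) * (x powr (r / 2) * nbessel_K r x - x powr (r / 2 + 1) * nbessel_K (r + 2) x
        + r / 2 * (x powr (r / 2) * nbessel_K (r + 2) x))) \<longlongrightarrow> 0 * (0 - 0 + r / 2 * 0)) at_top"
      by (intro tendsto_intros nbessel_K_decay exp_decay)
    moreover have "\<forall>\<^sub>F x in at_top. exp (- x) * (x powr (r / 2) * nbessel_K r x -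
        x powr (r / 2 + 1) * nbessel_K (r + 2) x
        + r / 2 * (x powr (r / 2) * nbessel_K (r + 2) x)) = ?F x"
      using eventually_gt_at_top[of 0] by eventually_elim (simp add: powr_add algebra_simps)
    ultimately have "(?F \<longlongrightarrow> 0 * (0 - 0 + r / 2 * 0)) at_top" by (rule Lim_transform_eventually)
    then show "(?F \<longlongrightarrow> 0) at_top" by simp
  qed
  moreover have "exp (- x) * x powr (r / 2) > 0" using x by simp
  ultimately have "0 \<le> nbessel_K r x - (x - r / 2) * nbessel_K (r + 2) x" by (simp add: zero_le_mult_iff)
  then show ?thesis by simp
qed

lemma nbessel_product_le:
  assumes r: "r > 0" and x: "x > 0"
  shows "x\<^sup>2 * x powr r * (nbessel_I (r + 2) x * nbessel_K (r + 2) x) \<le> 1 / 2"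
proof -
  let ?I = "nbessel_I r x" and ?I2 = "nbessel_I (r + 2) x" and ?K = "nbessel_K r x"
    and ?K2 = "nbessel_K (r + 2) x"
  have nonneg: "?I2 \<ge> 0" "?K2 \<ge> 0" using r nbessel_I_pos[of "r + 2" x] by (auto simp: nbessel_K_nonneg)
  have "?I2 * ((x - r / 2) * ?K2) + (x + r / 2) * ?I2 * ?K2 \<le> ?I2 * ?K + ?I * ?K2"
    by (intro add_mono mult_left_mono mult_right_mono nbessel_I_ratio nbessel_K_ratio nonneg r x)
  then have "x powr (r + 1) * (2 * x * (?I2 * ?K2)) \<le> x powr (r + 1) * (?I2 * ?K + ?I * ?K2)"
    by (intro mult_left_mono) (auto simp: algebra_simps)
  then show ?thesis
    unfolding nbessel_wronskian[OF r x] unfolding powr_add_one[OF x] by (simp add: power2_eq_square ac_simps)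
qed

lemma mult_nstruve_0_le:
  assumes r: "r > 0" and x: "x > 0"
  shows "x * nstruve 0 r x \<le> 1 + 1 / (2 * r)"
proof -
  let ?I = "nbessel_I r x" and ?I2 = "nbessel_I (r + 2) x" and ?K = "nbessel_K r x"
    and ?K2 = "nbessel_K (r + 2) x"
  let ?p = "x powr r"
  have nonneg: "?I > 0" "?I2 > 0" "?K \<ge> 0" using r by (auto intro: nbessel_I_pos nbessel_K_nonneg)
  have "nstruve 0 r x \<le> ?K * ((1 + 1 / r) * (?p * ?I2)) + ?I * (?p * ?K2)"
    unfolding nstruve_0_eq_green[OF r x, symmetric] using nonneg
    by (intro add_mono mult_left_mono green_lower_one_le_add2 green_upper_one_le r x) auto
  then have "x * nstruve 0 r x \<le> x * (?K * ((1 + 1 / r) * (?p * ?I2)) + ?I * (?p * ?K2))"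
    using x by (intro mult_left_mono) auto
  also have "\<dots> = x powr (r + 1) * (?I2 * ?K + ?I * ?K2) + x * ?p * ?I2 * ?K / r"
    unfolding powr_add_one[OF x] by (simp add: algebra_simps add_divide_distrib)
  also have "\<dots> \<le> 1 + (1 / 2) / r"
  proof -
    have "x * ?p * ?I2 * ?K \<le> x * ?p * ?I2 * (x * ?K2)"
      using x nonneg r by (intro mult_left_mono nbessel_K_le_mult_add2) auto
    also have "\<dots> \<le> 1 / 2" using nbessel_product_le[OF r x] by (simp add: power2_eq_square ac_simps)
    finally show ?thesis
      unfolding nbessel_wronskian[OF r x] using r by (intro add_left_mono divide_right_mono) auto
  qed
  finally show ?thesis by simp
qed

definition green'_norm :: "real \<Rightarrow> real \<Rightarrow> real" where
  "green'_norm r x =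
      x * nbessel_K (r + 2) x * green_lower r (\<lambda>_. 1) x + x * nbessel_I (r + 2) x * green_upper r (\<lambda>_. 1) x"

lemma green'_norm_le:
  assumes r: "r > 0" and x: "x > 0"
  shows "green'_norm r x \<le> 2 / r"
proof -
  let ?I = "nbessel_I r x" and ?I2 = "nbessel_I (r + 2) x" and ?K = "nbessel_K r x"
    and ?K2 = "nbessel_K (r + 2) x"
  let ?p = "x powr r"
  have nonneg: "?I > 0" "?I2 > 0" "?K \<ge> 0" "?K2 \<ge> 0" using r by (auto intro: nbessel_I_pos nbessel_K_nonneg)
  have "x * ?p * (?I * ?K2) \<le> x * ?p * (?I2 * ?K + ?I * ?K2)"
    using nonneg x by (intro mult_left_mono) auto
  then have product_le: "x * ?p * (?I * ?K2) \<le> 1"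
    using nbessel_wronskian[OF r x] unfolding powr_add_one[OF x] by simp
  have "green'_norm r x \<le> x * ?K2 * (?p * ?I / r) + x * ?I2 * (?p * ?K2)"
    unfolding green'_norm_def using nonneg x
    by (intro add_mono mult_left_mono green_lower_one_le green_upper_one_le r) auto
  also have "x * ?I2 * (?p * ?K2) \<le> x * (?I / (r + 1)) * (?p * ?K2)"
    using nbessel_I_add2_le[of r x] x nonneg r by (intro mult_left_mono mult_right_mono) (auto simp: field_simps)
  also have "x * ?K2 * (?p * ?I / r) + x * (?I / (r + 1)) * (?p * ?K2) =
      x * ?p * (?I * ?K2) * (1 / r + 1 / (r + 1))"
    by (simp add: field_simps)
  also have "\<dots> \<le> 1 * (1 / r + 1 / (r + 1))"
    using product_le r by (intro mult_right_mono) auto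
  also have "1 / (r + 1) \<le> 1 / r" using r by (simp add: frac_le)
  finally show ?thesis by simp
qed

lemma mult_green'_norm_le:
  assumes r: "r > 0" and x: "x > 0"
  shows "x * green'_norm r x \<le> 1 + 1 / (2 * r)"
proof -
  let ?I2 = "nbessel_I (r + 2) x" and ?K2 = "nbessel_K (r + 2) x" and ?p = "x powr r"
  have nonneg: "?I2 > 0" "?K2 \<ge> 0" using r by (auto intro: nbessel_I_pos nbessel_K_nonneg)
  have "green'_norm r x \<le> x * ?K2 * ((1 + 1 / r) * (?p * ?I2)) + x * ?I2 * (?p * ?K2)"
    unfolding green'_norm_def using nonneg x
    by (intro add_mono mult_left_mono green_lower_one_le_add2 green_upper_one_le r) auto
  then have "x * green'_norm r x \<le> x * (x * ?K2 * ((1 + 1 / r) * (?p * ?I2)) + x * ?I2 * (?p * ?K2))"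
    using x by (intro mult_left_mono) auto
  also have "\<dots> = x\<^sup>2 * ?p * (?I2 * ?K2) * (2 + 1 / r)"
    by (simp add: algebra_simps power2_eq_square)
  also have "\<dots> \<le> 1 / 2 * (2 + 1 / r)"
    using nbessel_product_le[OF r x] r by (intro mult_right_mono) auto
  finally show ?thesis by (simp add: field_simps)
qed

subsection \<open>Solutions of the differential equation\<close>

definition green :: "real \<Rightarrow> (real \<Rightarrow> real) \<Rightarrow> real \<Rightarrow> real" where
  "green r k x = - (nbessel_K r x * green_lower r k x + nbessel_I r x * green_upper r k x)"

definition green' :: "real \<Rightarrow> (real \<Rightarrow> real) \<Rightarrow> real \<Rightarrow> real" where
  "green' r k x = x * nbessel_K (r + 2) x * green_lower r k x - x * nbessel_I (r + 2) x * green_upper r k x"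

definition green'' :: "real \<Rightarrow> (real \<Rightarrow> real) \<Rightarrow> real \<Rightarrow> real" where
  "green'' r k x = green r k x - r / x * green' r k x + k x / x"

lemma variation_of_parameters_bound:
  assumes r: "r > 0" and x: "x > 0" and B: "B \<ge> 0"
    and X: "\<bar>X\<bar> \<le> A * green_lower r (\<lambda>_. 1) x + B * green_lower r (\<lambda>t. t) x"
    and Y: "\<bar>Y\<bar> \<le> A * green_upper r (\<lambda>_. 1) x + B * green_upper r (\<lambda>t. t) x"
  shows "\<bar>nbessel_K r x * X + nbessel_I r x * Y\<bar> \<le> A * nstruve 0 r x + B"
    and "\<bar>x * nbessel_K (r + 2) x * X - x * nbessel_I (r + 2) x * Y\<bar> \<le> A * green'_norm r x + B"
proof -
  let ?P = "green_lower r (\<lambda>_. 1) x" and ?P' = "green_lower r (\<lambda>t. t) x"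
  let ?Q = "green_upper r (\<lambda>_. 1) x" and ?Q' = "green_upper r (\<lambda>t. t) x"
  have abs_le: "\<bar>a * X\<bar> + \<bar>b * Y\<bar> \<le> A * (a * ?P + b * ?Q) + B * (a * ?P' + b * ?Q')" if "a \<ge> 0" "b \<ge> 0" for a b
  proof -
    have "\<bar>a * X\<bar> + \<bar>b * Y\<bar> = a * \<bar>X\<bar> + b * \<bar>Y\<bar>" using that by (simp add: abs_mult)
    also have "\<dots> \<le> a * (A * ?P + B * ?P') + b * (A * ?Q + B * ?Q')"
      by (intro add_mono mult_left_mono X Y that)
    finally show ?thesis by (simp add: algebra_simps)
  qed
  have nonneg: "nbessel_K r x \<ge> 0" "nbessel_I r x \<ge> 0" "x * nbessel_K (r + 2) x \<ge> 0" "x * nbessel_I (r + 2) x \<ge> 0"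
    using r x nbessel_I_pos[of r x] nbessel_I_pos[of "r + 2" x] by (auto simp: nbessel_K_nonneg)
  have ident: "?P' = x powr (r + 1) * nbessel_I (r + 2) x" "?Q' = x powr (r + 1) * nbessel_K (r + 2) x"
    using r x by (simp_all add: green_lower_ident green_upper_ident)
  have one: "nbessel_K r x * ?P' + nbessel_I r x * ?Q' = 1"
    using nbessel_wronskian[OF r x] unfolding ident by (simp add: algebra_simps)
  show "\<bar>nbessel_K r x * X + nbessel_I r x * Y\<bar> \<le> A * nstruve 0 r x + B"
    using abs_le[OF nonneg(1,2)] unfolding nstruve_0_eq_green[OF r x] one by simp
  have "x * nbessel_K (r + 2) x * ?P' + x * nbessel_I (r + 2) x * ?Q'
      = 2 * (x\<^sup>2 * x powr r * (nbessel_I (r + 2) x * nbessel_K (r + 2) x))"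
    unfolding ident powr_add_one[OF x] by (simp add: algebra_simps power2_eq_square)
  then have "B * (x * nbessel_K (r + 2) x * ?P' + x * nbessel_I (r + 2) x * ?Q') \<le> B * 1"
    using nbessel_product_le[OF r x] by (intro mult_left_mono B) simp
  then show "\<bar>x * nbessel_K (r + 2) x * X - x * nbessel_I (r + 2) x * Y\<bar> \<le> A * green'_norm r x + B"
    using abs_le[OF nonneg(3,4)] unfolding green'_norm_def[symmetric] by linarith
qed

lemma
  assumes r: "r > 0" and k: "linear_growth A B k" and x: "x > 0"
  shows abs_green_le: "\<bar>green r k x\<bar> \<le> A * nstruve 0 r x + B"
    and abs_green'_le: "\<bar>green' r k x\<bar> \<le> A * green'_norm r x + B"
  using variation_of_parameters_bound[OF r x linear_growthD(3)[OF k] abs_green_lower_le[OF r k x]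
      abs_green_upper_le[OF r k less_imp_le[OF x]]]
  by (simp_all add: green_def green'_def)

lemma
  assumes r: "r > 0" and k: "linear_growth A B k" and x: "x > 0"
  shows abs_green_le_const: "\<bar>green r k x\<bar> \<le> A * nstruve 0 r 0 + B"
    and abs_green'_le_const: "\<bar>green' r k x\<bar> \<le> A * (2 / r) + B"
    and abs_green''_le: "\<bar>green'' r k x\<bar> \<le> A * nstruve 0 r 0 + 2 * B + (3 * A + r * B) / x"
proof -
  have "A * nstruve 0 r x \<le> A * nstruve 0 r 0"
    using x by (intro mult_left_mono nstruve_le r linear_growthD(2)[OF k]) auto
  with abs_green_le[OF assms] show g: "\<bar>green r k x\<bar> \<le> A * nstruve 0 r 0 + B" by linarith
  have "A * green'_norm r x \<le> A * (2 / r)"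
    by (intro mult_left_mono green'_norm_le r x linear_growthD(2)[OF k])
  with abs_green'_le[OF assms] show g': "\<bar>green' r k x\<bar> \<le> A * (2 / r) + B" by linarith
  have "\<bar>r / x * green' r k x\<bar> \<le> r / x * (A * (2 / r) + B)"
    unfolding abs_mult using r x g' by (intro mult_mono) auto
  moreover have "\<bar>k x / x\<bar> \<le> (A + B * x) / x"
    unfolding abs_divide using linear_growthD(4)[OF k x] x by (intro frac_le) auto
  ultimately have "\<bar>green'' r k x\<bar> \<le> A * nstruve 0 r 0 + B + r / x * (A * (2 / r) + B) + (A + B * x) / x"
    unfolding green''_def using g by linarith
  also have "\<dots> = A * nstruve 0 r 0 + 2 * B + (3 * A + r * B) / x"
    using r x by (simp add: field_simps)
  finally show "\<bar>green'' r k x\<bar> \<le> A * nstruve 0 r 0 + 2 * B + (3 * A + r * B) / x" .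
qed

lemma has_real_derivative_green:
  assumes r: "r > 0" and k: "linear_growth A B k" and x: "x > 0"
  shows "(green r k has_real_derivative green' r k x) (at x)"
proof -
  let ?X = "green_lower r k" and ?Y = "green_upper r k"
  let ?K = "nbessel_K r x" and ?I = "nbessel_I r x"
  let ?h = "\<lambda>t. t powr (r - 1) * (?K * nbessel_I r t - ?I * nbessel_K r t) * k t"
  have r_gt: "r > - 1" using r by simp
  have "(green_density_bound r A B ?K ?I \<longlongrightarrow> 0) (at x)"
    using isCont_green_density_bound[OF r_gt x, of A B ?K ?I]
    by (simp add: isCont_def green_density_bound_def mult.commute)
  moreover have "\<forall>\<^sub>F t in at x. norm (?h t) \<le> green_density_bound r A B ?K ?I t"
  proof -
    have "\<forall>\<^sub>F t in at x. t > 0" using eventually_at_in_open'[of "{0<..}" x] x by simp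
    then show ?thesis by eventually_elim (simp add: abs_green_density_le[OF k])
  qed
  ultimately have "isCont ?h x" by (simp add: isCont_def Lim_null_comparison mult.commute)
  then have "((\<lambda>z. ?K * ?X z + ?I * ?Y z) has_real_derivative ?h x) (at x)"
    by (rule has_real_derivative_green_combination[OF r k x])
  then have diag: "((\<lambda>z. ?K * ?X z + ?I * ?Y z) has_real_derivative 0) (at x)"
    by (simp add: mult.commute)
  have frozen: "((\<lambda>z. nbessel_K r z * ?X z + nbessel_I r z * ?Y z - (?K * ?X z + ?I * ?Y z)) has_real_derivative
      - (x * nbessel_K (r + 2) x) * ?X x + x * nbessel_I (r + 2) x * ?Y x) (at x)"
    by (intro has_real_derivative_frozen_coefficients has_real_derivative_nbessel_K
        has_real_derivative_nbessel_I r_gt x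
        isCont_green_lower[OF r k x] isCont_green_upper[OF r k x])
  from DERIV_minus[OF DERIV_add[OF frozen diag]] show ?thesis unfolding green_def[abs_def] green'_def by simp
qed

lemma has_real_derivative_mult_nbessel_I_add2:
  assumes "r > - 1"
  shows "((\<lambda>x. x * nbessel_I (r + 2) x) has_real_derivative nbessel_I r x - r * nbessel_I (r + 2) x) (at x)"
proof -
  have "((\<lambda>x. x * nbessel_I (r + 2) x) has_real_derivative
      1 * nbessel_I (r + 2) x + (x * nbessel_I (r + 2 + 2) x) * x) (at x)"
    using assms by (intro DERIV_mult DERIV_ident has_real_derivative_nbessel_I) auto
  moreover have "1 * nbessel_I (r + 2) x + (x * nbessel_I (r + 2 + 2) x) * x =
      nbessel_I r x - r * nbessel_I (r + 2) x"
    using nbessel_I_recurrence[OF assms, of x] by (simp add: power2_eq_square algebra_simps)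
  ultimately show ?thesis by simp
qed

lemma has_real_derivative_mult_nbessel_K_add2:
  assumes "x > 0"
  shows "((\<lambda>x. x * nbessel_K (r + 2) x) has_real_derivative - (nbessel_K r x + r * nbessel_K (r + 2) x)) (at x)"
proof -
  have "((\<lambda>x. x * nbessel_K (r + 2) x) has_real_derivative
      1 * nbessel_K (r + 2) x + (- (x * nbessel_K (r + 2 + 2) x)) * x) (at x)"
    by (intro DERIV_mult DERIV_ident has_real_derivative_nbessel_K assms)
  moreover have "1 * nbessel_K (r + 2) x + (- (x * nbessel_K (r + 2 + 2) x)) * x =
      - (nbessel_K r x + r * nbessel_K (r + 2) x)"
    using nbessel_K_recurrence[OF assms, of r] by (simp add: power2_eq_square algebra_simps)
  ultimately show ?thesis by simp
qed

lemma has_real_derivative_green'_frozen: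
  assumes r: "r > 0" and k: "linear_growth A B k" and x: "x > 0"
  shows "((\<lambda>z. green' r k z - (x * nbessel_K (r + 2) x * green_lower r k z +
      - (x * nbessel_I (r + 2) x) * green_upper r k z))
    has_real_derivative green r k x - r / x * green' r k x) (at x)"
proof -
  let ?X = "green_lower r k" and ?Y = "green_upper r k"
  let ?u = "\<lambda>z. z * nbessel_K (r + 2) z" and ?v = "\<lambda>z. - (z * nbessel_I (r + 2) z)"
  have "((\<lambda>z. ?u z * ?X z + ?v z * ?Y z - (?u x * ?X z + ?v x * ?Y z)) has_real_derivative
      - (nbessel_K r x + r * nbessel_K (r + 2) x) * ?X x +
          - (nbessel_I r x - r * nbessel_I (r + 2) x) * ?Y x) (at x)"
    using r
    by (intro has_real_derivative_frozen_coefficients DERIV_minus has_real_derivative_mult_nbessel_K_add2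
        has_real_derivative_mult_nbessel_I_add2 isCont_green_lower[OF r k x] isCont_green_upper[OF r k x] x) simp
  moreover have "- (nbessel_K r x + r * nbessel_K (r + 2) x) * ?X x +
      - (nbessel_I r x - r * nbessel_I (r + 2) x) * ?Y x
      = green r k x - r / x * green' r k x"
    unfolding green_def green'_def using x by (simp add: algebra_simps)
  moreover have "green' r k z = ?u z * ?X z + ?v z * ?Y z" for z
    unfolding green'_def by simp
  ultimately show ?thesis by simp
qed

lemma green'_density_diagonal:
  assumes r: "r > 0" and x: "x > 0"
  shows "x powr (r - 1) *
    (x * nbessel_K (r + 2) x * nbessel_I r x - - (x * nbessel_I (r + 2) x) * nbessel_K r x) = 1 / x"
proof -
  have pow: "x powr (r - 1) = x powr (r + 1) / (x * x)" using x by (simp add: powr_diff powr_add)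
  have "x powr (r - 1) * (x * nbessel_K (r + 2) x * nbessel_I r x - - (x * nbessel_I (r + 2) x) * nbessel_K r x) =
      x powr (r + 1) * (nbessel_I (r + 2) x * nbessel_K r x + nbessel_I r x * nbessel_K (r + 2) x) / x"
    unfolding pow using x by (simp add: field_simps)
  then show ?thesis unfolding nbessel_wronskian[OF r x] .
qed

lemma has_real_derivative_green':
  assumes r: "r > 0" and k: "linear_growth A B k" and x: "x > 0" and cont: "isCont k x"
  shows "(green' r k has_real_derivative green'' r k x) (at x)"
proof -
  let ?K2 = "x * nbessel_K (r + 2) x" and ?I2 = "- (x * nbessel_I (r + 2) x)"
  have "isCont (\<lambda>t. t powr (r - 1) * (?K2 * nbessel_I r t - ?I2 * nbessel_K r t) * k t) x"
    using x r by (intro continuous_intros isCont_nbessel_I isCont_nbessel_K cont) auto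
  from has_real_derivative_green_combination[OF r k x this]
  have "((\<lambda>z. ?K2 * green_lower r k z + ?I2 * green_upper r k z) has_real_derivative 1 / x * k x) (at x)"
    unfolding green'_density_diagonal[OF r x] .
  from DERIV_add[OF has_real_derivative_green'_frozen[OF r k x] this] show ?thesis
    unfolding green''_def by simp
qed

lemma abs_deriv_green'_diff_le:
  assumes r: "r > 0" and k: "linear_growth M 0 k" and x: "x > 0"
    and D: "(green' r k has_real_derivative D) (at x)"
  shows "\<bar>D - (green r k x - r / x * green' r k x)\<bar> \<le> M / x"
proof -
  let ?K2 = "x * nbessel_K (r + 2) x" and ?I2 = "- (x * nbessel_I (r + 2) x)"
  have r_gt: "r > - 1" using r by simp
  have "((\<lambda>z. ?K2 * green_lower r k z + ?I2 * green_upper r k z) has_real_derivative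
      D - (green r k x - r / x * green' r k x)) (at x)"
    using DERIV_diff[OF D has_real_derivative_green'_frozen[OF r k x]] by simp
  from abs_deriv_indefinite_integral_le[OF indefinite_integral_green_combination[OF r k] x
      isCont_green_density_bound[OF r_gt x] abs_green_density_le[OF k] this]
  show ?thesis unfolding green_density_bound_def green'_density_diagonal[OF r x] using x by simp
qed

text \<open>The equation of order \<open>r + 1\<close> solved by \<open>green' r k\<close>, obtained by differentiating that of \<open>green r k\<close>.\<close>

lemma has_real_derivative_green''_iff:
  assumes r: "r > 0" and k: "linear_growth A B k" and x: "x > 0" and cont: "isCont k x"
  shows "(green'' r k has_real_derivative D) (at x) \<longleftrightarrow>
    (k has_real_derivative x * D + (r + 1) * green'' r k x - x * green' r k x - green r k x) (at x)"
    (is "?L \<longleftrightarrow> (k has_real_derivative ?k') (at x)")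
proof
  note derivs = has_real_derivative_green[OF r k x] has_real_derivative_green'[OF r k x cont]
  assume D: ?L
  have "((\<lambda>z. z * green'' r k z - z * green r k z + r * green' r k z) has_real_derivative
      (1 * green'' r k x + D * x) - (1 * green r k x + green' r k x * x) + r * green'' r k x) (at x)"
    by (intro DERIV_add DERIV_diff DERIV_mult DERIV_cmult DERIV_ident derivs D)
  also have "(1 * green'' r k x + D * x) - (1 * green r k x + green' r k x * x) + r * green'' r k x = ?k'"
    by (simp add: algebra_simps)
  finally have deriv: "((\<lambda>z. z * green'' r k z - z * green r k z + r * green' r k z) has_real_derivative
      ?k') (at x)" .
  have "\<forall>\<^sub>F z in nhds x. z \<in> {0<..}" using x by (intro eventually_nhds_in_open) auto
  then have "\<forall>\<^sub>F z in nhds x. z * green'' r k z - z * green r k z + r * green' r k z = k z"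
    by eventually_elim (simp add: green''_def field_simps)
  from DERIV_cong_ev[OF refl this refl] deriv show "(k has_real_derivative ?k') (at x)" by simp
next
  note derivs = has_real_derivative_green[OF r k x] has_real_derivative_green'[OF r k x cont]
  assume k': "(k has_real_derivative ?k') (at x)"
  have "((\<lambda>z. r / z) has_real_derivative - (r / x\<^sup>2)) (at x)"
    using x by (auto intro!: derivative_eq_intros simp: power2_eq_square)
  moreover have "((\<lambda>z. k z / z) has_real_derivative (?k' * x - k x * 1) / (x * x)) (at x)"
    using x by (intro DERIV_divide k' DERIV_ident) simp
  ultimately have "((\<lambda>z. green r k z - r / z * green' r k z + k z / z) has_real_derivative
      green' r k x - (- (r / x\<^sup>2) * green' r k x + green'' r k x * (r / x)) +
          (?k' * x - k x * 1) / (x * x)) (at x)"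
    by (intro DERIV_add DERIV_diff DERIV_mult derivs)
  moreover have "green' r k x - (- (r / x\<^sup>2) * green' r k x + green'' r k x * (r / x)) +
      (?k' * x - k x * 1) / (x * x) = D"
    unfolding green''_def using x by (simp add: field_simps power2_eq_square)
  ultimately show ?L unfolding green''_def[abs_def] by simp
qed

lemma abs_lagrange_I_le:
  assumes r: "r > 0" and x: "x > 0"
    and g: "\<And>x. x > 0 \<Longrightarrow> (g has_real_derivative g' x) (at x)" "\<And>x. x > 0 \<Longrightarrow> (g' has_real_derivative g'' x) (at x)"
    and ode: "\<And>x. x > 0 \<Longrightarrow> \<bar>x * g'' x + r * g' x - x * g x\<bar> \<le> M"
    and lim: "(lagrange_I r g g' \<longlongrightarrow> 0) (at_right 0)"
  shows "\<bar>lagrange_I r g g' x\<bar> \<le> M * green_lower r (\<lambda>_. 1) x"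
proof (rule abs_le_of_abs_deriv_le_at_right[OF _ lim _ _ _ x])
  show "((\<lambda>t. M * green_lower r (\<lambda>_. 1) t) \<longlongrightarrow> 0) (at_right 0)"
    by (intro tendsto_mult_right_zero green_lower_one_at_0 r)
  fix t :: real assume t: "t > 0"
  show "(lagrange_I r g g' has_real_derivative
      t powr (r - 1) * nbessel_I r t * (t * g'' t + r * g' t - t * g t)) (at t)"
    using r by (intro has_real_derivative_lagrange_I g t) simp
  show "((\<lambda>t. M * green_lower r (\<lambda>_. 1) t) has_real_derivative M * (t powr (r - 1) * nbessel_I r t)) (at t)"
    by (intro DERIV_cmult has_real_derivative_green_lower_one r t)
  have w: "t powr (r - 1) * nbessel_I r t \<ge> 0" using r nbessel_I_pos[of r t] by simp
  show "\<bar>t powr (r - 1) * nbessel_I r t * (t * g'' t + r * g' t - t * g t)\<bar> \<le>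
      M * (t powr (r - 1) * nbessel_I r t)"
    unfolding abs_mult[of "t powr (r - 1) * nbessel_I r t"] abs_of_nonneg[OF w]
    using mult_left_mono[OF ode[OF t] w] by (simp only: mult.commute)
qed

lemma abs_lagrange_K_le:
  assumes r: "r > 0" and x: "x > 0"
    and g: "\<And>x. x > 0 \<Longrightarrow> (g has_real_derivative g' x) (at x)" "\<And>x. x > 0 \<Longrightarrow> (g' has_real_derivative g'' x) (at x)"
    and ode: "\<And>x. x > 0 \<Longrightarrow> \<bar>x * g'' x + r * g' x - x * g x\<bar> \<le> M"
    and lim: "(lagrange_K r g g' \<longlongrightarrow> 0) at_top"
  shows "\<bar>lagrange_K r g g' x\<bar> \<le> M * green_upper r (\<lambda>_. 1) x"
proof (rule abs_le_of_abs_deriv_le_at_top[OF _ lim _ _ _ x])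
  show "((\<lambda>t. M * green_upper r (\<lambda>_. 1) t) \<longlongrightarrow> 0) at_top"
    by (intro tendsto_mult_right_zero green_upper_one_at_top r)
  fix t :: real assume t: "t > 0"
  show "(lagrange_K r g g' has_real_derivative
      t powr (r - 1) * nbessel_K r t * (t * g'' t + r * g' t - t * g t)) (at t)"
    using r by (intro has_real_derivative_lagrange_K g t) simp
  show "((\<lambda>t. M * green_upper r (\<lambda>_. 1) t) has_real_derivative - (M * (t powr (r - 1) * nbessel_K r t))) (at t)"
    using DERIV_cmult[OF has_real_derivative_green_upper_one[OF r t], of M] by simp
  have w: "t powr (r - 1) * nbessel_K r t \<ge> 0" using nbessel_K_nonneg[of r t] by simp
  show "\<bar>t powr (r - 1) * nbessel_K r t * (t * g'' t + r * g' t - t * g t)\<bar> \<le>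
      M * (t powr (r - 1) * nbessel_K r t)"
    unfolding abs_mult[of "t powr (r - 1) * nbessel_K r t"] abs_of_nonneg[OF w]
    using mult_left_mono[OF ode[OF t] w] by (simp only: mult.commute)
qed

lemma lagrange_I_at_0:
  assumes r: "r > 1"
    and g: "\<And>x. x > 0 \<Longrightarrow> \<bar>g x\<bar> \<le> C" and g': "\<And>x. x > 0 \<Longrightarrow> \<bar>g' x\<bar> \<le> C * (1 + 1 / x)"
  shows "(lagrange_I r g g' \<longlongrightarrow> 0) (at_right 0)"
proof -
  have "((\<lambda>t. t powr r * g' t) \<longlongrightarrow> 0) (at_right 0)"
  proof (rule Lim_null_comparison)
    have "((\<lambda>t. C * (t powr r + t powr (r - 1))) \<longlongrightarrow> C * (0 + 0)) (at_right 0)"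
      using r by (intro tendsto_intros tendsto_powr_at_right_0) auto
    then show "((\<lambda>t. C * (t powr r + t powr (r - 1))) \<longlongrightarrow> 0) (at_right 0)" by simp
    show "\<forall>\<^sub>F t in at_right 0. norm (t powr r * g' t) \<le> C * (t powr r + t powr (r - 1))"
      using eventually_at_right_less[of 0]
    proof eventually_elim
      case (elim t)
      have "norm (t powr r * g' t) \<le> t powr r * (C * (1 + 1 / t))"
        using g'[OF elim] by (simp add: abs_mult mult_left_mono)
      also have "\<dots> = C * (t powr r + t powr (r - 1))" using elim by (simp add: powr_diff field_simps)
      finally show ?case .
    qed
  qed
  moreover have "((\<lambda>t. t powr (r + 1) * nbessel_I (r + 2) t * g t) \<longlongrightarrow> 0) (at_right 0)"
  proof (rule lim_null_mult_right_bounded)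
    show "((\<lambda>t. t powr (r + 1) * nbessel_I (r + 2) t) \<longlongrightarrow> 0) (at_right 0)"
      using tendsto_mult[OF tendsto_powr_at_right_0[of "r + 1"] nbessel_I_at_0[of "r + 2"]] r by simp
    show "\<forall>\<^sub>F t in at_right 0. norm (g t) \<le> C"
      using eventually_at_right_less[of 0] by eventually_elim (simp add: g)
  qed
  ultimately have "(lagrange_I r g g' \<longlongrightarrow> 0 * nbessel_I r 0 - 0) (at_right 0)"
    unfolding lagrange_I_def[abs_def] using r by (intro tendsto_diff tendsto_mult nbessel_I_at_0) simp_all
  then show ?thesis by simp
qed

lemma a_priori_bound:
  assumes r: "r > 1" and x: "x > 0"
    and g: "\<And>x. x > 0 \<Longrightarrow> (g has_real_derivative g' x) (at x)" "\<And>x. x > 0 \<Longrightarrow> (g' has_real_derivative g'' x) (at x)"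
    and ode: "\<And>x. x > 0 \<Longrightarrow> \<bar>x * g'' x + r * g' x - x * g x\<bar> \<le> M"
    and bounded: "\<And>x. x > 0 \<Longrightarrow> \<bar>g x\<bar> \<le> C" "\<And>x. x > 0 \<Longrightarrow> \<bar>g' x\<bar> \<le> C * (1 + 1 / x)"
  shows "\<bar>g x\<bar> \<le> M * nstruve 0 r x" and "\<bar>g' x\<bar> \<le> M * green'_norm r x"
proof -
  let ?U = "lagrange_I r g g' x" and ?V = "lagrange_K r g g' x"
  have r_pos: "r > 0" using r by simp
  have U: "\<bar>?U\<bar> \<le> M * green_lower r (\<lambda>_. 1) x"
    by (rule abs_lagrange_I_le[OF r_pos x g ode lagrange_I_at_0[OF r bounded]])
  have "\<forall>\<^sub>F t in at_top. \<bar>g t\<bar> \<le> 2 * C \<and> \<bar>g' t\<bar> \<le> 2 * C"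
    using eventually_ge_at_top[of 1]
  proof eventually_elim
    case (elim t)
    have "C \<ge> 0" using bounded(1)[OF x] by linarith
    then have "C * (1 + 1 / t) \<le> C * 2" using elim by (intro mult_left_mono) auto
    with bounded[of t] elim \<open>C \<ge> 0\<close> show ?case by simp
  qed
  then have "(lagrange_K r g g' \<longlongrightarrow> 0) at_top"
    by (intro lagrange_K_at_top[where C = "2 * C"]) (simp_all add: eventually_conj_iff)
  then have V: "\<bar>?V\<bar> \<le> M * green_upper r (\<lambda>_. 1) x"
    by (intro abs_lagrange_K_le[OF r_pos x g ode])
  have "\<bar>nbessel_K r x * ?U + nbessel_I r x * - ?V\<bar> \<le> M * nstruve 0 r x + 0"
    by (rule variation_of_parameters_bound[OF r_pos x]) (use U V in simp_all)
  then show "\<bar>g x\<bar> \<le> M * nstruve 0 r x"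
    using lagrange_inversion(1)[OF r_pos x, of g g'] by simp
  have "\<bar>x * nbessel_K (r + 2) x * ?U - x * nbessel_I (r + 2) x * - ?V\<bar> \<le> M * green'_norm r x + 0"
    by (rule variation_of_parameters_bound[OF r_pos x]) (use U V in simp_all)
  then show "\<bar>g' x\<bar> \<le> M * green'_norm r x"
    using lagrange_inversion(2)[OF r_pos x, of g g'] by simp
qed

subsection \<open>Lipschitz right-hand sides\<close>

lemma green'_bounds_of_deriv_bounded:
  assumes r: "r > 0" and k: "linear_growth A B k" and x: "x > 0"
    and k': "\<And>t. t > 0 \<Longrightarrow> (k has_real_derivative k' t) (at t)" "\<And>t. t > 0 \<Longrightarrow> \<bar>k' t\<bar> \<le> B"
  defines "M \<equiv> A * nstruve 0 r 0 + 2 * B"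
  shows "\<bar>green' r k x\<bar> \<le> M * nstruve 0 (r + 1) x" and "\<bar>green'' r k x\<bar> \<le> M * green'_norm (r + 1) x"
proof -
  define g'' where "g'' = (\<lambda>x. (green r k x + k' x - (r + 1) * green'' r k x + x * green' r k x) / x)"
  have deriv: "(green' r k has_real_derivative green'' r k t) (at t)"
    "(green'' r k has_real_derivative g'' t) (at t)"
    if t: "t > 0" for t
  proof -
    have cont: "isCont k t" using k'(1)[OF t] by (rule DERIV_isCont)
    then show "(green' r k has_real_derivative green'' r k t) (at t)"
      by (rule has_real_derivative_green'[OF r k t])
    have "t * g'' t + (r + 1) * green'' r k t - t * green' r k t - green r k t = k' t"
      unfolding g''_def using t by simp
    with k'(1)[OF t] show "(green'' r k has_real_derivative g'' t) (at t)"
      by (subst has_real_derivative_green''_iff[OF r k t cont]) simp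
  qed
  have ode: "\<bar>t * g'' t + (r + 1) * green'' r k t - t * green' r k t\<bar> \<le> M" if t: "t > 0" for t
  proof -
    have "t * g'' t + (r + 1) * green'' r k t - t * green' r k t = green r k t + k' t"
      unfolding g''_def using t by simp
    then show ?thesis
      using k'(2)[OF t] abs_green_le_const[OF r k t] unfolding M_def by linarith
  qed
  define C where "C = A * (2 / r) + B + M + (3 * A + r * B)"
  note AB = linear_growthD(2,3)[OF k]
  have nonneg: "0 \<le> A * (2 / r)" "0 \<le> M" "0 \<le> 3 * A + r * B"
    unfolding M_def using AB r nstruve_0_pos[OF r] by auto
  have bound': "\<bar>green' r k t\<bar> \<le> C" if "t > 0" for t
    using abs_green'_le_const[OF r k that] nonneg AB unfolding C_def by linarith
  have bound'': "\<bar>green'' r k t\<bar> \<le> C * (1 + 1 / t)" if t: "t > 0" for t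
  proof -
    have "\<bar>green'' r k t\<bar> \<le> M + (3 * A + r * B) / t"
      using abs_green''_le[OF r k t] unfolding M_def .
    also have "M \<le> C" using nonneg AB unfolding C_def by linarith
    also have "3 * A + r * B \<le> C" using nonneg AB unfolding C_def by linarith
    finally show ?thesis using t by (simp add: distrib_left divide_right_mono)
  qed
  have r1: "r + 1 > 1" using r by simp
  show "\<bar>green' r k x\<bar> \<le> M * nstruve 0 (r + 1) x"
    by (rule a_priori_bound(1)[OF r1 x deriv ode bound' bound''])
  show "\<bar>green'' r k x\<bar> \<le> M * green'_norm (r + 1) x"
    by (rule a_priori_bound(2)[OF r1 x deriv ode bound' bound''])
qed

lemma lipschitz_smoothing:
  fixes k :: "real \<Rightarrow> real"
  assumes lip: "L-lipschitz_on UNIV k" and e: "e > 0"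
  obtains l l' where "\<And>t. (l has_real_derivative l' t) (at t)" "\<And>t. \<bar>l' t\<bar> \<le> L" "\<And>t. \<bar>k t - l t\<bar> \<le> L * e"
proof -
  have "isCont k t" for t
    using lipschitz_on_continuous_on[OF lip] by (simp add: continuous_on_eq_continuous_at)
  then have "\<exists>F. \<forall>t::real. -\<infinity> < ereal t \<longrightarrow> ereal t < \<infinity> \<longrightarrow> (F has_vector_derivative k t) (at t)"
    by (intro einterval_antiderivative) auto
  then obtain F where F: "\<And>t. (F has_real_derivative k t) (at t)"
    by (auto simp: has_real_derivative_iff_has_vector_derivative)
  have diff: "\<bar>k s - k t\<bar> \<le> L * \<bar>s - t\<bar>" for s t
    using lipschitz_onD[OF lip, of s t] by (simp add: dist_real_def)
  show thesis
  proof
    fix t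
    show "((\<lambda>t. (F (t + e) - F t) / e) has_real_derivative (k (t + e) - k t) / e) (at t)"
      by (intro DERIV_cdivide DERIV_diff F DERIV_shift[THEN iffD1])
    show "\<bar>(k (t + e) - k t) / e\<bar> \<le> L"
      unfolding abs_divide using diff[of "t + e" t] e by (simp add: field_simps)
    have "\<exists>z>t. z < t + e \<and> F (t + e) - F t = (t + e - t) * k z"
      using e by (intro MVT2 F) auto
    then obtain z where z: "t < z" "z < t + e" "F (t + e) - F t = e * k z" by auto
    have "\<bar>k t - k z\<bar> \<le> L * \<bar>t - z\<bar>" by (rule diff)
    also have "\<dots> \<le> L * e" using z lipschitz_on_nonneg[OF lip] by (intro mult_left_mono) auto
    finally show "\<bar>k t - (F (t + e) - F t) / e\<bar> \<le> L * e" unfolding z(3) using e by simp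
  qed
qed

lemma
  assumes r: "r > 0" and x: "x > 0" and k: "linear_growth A B k" and l: "linear_growth A' B' l"
  shows green'_diff: "green' r (\<lambda>t. k t - l t) x = green' r k x - green' r l x"
    and green''_diff: "green'' r (\<lambda>t. k t - l t) x = green'' r k x - green'' r l x"
proof -
  note lower = set_integrable_green_lower[OF r _ x] and upper =
      set_integrable_green_upper[OF r _ less_imp_le[OF x]]
  have X: "green_lower r (\<lambda>t. k t - l t) x = green_lower r k x - green_lower r l x"
    unfolding green_lower_def right_diff_distrib by (rule set_integral_diff(2)[OF lower[OF k] lower[OF l]])
  have Y: "green_upper r (\<lambda>t. k t - l t) x = green_upper r k x - green_upper r l x"
    unfolding green_upper_def right_diff_distrib by (rule set_integral_diff(2)[OF upper[OF k] upper[OF l]])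
  show g': "green' r (\<lambda>t. k t - l t) x = green' r k x - green' r l x"
    unfolding green'_def X Y by (simp add: algebra_simps)
  show "green'' r (\<lambda>t. k t - l t) x = green'' r k x - green'' r l x"
    unfolding green''_def green_def g' X Y by (simp add: algebra_simps diff_divide_distrib)
qed

lemma le_of_le_add_mult_eps:
  fixes a b c :: real
  assumes "\<And>e. e > 0 \<Longrightarrow> a \<le> b + e * c"
  shows "a \<le> b"
proof (rule tendsto_lowerbound)
  show "((\<lambda>e. b + e * c) \<longlongrightarrow> b) (at_right 0)" by (auto intro!: tendsto_eq_intros)
  show "\<forall>\<^sub>F e in at_right 0. a \<le> b + e * c"
    using eventually_at_right_less[of 0] by eventually_elim (rule assms)
qed simp

lemma green'_bounds_by_smoothing:
  assumes r: "r > 0" and k: "linear_growth A B k" and lip: "B-lipschitz_on UNIV k" and x: "x > 0" and e: "e > 0"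
  defines "E \<equiv> nstruve 0 r 0"
  defines "M \<equiv> A * E + 2 * B"
  shows "\<bar>green' r k x\<bar> \<le> (M + e * (B * E)) * nstruve 0 (r + 1) x + e * (B * (2 / r))"
    and "\<bar>green'' r k x\<bar> \<le> (M + e * (B * E)) * green'_norm (r + 1) x + e * (B * E + 3 * B / x)"
proof -
  obtain l l' where l: "\<And>t. (l has_real_derivative l' t) (at t)" "\<And>t. \<bar>l' t\<bar> \<le> B"
    and near: "\<And>t. \<bar>k t - l t\<bar> \<le> B * e"
    using lipschitz_smoothing[OF lip e] by blast
  note [measurable] = linear_growthD(1)[OF k]
  have [measurable]: "l \<in> borel_measurable borel"
    by (intro borel_measurable_continuous_onI continuous_at_imp_continuous_on ballI DERIV_isCont[OF l(1)])
  have "\<bar>l t\<bar> \<le> A + B * e + B * t" if "t > 0" for t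
    using linear_growthD(4)[OF k that] near[of t] by linarith
  then have growth_l: "linear_growth (A + B * e) B l"
    using linear_growthD(2,3)[OF k] e unfolding linear_growth_def by simp
  have growth_diff: "linear_growth (B * e) 0 (\<lambda>t. k t - l t)"
    using near linear_growthD(3)[OF k] e unfolding linear_growth_def by simp
  have M: "(A + B * e) * E + 2 * B = M + e * (B * E)"
    unfolding M_def by (simp add: algebra_simps)
  note smooth = green'_bounds_of_deriv_bounded[OF r growth_l x l, folded E_def, unfolded M]
  show "\<bar>green' r k x\<bar> \<le> (M + e * (B * E)) * nstruve 0 (r + 1) x + e * (B * (2 / r))"
    using abs_green'_le_const[OF r growth_diff x] smooth(1) unfolding green'_diff[OF r x k growth_l]
    by (simp add: mult_ac)
  show "\<bar>green'' r k x\<bar> \<le> (M + e * (B * E)) * green'_norm (r + 1) x + e * (B * E + 3 * B / x)"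
    using abs_green''_le[OF r growth_diff x, folded E_def] smooth(2) unfolding green''_diff[OF r x k growth_l]
    by (simp add: algebra_simps)
qed

lemma
  assumes r: "r > 0" and k: "linear_growth A B k" and lip: "B-lipschitz_on UNIV k" and x: "x > 0"
  defines "M \<equiv> A * nstruve 0 r 0 + 2 * B"
  shows abs_green'_le_of_lipschitz: "\<bar>green' r k x\<bar> \<le> M * nstruve 0 (r + 1) x"
    and abs_green''_le_of_lipschitz: "\<bar>green'' r k x\<bar> \<le> M * green'_norm (r + 1) x"
proof -
  let ?E = "nstruve 0 r 0"
  note approx = green'_bounds_by_smoothing[OF r k lip x, folded M_def]
  show "\<bar>green' r k x\<bar> \<le> M * nstruve 0 (r + 1) x"
  proof (rule le_of_le_add_mult_eps)
    show "\<bar>green' r k x\<bar> \<le>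
        M * nstruve 0 (r + 1) x + e * (B * ?E * nstruve 0 (r + 1) x + B * (2 / r))" if "e > 0" for e
      using approx(1)[OF that] by (simp add: distrib_left distrib_right mult.assoc)
  qed
  show "\<bar>green'' r k x\<bar> \<le> M * green'_norm (r + 1) x"
  proof (rule le_of_le_add_mult_eps)
    show "\<bar>green'' r k x\<bar> \<le>
        M * green'_norm (r + 1) x + e * (B * ?E * green'_norm (r + 1) x + (B * ?E + 3 * B / x))"
      if "e > 0" for e
      using approx(2)[OF that] by (simp add: distrib_left distrib_right mult.assoc)
  qed
qed

lemma abs_deriv_le_of_lipschitz:
  fixes k :: "real \<Rightarrow> real"
  assumes "L-lipschitz_on UNIV k" "(k has_real_derivative D) (at x)"
  shows "\<bar>D\<bar> \<le> L"
  using lipschitz_onD[OF assms(1)]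
  by (intro abs_deriv_le_of_increment[OF assms(2)] always_eventually) (simp add: dist_real_def)

lemma abs_mult_deriv_green''_le:
  assumes r: "r > 0" and k: "linear_growth A B k" and lip: "B-lipschitz_on UNIV k" and x: "x > 0"
    and D: "(green'' r k has_real_derivative D) (at x)"
  defines "M \<equiv> A * nstruve 0 r 0 + 2 * B"
  shows "\<bar>x * D\<bar> \<le> (4 + 1 / (2 * (r + 1))) * M"
proof -
  have r1: "r + 1 > 0" using r by simp
  have M: "M \<ge> 0" unfolding M_def using linear_growthD(2,3)[OF k] nstruve_0_pos[OF r] by simp
  have "isCont k x"
    using lipschitz_on_continuous_on[OF lip] by (simp add: continuous_on_eq_continuous_at)
  then have "(k has_real_derivative x * D + (r + 1) * green'' r k x - x * green' r k x - green r k x) (at x)"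
    using D by (subst (asm) has_real_derivative_green''_iff[OF r k x])
  then have "\<bar>x * D + (r + 1) * green'' r k x - x * green' r k x - green r k x\<bar> \<le> B"
    by (rule abs_deriv_le_of_lipschitz[OF lip])
  then have rhs: "\<bar>x * D + (r + 1) * green'' r k x - x * green' r k x\<bar> \<le> M"
    using abs_green_le_const[OF r k x] unfolding M_def by linarith
  have "\<bar>x * green' r k x\<bar> \<le> x * (M * nstruve 0 (r + 1) x)"
    unfolding abs_mult M_def using x by (intro mult_mono abs_green'_le_of_lipschitz r k lip) auto
  also have "\<dots> = x * nstruve 0 (r + 1) x * M" by simp
  also have "\<dots> \<le> (1 + 1 / (2 * (r + 1))) * M"
    using M by (intro mult_right_mono mult_nstruve_0_le r1 x)
  finally have g': "\<bar>x * green' r k x\<bar> \<le> (1 + 1 / (2 * (r + 1))) * M" .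
  have "\<bar>(r + 1) * green'' r k x\<bar> \<le> (r + 1) * (M * green'_norm (r + 1) x)"
    unfolding abs_mult M_def using r by (intro mult_mono abs_green''_le_of_lipschitz k lip x) auto
  also have "\<dots> \<le> (r + 1) * (M * (2 / (r + 1)))"
    using r M by (intro mult_left_mono green'_norm_le x) auto
  also have "\<dots> = 2 * M" using r by simp
  finally have g'': "\<bar>(r + 1) * green'' r k x\<bar> \<le> 2 * M" .
  have "(4 + 1 / (2 * (r + 1))) * M = M + (1 + 1 / (2 * (r + 1))) * M + 2 * M"
    by (simp add: algebra_simps)
  with rhs g' g'' show ?thesis by linarith
qed

subsection \<open>Bounds on the half-line\<close>

lemma has_nth_deriv_green_Suc_iff:
  assumes "r > 0" "linear_growth A B k" "x > 0"
  shows "has_nth_deriv (green r k) (Suc n) x D \<longleftrightarrow> has_nth_deriv (green' r k) n x D"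
  by (rule has_nth_deriv_Suc_iff[of "{0<..}"]) (use assms in \<open>auto intro: has_real_derivative_green\<close>)

lemma has_nth_deriv_green'_Suc_iff:
  assumes "r > 0" "linear_growth A B k" "continuous_on UNIV k" "x > 0"
  shows "has_nth_deriv (green' r k) (Suc n) x D \<longleftrightarrow> has_nth_deriv (green'' r k) n x D"
proof (rule has_nth_deriv_Suc_iff[of "{0<..}"])
  have "isCont k t" for t using assms(3) by (simp add: continuous_on_eq_continuous_at)
  then show "(green' r k has_real_derivative green'' r k t) (at t)" if "t \<in> {0<..}" for t
    using that by (intro has_real_derivative_green'[OF assms(1,2)]) auto
qed (use assms in auto)

lemma
  assumes r: "r > 0" and k: "linear_growth M 0 k" and x: "x > 0"
  shows abs_mult_green_le: "\<bar>x * green r k x\<bar> \<le> (1 + 1 / (2 * r)) * M"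
    and abs_mult_green_deriv_1_le: "has_nth_deriv (green r k) 1 x D \<Longrightarrow> \<bar>x * D\<bar> \<le> (1 + 1 / (2 * r)) * M"
    and abs_mult_green_deriv_2_le: "has_nth_deriv (green r k) 2 x D \<Longrightarrow> \<bar>x * D\<bar> \<le> (4 + 1 / (2 * r)) * M"
proof -
  have M: "M \<ge> 0" by (rule linear_growthD(2)[OF k])
  have "\<bar>x * green r k x\<bar> \<le> x * (M * nstruve 0 r x)"
    unfolding abs_mult using abs_green_le[OF r k x] x by (intro mult_mono) auto
  also have "\<dots> = x * nstruve 0 r x * M" by simp
  also have "\<dots> \<le> (1 + 1 / (2 * r)) * M" using M by (intro mult_right_mono mult_nstruve_0_le r x)
  finally show g: "\<bar>x * green r k x\<bar> \<le> (1 + 1 / (2 * r)) * M" .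
  have "\<bar>x * green' r k x\<bar> \<le> x * (M * green'_norm r x)"
    unfolding abs_mult using abs_green'_le[OF r k x] x by (intro mult_mono) auto
  also have "\<dots> = x * green'_norm r x * M" by simp
  also have "\<dots> \<le> (1 + 1 / (2 * r)) * M" using M by (intro mult_right_mono mult_green'_norm_le r x)
  finally have g': "\<bar>x * green' r k x\<bar> \<le> (1 + 1 / (2 * r)) * M" .
  show "\<bar>x * D\<bar> \<le> (1 + 1 / (2 * r)) * M" if "has_nth_deriv (green r k) 1 x D"
    using that g' by (simp add: has_nth_deriv_green_Suc_iff[OF r k x] del: has_nth_deriv.simps(2))
  assume "has_nth_deriv (green r k) 2 x D"
  then have "(green' r k has_real_derivative D) (at x)"
    by (simp add: numeral_2_eq_2 has_nth_deriv_green_Suc_iff[OF r k x]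
        has_nth_deriv_Suc_0_iff del: has_nth_deriv.simps(2))
  from abs_deriv_green'_diff_le[OF r k x this]
  have "x * \<bar>D - (green r k x - r / x * green' r k x)\<bar> \<le> x * (M / x)" using x by (intro mult_left_mono) auto
  also have "x * \<bar>D - (green r k x - r / x * green' r k x)\<bar> = \<bar>x * D - x * green r k x + r * green' r k x\<bar>"
    using x by (simp add: abs_mult_pos' algebra_simps)
  finally have "\<bar>x * D - x * green r k x + r * green' r k x\<bar> \<le> M" using x by simp
  moreover have "\<bar>r * green' r k x\<bar> \<le> r * (M * (2 / r))"
    unfolding abs_mult using abs_green'_le_const[OF r k x] r by (intro mult_mono) auto
  then have "\<bar>r * green' r k x\<bar> \<le> 2 * M" using r by simp
  moreover have "(4 + 1 / (2 * r)) * M = M + (1 + 1 / (2 * r)) * M + 2 * M" by (simp add: algebra_simps)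
  ultimately show "\<bar>x * D\<bar> \<le> (4 + 1 / (2 * r)) * M" using g by linarith
qed

lemma
  assumes r: "r > 0" and k: "linear_growth A B k" and lip: "B-lipschitz_on UNIV k" and x: "x > 0"
  shows lipschitz_green_deriv_1_iff: "has_nth_deriv (green r k) 1 x D \<longleftrightarrow> D = green' r k x"
    and lipschitz_green_deriv_2_iff: "has_nth_deriv (green r k) 2 x D \<longleftrightarrow> D = green'' r k x"
    and lipschitz_green_deriv_3_iff: "has_nth_deriv (green r k) 3 x D \<longleftrightarrow>
        (green'' r k has_real_derivative D) (at x)"
proof -
  note g' = has_nth_deriv_green_Suc_iff[OF r k x]
    and g'' = has_nth_deriv_green'_Suc_iff[OF r k lipschitz_on_continuous_on[OF lip] x]
  show "has_nth_deriv (green r k) 1 x D \<longleftrightarrow> D = green' r k x"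
    unfolding One_nat_def g' by simp
  show "has_nth_deriv (green r k) 2 x D \<longleftrightarrow> D = green'' r k x"
    unfolding numeral_2_eq_2 g' g'' by simp
  show "has_nth_deriv (green r k) 3 x D \<longleftrightarrow> (green'' r k has_real_derivative D) (at x)"
    unfolding numeral_3_eq_3 g' g'' has_nth_deriv_Suc_0_iff ..
qed

lemma
  assumes r: "r > 0" and k: "linear_growth A B k" and lip: "B-lipschitz_on UNIV k" and x: "x > 0"
  defines "M \<equiv> A * nstruve 0 r 0 + 2 * B"
  shows lipschitz_green_deriv_1_le: "has_nth_deriv (green r k) 1 x D \<Longrightarrow> \<bar>D\<bar> \<le> nstruve 0 (r + 1) 0 * M"
    and lipschitz_mult_green_deriv_1_le:
      "has_nth_deriv (green r k) 1 x D \<Longrightarrow> \<bar>x * D\<bar> \<le> (1 + 1 / (2 * (r + 1))) * M"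
    and lipschitz_green_deriv_2_le: "has_nth_deriv (green r k) 2 x D \<Longrightarrow> \<bar>D\<bar> \<le> 2 / (r + 1) * M"
    and lipschitz_mult_green_deriv_2_le:
      "has_nth_deriv (green r k) 2 x D \<Longrightarrow> \<bar>x * D\<bar> \<le> (1 + 1 / (2 * (r + 1))) * M"
    and lipschitz_mult_green_deriv_3_le:
      "has_nth_deriv (green r k) 3 x D \<Longrightarrow> \<bar>x * D\<bar> \<le> (4 + 1 / (2 * (r + 1))) * M"
proof -
  have r1: "r + 1 > 0" using r by simp
  have M: "M \<ge> 0" unfolding M_def using linear_growthD(2,3)[OF k] nstruve_0_pos[OF r] by simp
  have bound: "\<bar>D\<bar> \<le> c * M" if "\<bar>D\<bar> \<le> M * b" "b \<le> c" for D b c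
    using that(1) mult_right_mono[OF that(2) M] by (simp add: mult.commute)
  have mult_bound: "\<bar>x * D\<bar> \<le> c * M" if "\<bar>D\<bar> \<le> M * b" "x * b \<le> c" for D b c
  proof -
    have "\<bar>x * D\<bar> \<le> x * (M * b)" using that(1) x by (simp add: abs_mult)
    also have "\<dots> = x * b * M" by simp
    also have "\<dots> \<le> c * M" by (rule mult_right_mono[OF that(2) M])
    finally show ?thesis .
  qed
  note g' = abs_green'_le_of_lipschitz[OF r k lip x, folded M_def]
    and g'' = abs_green''_le_of_lipschitz[OF r k lip x, folded M_def]
  show "\<bar>D\<bar> \<le> nstruve 0 (r + 1) 0 * M"
    "\<bar>x * D\<bar> \<le> (1 + 1 / (2 * (r + 1))) * M" if "has_nth_deriv (green r k) 1 x D"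
    using that bound[OF g' nstruve_le[OF r1]] mult_bound[OF g' mult_nstruve_0_le[OF r1 x]] x
    unfolding lipschitz_green_deriv_1_iff[OF r k lip x] by auto
  show "\<bar>D\<bar> \<le> 2 / (r + 1) * M" "\<bar>x * D\<bar> \<le> (1 + 1 / (2 * (r + 1))) * M" if "has_nth_deriv (green r k) 2 x D"
    using that bound[OF g'' green'_norm_le[OF r1 x]] mult_bound[OF g'' mult_green'_norm_le[OF r1 x]]
    unfolding lipschitz_green_deriv_2_iff[OF r k lip x] by auto
  show "\<bar>x * D\<bar> \<le> (4 + 1 / (2 * (r + 1))) * M" if "has_nth_deriv (green r k) 3 x D"
    using that unfolding lipschitz_green_deriv_3_iff[OF r k lip x] M_def
    by (rule abs_mult_deriv_green''_le[OF r k lip x])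
qed

lemma green_at_0:
  assumes r: "r > 0" and k: "linear_growth A B k"
  shows "(green r k \<longlongrightarrow> - (nbessel_I r 0 * green_upper r k 0)) (at_right 0)"
proof -
  note A = linear_growthD(2)[OF k]
  have "((\<lambda>x. nbessel_K r x * green_lower r k x) \<longlongrightarrow> 0) (at_right 0)"
  proof (rule Lim_null_comparison)
    let ?g = "\<lambda>x. x powr r * nbessel_K r x * (A * (nbessel_I r x / r) + B * (x * nbessel_I (r + 2) x))"
    have "(?g \<longlongrightarrow> 0 * (A * (nbessel_I r 0 / r) + B * (0 * nbessel_I (r + 2) 0))) (at_right 0)"
      using r by (intro tendsto_intros nbessel_K_at_0 nbessel_I_at_0) auto
    then show "(?g \<longlongrightarrow> 0) (at_right 0)" by simp
    show "\<forall>\<^sub>F x in at_right 0. norm (nbessel_K r x * green_lower r k x) \<le> ?g x"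
      using eventually_at_right_less[of 0]
    proof eventually_elim
      case (elim x)
      have "norm (nbessel_K r x * green_lower r k x) = nbessel_K r x * \<bar>green_lower r k x\<bar>"
        by (simp add: abs_mult nbessel_K_nonneg)
      also have "\<dots> \<le> nbessel_K r x * (A * green_lower r (\<lambda>_. 1) x + B * green_lower r (\<lambda>t. t) x)"
        by (intro mult_left_mono abs_green_lower_le r k elim nbessel_K_nonneg)
      also have "\<dots> \<le> nbessel_K r x * (A * (x powr r * nbessel_I r x / r) + B * green_lower r (\<lambda>t. t) x)"
        by (intro mult_left_mono add_right_mono green_lower_one_le r elim nbessel_K_nonneg A)
      also have "green_lower r (\<lambda>t. t) x = x * x powr r * nbessel_I (r + 2) x"
        using r elim by (simp add: green_lower_ident powr_add_one)
      finally show ?case by (simp add: algebra_simps)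
    qed
  qed
  moreover have "(green_upper r k \<longlongrightarrow> green_upper r k 0) (at_right 0)"
    unfolding green_upper_def[abs_def]
    by (intro tendsto_set_integral_Ioi_at_right set_integrable_green_upper[OF r k]) simp
  ultimately have "((\<lambda>x. - (nbessel_K r x * green_lower r k x + nbessel_I r x * green_upper r k x)) \<longlongrightarrow>
      - (0 + nbessel_I r 0 * green_upper r k 0)) (at_right 0)"
    using r by (intro tendsto_intros nbessel_I_at_0) simp_all
  then show ?thesis unfolding green_def[abs_def] by simp
qed

subsection \<open>The symmetric variance-gamma distribution\<close>

lemma mult_svg_pdf_affine:
  assumes r: "r > 0" and \<sigma>: "\<sigma> > 0"
  shows "\<sigma> * svg_pdf r \<sigma> \<mu> (\<mu> + \<sigma> * t) =
    \<bar>t\<bar> powr (r - 1) * nbessel_K r \<bar>t\<bar> / (2 * green_upper r (\<lambda>_. 1) 0)"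
proof (cases "t = 0")
  case False
  define n where "n = (r - 1) / 2"
  have n: "(1 - r) / 2 = - n" "r - 1 = n + n" "(r + 1) / 2 = n + 1" "1 / 2 + r / 2 = n + 1"
    unfolding n_def by (simp_all add: field_simps)
  have "Gamma (n + 1) > 0" "Gamma (r / 2) > 0"
    using r by (auto intro!: Gamma_real_pos simp: n_def field_simps)
  then have "2 * green_upper r (\<lambda>_. 1) 0 = sqrt pi * Gamma (r / 2) * 2 powr n"
    unfolding green_upper_one_0[OF r] nstruve_0[OF r] nbessel_I_0 nbessel_I_coeff_def Beta_def n
    by (simp add: Gamma_one_half_real powr_minus field_simps)
  moreover have "\<bar>t\<bar> powr (r - 1) * nbessel_K r \<bar>t\<bar> = \<bar>t\<bar> powr n * bessel_K n \<bar>t\<bar>"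
    unfolding nbessel_K_def n(1,2) powr_add n_def[symmetric] using False by (simp add: powr_minus field_simps)
  moreover have "\<sigma> * svg_pdf r \<sigma> \<mu> (\<mu> + \<sigma> * t) =
      1 / (sqrt pi * Gamma (r / 2)) * (\<bar>t\<bar> / 2) powr n * bessel_K n \<bar>t\<bar>"
    unfolding svg_pdf_def n_def[symmetric] using \<sigma> by (simp add: abs_mult)
  ultimately show ?thesis by (simp add: powr_divide field_simps)
qed (use \<sigma> in \<open>simp add: svg_pdf_def\<close>)

lemma
  assumes r: "r > 0" and \<sigma>: "\<sigma> > 0"
    and g: "linear_growth A B (\<lambda>t. g (\<mu> + \<sigma> * t))" "linear_growth A' B' (\<lambda>t. g (\<mu> - \<sigma> * t))"
  shows integrable_svg_pdf_mult: "integrable lborel (\<lambda>x. svg_pdf r \<sigma> \<mu> x * g x)"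
    and svg_expect_eq_green_upper: "svg_expect r \<sigma> \<mu> g =
      (green_upper r (\<lambda>t. g (\<mu> + \<sigma> * t)) 0 + green_upper r (\<lambda>t. g (\<mu> - \<sigma> * t)) 0) / (2 * green_upper r (\<lambda>_. 1) 0)"
proof -
  let ?m = "2 * green_upper r (\<lambda>_. 1) 0"
  let ?\<kappa> = "\<lambda>t. \<bar>t\<bar> powr (r - 1) * nbessel_K r \<bar>t\<bar> * g (\<mu> + \<sigma> * t)"
  note [measurable] = linear_growthD(1)[OF g(1)]
  have right: "?\<kappa> t = t powr (r - 1) * nbessel_K r t * g (\<mu> + \<sigma> * t)"
    and left: "?\<kappa> (- t) = t powr (r - 1) * nbessel_K r t * g (\<mu> - \<sigma> * t)" if "t \<in> {0<..}" for t
    using that by auto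
  have "set_integrable lborel {0<..} ?\<kappa>"
    using set_integrable_green_upper[OF r g(1), of 0] by (subst set_integrable_cong[OF refl refl right]) auto
  moreover have "set_integrable lborel {0<..} (\<lambda>t. ?\<kappa> (- t))"
    using set_integrable_green_upper[OF r g(2), of 0] by (subst set_integrable_cong[OF refl refl left]) auto
  ultimately have \<kappa>: "integrable lborel ?\<kappa>"
    by (subst integrable_lborel_iff_half_lines) auto
  have pdf: "svg_pdf r \<sigma> \<mu> (\<mu> + \<sigma> * t) * g (\<mu> + \<sigma> * t) = ?\<kappa> t / (\<sigma> * ?m)" for t
  proof -
    have "svg_pdf r \<sigma> \<mu> (\<mu> + \<sigma> * t) = \<sigma> * svg_pdf r \<sigma> \<mu> (\<mu> + \<sigma> * t) / \<sigma>" using \<sigma> by simp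
    then show ?thesis unfolding mult_svg_pdf_affine[OF r \<sigma>] by simp
  qed
  have "integrable lborel (\<lambda>t. svg_pdf r \<sigma> \<mu> (\<mu> + \<sigma> * t) * g (\<mu> + \<sigma> * t))"
    unfolding pdf by (rule integrable_divide) (use \<kappa> in simp)
  then show "integrable lborel (\<lambda>x. svg_pdf r \<sigma> \<mu> x * g x)"
    using \<sigma> by (subst (asm) lborel_integrable_real_affine_iff) auto
  have "svg_expect r \<sigma> \<mu> g = \<sigma> * (LINT t|lborel. svg_pdf r \<sigma> \<mu> (\<mu> + \<sigma> * t) * g (\<mu> + \<sigma> * t))"
    unfolding svg_expect_def using \<sigma> by (subst lborel_integral_real_affine[where c = \<sigma> and t = \<mu>]) auto
  also have "\<dots> = (LINT t|lborel. ?\<kappa> t) / ?m"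
    unfolding pdf using \<sigma> by simp
  also have "(LINT t|lborel. ?\<kappa> t) = (LINT t:{0<..}|lborel. ?\<kappa> t) + (LINT t:{0<..}|lborel. ?\<kappa> (- t))"
    by (intro integral_lborel_half_lines \<kappa>) measurable
  also have "(LINT t:{0<..}|lborel. ?\<kappa> t) = green_upper r (\<lambda>t. g (\<mu> + \<sigma> * t)) 0"
    unfolding green_upper_def by (intro set_lebesgue_integral_cong allI impI right) auto
  also have "(LINT t:{0<..}|lborel. ?\<kappa> (- t)) = green_upper r (\<lambda>t. g (\<mu> - \<sigma> * t)) 0"
    unfolding green_upper_def by (intro set_lebesgue_integral_cong allI impI left) auto
  finally show "svg_expect r \<sigma> \<mu> g =
      (green_upper r (\<lambda>t. g (\<mu> + \<sigma> * t)) 0 + green_upper r (\<lambda>t. g (\<mu> - \<sigma> * t)) 0) / ?m" .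
qed

lemma green_upper_one_0_pos: "r > 0 \<Longrightarrow> green_upper r (\<lambda>_. 1) 0 > 0"
  by (simp add: green_upper_one_0 nstruve_0_pos nbessel_I_pos)

lemma
  assumes "r > 0" "\<sigma> > 0"
  shows integrable_svg_pdf: "integrable lborel (svg_pdf r \<sigma> \<mu>)"
    and integral_svg_pdf: "(LINT x|lborel. svg_pdf r \<sigma> \<mu> x) = 1"
  using integrable_svg_pdf_mult[OF assms linear_growth_one linear_growth_one, of \<mu>]
    svg_expect_eq_green_upper[OF assms linear_growth_one linear_growth_one, of \<mu>]
        green_upper_one_0_pos[OF assms(1)]
  by (simp_all add: svg_expect_def)

lemma
  assumes r: "r > 0" and \<sigma>: "\<sigma> > 0"
  shows integrable_svg_abs_deviation: "integrable lborel (\<lambda>x. svg_pdf r \<sigma> \<mu> x * \<bar>x - \<mu>\<bar>)"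
    and svg_expect_abs_deviation: "svg_expect r \<sigma> \<mu> (\<lambda>x. \<bar>x - \<mu>\<bar>) = \<sigma> / nstruve 0 r 0"
proof -
  have growth: "linear_growth 0 \<sigma> (\<lambda>t. \<bar>\<mu> + \<sigma> * t - \<mu>\<bar>)" "linear_growth 0 \<sigma> (\<lambda>t. \<bar>\<mu> - \<sigma> * t - \<mu>\<bar>)"
    using \<sigma> by (auto simp: linear_growth_def abs_mult)
  show "integrable lborel (\<lambda>x. svg_pdf r \<sigma> \<mu> x * \<bar>x - \<mu>\<bar>)"
    by (rule integrable_svg_pdf_mult[OF r \<sigma> growth])
  have "green_upper r (\<lambda>t. \<sigma> * \<bar>t\<bar>) 0 = (LINT t:{0<..}|lborel. \<sigma> * (t powr (r - 1) * nbessel_K r t * t))"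
    unfolding green_upper_def by (intro set_lebesgue_integral_cong) auto
  also have "\<dots> = \<sigma> / nbessel_I r 0"
    using green_upper_ident_0[of r] r unfolding green_upper_def by simp
  finally have "green_upper r (\<lambda>t. \<sigma> * \<bar>t\<bar>) 0 = \<sigma> / nbessel_I r 0" .
  moreover have "nbessel_I r 0 > 0" using r by (intro nbessel_I_pos) simp
  ultimately show "svg_expect r \<sigma> \<mu> (\<lambda>x. \<bar>x - \<mu>\<bar>) = \<sigma> / nstruve 0 r 0"
    unfolding svg_expect_eq_green_upper[OF r \<sigma> growth] green_upper_one_0[OF r]
    using \<sigma> by (simp add: abs_mult)
qed

lemma svg_pdf_reflect: "svg_pdf r \<sigma> \<mu> (2 * \<mu> - x) = svg_pdf r \<sigma> \<mu> x"
  by (simp add: svg_pdf_def abs_minus_commute)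

lemma svg_expect_reflect: "svg_expect r \<sigma> \<mu> (\<lambda>x. h (2 * \<mu> - x)) = svg_expect r \<sigma> \<mu> h"
  unfolding svg_expect_def
  using lborel_integral_real_affine[of "-1" "\<lambda>x. svg_pdf r \<sigma> \<mu> x * h x" "2 * \<mu>"] by (simp add: svg_pdf_reflect)

subsection \<open>The Stein solution on the two half-lines\<close>

lemma set_integral_powr_rescale:
  fixes c d f :: "real \<Rightarrow> real"
  assumes \<sigma>: "\<sigma> > 0" and S: "\<And>t. \<sigma> * t \<in> S \<longleftrightarrow> t \<in> T" and T: "T \<subseteq> {0<..}"
    and c: "\<And>t. t > 0 \<Longrightarrow> c t = t powr n * d t"
  shows "(LINT t:S|lborel. \<bar>t\<bar> powr n * c (\<bar>t\<bar> / \<sigma>) * f t) =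
    \<sigma> * \<sigma> powr n * (LINT t:T|lborel. t powr (2 * n) * d t * f (\<sigma> * t))"
proof -
  have scaled: "indicat_real S (0 + \<sigma> * t) *\<^sub>R (\<bar>0 + \<sigma> * t\<bar> powr n * c (\<bar>0 + \<sigma> * t\<bar> / \<sigma>) * f (0 + \<sigma> * t))
      = \<sigma> powr n * (indicat_real T t *\<^sub>R (t powr (2 * n) * d t * f (\<sigma> * t)))" for t
  proof (cases "t \<in> T")
    case True
    then have "t > 0" using T by auto
    then show ?thesis
      unfolding mult_2 powr_add using True S[of t] c[of t] \<sigma> by (simp add: powr_mult abs_mult)
  qed (simp add: S)
  have "(LINT t:S|lborel. \<bar>t\<bar> powr n * c (\<bar>t\<bar> / \<sigma>) * f t) =
      \<bar>\<sigma>\<bar> *\<^sub>R (LINT t|lborel. \<sigma> powr n * (indicat_real T t *\<^sub>R (t powr (2 * n) * d t * f (\<sigma> * t))))"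
    unfolding set_lebesgue_integral_def scaled[symmetric] using \<sigma> by (intro lborel_integral_real_affine) simp
  then show ?thesis
    unfolding set_lebesgue_integral_def using \<sigma> by simp
qed

lemma svg_stein_formula_right:
  assumes r: "r > 0" and \<sigma>: "\<sigma> > 0" and z: "z > 0"
  shows "svg_stein_formula r \<sigma> \<mu> h (\<mu> + \<sigma> * z) = green r (\<lambda>t. h (\<mu> + \<sigma> * t) - svg_expect r \<sigma> \<mu> h) z / \<sigma>"
proof -
  define n where "n = (r - 1) / 2"
  have r_gt: "r > - 1" using r by simp
  have n: "(1 - r) / 2 = - n" "r - 1 = 2 * n" unfolding n_def by (simp_all add: field_simps)
  let ?k = "\<lambda>t. h (\<mu> + \<sigma> * t) - svg_expect r \<sigma> \<mu> h" and ?h = "\<lambda>t. h (t + \<mu>) - svg_expect r \<sigma> \<mu> h"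
  have I: "bessel_I n t = t powr n * nbessel_I r t"
    and K: "bessel_K n t = t powr n * nbessel_K r t" if "t > 0" for t
    using bessel_I_eq_nbessel_I[OF r_gt that] that unfolding nbessel_K_def n(1) n_def[symmetric]
    by (simp_all add: powr_minus)
  have "(LBINT t=ereal 0..ereal (\<sigma> * z). \<bar>t\<bar> powr n * bessel_I n (\<bar>t\<bar> / \<sigma>) * ?h t) =
      (LINT t:{0<..\<sigma> * z}|lborel. \<bar>t\<bar> powr n * bessel_I n (\<bar>t\<bar> / \<sigma>) * ?h t)"
    using \<sigma> z by (intro interval_integral_Ioc) simp
  also have "\<dots> = \<sigma> * \<sigma> powr n * (LINT t:{0<..z}|lborel. t powr (2 * n) * nbessel_I r t * ?h (\<sigma> * t))"
    using \<sigma> by (intro set_integral_powr_rescale I) (auto simp: zero_less_mult_iff)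
  finally have X: "(LBINT t=ereal 0..ereal (\<sigma> * z). \<bar>t\<bar> powr n * bessel_I n (\<bar>t\<bar> / \<sigma>) * ?h t) =
      \<sigma> * \<sigma> powr n * green_lower r ?k z"
    unfolding green_lower_def n(2) by (simp add: add.commute)
  have "(LBINT t=ereal (\<sigma> * z)..PInfty. \<bar>t\<bar> powr n * bessel_K n (\<bar>t\<bar> / \<sigma>) * ?h t) =
      (LINT t:{\<sigma> * z<..}|lborel. \<bar>t\<bar> powr n * bessel_K n (\<bar>t\<bar> / \<sigma>) * ?h t)"
    by (simp add: interval_integral_to_infinity_eq flip: infinity_ereal_def)
  also have "\<dots> = \<sigma> * \<sigma> powr n * (LINT t:{z<..}|lborel. t powr (2 * n) * nbessel_K r t * ?h (\<sigma> * t))"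
    using \<sigma> z by (intro set_integral_powr_rescale K) auto
  finally have Y: "(LBINT t=ereal (\<sigma> * z)..PInfty. \<bar>t\<bar> powr n * bessel_K n (\<bar>t\<bar> / \<sigma>) * ?h t) =
      \<sigma> * \<sigma> powr n * green_upper r ?k z"
    unfolding green_upper_def n(2) by (simp add: add.commute)
  have "svg_stein_formula r \<sigma> \<mu> h (\<mu> + \<sigma> * z) =
      - (bessel_K n z / (\<sigma>\<^sup>2 * (\<sigma> * z) powr n)) * (\<sigma> * \<sigma> powr n * green_lower r ?k z)
      - bessel_I n z / (\<sigma>\<^sup>2 * (\<sigma> * z) powr n) * (\<sigma> * \<sigma> powr n * green_upper r ?k z)"
    unfolding svg_stein_formula_def Let_def n_def[symmetric] add_diff_cancel_left' X Y using \<sigma> z by simp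
  also have "\<dots> = green r ?k z / \<sigma>"
    unfolding green_def I[OF z] K[OF z] using \<sigma> z by (simp add: powr_mult field_simps power2_eq_square)
  finally show ?thesis .
qed

lemma
  fixes r \<sigma> \<mu> :: real and h :: "real \<Rightarrow> real"
  assumes r: "r > 0" and \<sigma>: "\<sigma> > 0" and h: "integrable lborel (\<lambda>x. svg_pdf r \<sigma> \<mu> x * h x)"
  defines "\<kappa> \<equiv> \<lambda>t. \<bar>t\<bar> powr ((r - 1) / 2) * bessel_K ((r - 1) / 2) (\<bar>t\<bar> / \<sigma>) * (h (t + \<mu>) - svg_expect r \<sigma> \<mu> h)"
  shows integrable_svg_centred: "integrable lborel \<kappa>"
    and integral_svg_centred: "(LINT t|lborel. \<kappa> t) = 0"
proof -
  define c where "c = \<sigma> * sqrt pi * Gamma (r / 2) * (2 * \<sigma>) powr ((r - 1) / 2)"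
  let ?\<phi> = "\<lambda>x. c * (svg_pdf r \<sigma> \<mu> x * h x - svg_expect r \<sigma> \<mu> h * svg_pdf r \<sigma> \<mu> x)"
  have "Gamma (r / 2) > 0" using r by (intro Gamma_real_pos) simp
  then have \<kappa>: "\<kappa> = (\<lambda>t. ?\<phi> (\<mu> + 1 * t))"
    unfolding \<kappa>_def svg_pdf_def c_def using \<sigma> by (auto simp: powr_divide powr_mult field_simps)
  have \<phi>: "integrable lborel ?\<phi>"
    by (intro integrable_mult_right Bochner_Integration.integrable_diff h integrable_svg_pdf r \<sigma>)
  then show "integrable lborel \<kappa>"
    unfolding \<kappa> by (rule lborel_integrable_real_affine) simp
  have "(LINT t|lborel. \<kappa> t) = (LINT x|lborel. ?\<phi> x)"
    unfolding \<kappa> using lborel_integral_real_affine[of 1 ?\<phi> \<mu>, symmetric] by simp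
  also have "\<dots> = 0"
    using h integrable_svg_pdf[OF r \<sigma>] by (simp add: svg_expect_def integral_svg_pdf[OF r \<sigma>])
  finally show "(LINT t|lborel. \<kappa> t) = 0" .
qed

text \<open>Reflection exchanges the two tails, which costs nothing because \<open>h - E h(Z)\<close> has mean zero.\<close>

lemma svg_stein_formula_reflect:
  assumes r: "r > 0" and \<sigma>: "\<sigma> > 0" and h: "integrable lborel (\<lambda>x. svg_pdf r \<sigma> \<mu> x * h x)"
  shows "svg_stein_formula r \<sigma> \<mu> h (\<mu> - y) = - svg_stein_formula r \<sigma> \<mu> (\<lambda>t. h (2 * \<mu> - t)) (\<mu> + y)"
proof -
  define n where "n = (r - 1) / 2"
  define m where "m = svg_expect r \<sigma> \<mu> h"
  let ?I = "\<lambda>t. \<bar>t\<bar> powr n * bessel_I n (\<bar>t\<bar> / \<sigma>)" and ?K = "\<lambda>t. \<bar>t\<bar> powr n * bessel_K n (\<bar>t\<bar> / \<sigma>)"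
  let ?h = "\<lambda>t. h (t + \<mu>) - m" and ?h' = "\<lambda>t. h (2 * \<mu> - (t + \<mu>)) - m"
  have h': "?h' t = ?h (- t)" for t by (simp add: algebra_simps)
  have X: "(LBINT t=ereal 0..ereal (- y). ?I t * ?h t) = - (LBINT t=ereal 0..ereal y. ?I t * ?h' t)"
  proof -
    have "(LBINT t=ereal 0..ereal (- y). ?I t * ?h t) = (LBINT t=ereal y..ereal 0. ?I t * ?h' t)"
      unfolding h' by (subst interval_integral_reflect) simp
    also have "\<dots> = - (LBINT t=ereal 0..ereal y. ?I t * ?h' t)"
      by (rule interval_integral_endpoints_reverse)
    finally show ?thesis .
  qed
  have Y: "(LBINT t=ereal (- y)..\<infinity>. ?K t * ?h t) = - (LBINT t=ereal y..\<infinity>. ?K t * ?h' t)"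
  proof -
    have einterval_UNIV: "einterval (- \<infinity>) \<infinity> = UNIV" by (simp add: einterval_def)
    have int: "integrable lborel (\<lambda>t. ?K t * ?h t)" and zero: "(LINT t|lborel. ?K t * ?h t) = 0"
      unfolding n_def m_def by (rule integrable_svg_centred[OF r \<sigma> h], rule integral_svg_centred[OF r \<sigma> h])
    have "(LBINT t=ereal y..\<infinity>. ?K t * ?h' t) = (LBINT t=- \<infinity>..ereal (- y). ?K t * ?h t)"
      unfolding h' by (subst (2) interval_integral_reflect) simp
    moreover have "(LBINT t=- \<infinity>..ereal (- y). ?K t * ?h t) + (LBINT t=ereal (- y)..\<infinity>. ?K t * ?h t) =
        (LBINT t=- \<infinity>..\<infinity>. ?K t * ?h t)"
      using int by (intro interval_integral_sum)
          (simp add: interval_lebesgue_integrable_def einterval_UNIV set_integrable_def)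
    moreover have "(LBINT t=- \<infinity>..\<infinity>. ?K t * ?h t) = 0"
      using zero by (simp add: interval_lebesgue_integral_def einterval_UNIV set_lebesgue_integral_def)
    ultimately show ?thesis by linarith
  qed
  have y: "\<mu> - y - \<mu> = - y" "\<mu> + y - \<mu> = y" by simp_all
  show ?thesis
    unfolding svg_stein_formula_def Let_def n_def[symmetric] svg_expect_reflect m_def[symmetric] y
    unfolding infinity_ereal_def[symmetric] X Y by simp
qed

locale svg_test_function =
  fixes r \<sigma> \<mu> A B :: real and h :: "real \<Rightarrow> real"
  assumes r: "r > 0" and \<sigma>: "\<sigma> > 0" and B: "B \<ge> 0"
    and measurable_h [measurable]: "h \<in> borel_measurable borel"
    and growth_h: "\<bar>h x\<bar> \<le> A + B * \<bar>x - \<mu>\<bar>"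
begin

definition centred :: "real \<Rightarrow> real \<Rightarrow> real" where
  "centred s t = h (\<mu> + s * \<sigma> * t) - svg_expect r \<sigma> \<mu> h"

lemma linear_growth_shifted:
  assumes "\<bar>s\<bar> = 1"
  shows "linear_growth (A + \<bar>c\<bar>) (B * \<sigma>) (\<lambda>t. h (\<mu> + s * \<sigma> * t) - c)"
  unfolding linear_growth_def
proof (intro conjI allI impI)
  show "0 \<le> A + \<bar>c\<bar>" using growth_h[of \<mu>] by simp
  show "0 \<le> B * \<sigma>" using B \<sigma> by simp
  fix t :: real assume "t > 0"
  then have "\<bar>\<mu> + s * \<sigma> * t - \<mu>\<bar> = \<sigma> * t" using assms \<sigma> by (simp add: abs_mult)
  then show "\<bar>h (\<mu> + s * \<sigma> * t) - c\<bar> \<le> A + \<bar>c\<bar> + B * \<sigma> * t"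
    using growth_h[of "\<mu> + s * \<sigma> * t"] abs_triangle_ineq4[of "h (\<mu> + s * \<sigma> * t)" c] by simp
qed measurable

lemma linear_growth_half_lines:
  "linear_growth (A + \<bar>c\<bar>) (B * \<sigma>) (\<lambda>t. h (\<mu> + \<sigma> * t) - c)"
  "linear_growth (A + \<bar>c\<bar>) (B * \<sigma>) (\<lambda>t. h (\<mu> - \<sigma> * t) - c)"
  using linear_growth_shifted[of 1 c] linear_growth_shifted[of "- 1" c] by simp_all

lemma linear_growth_centred: "\<bar>s\<bar> = 1 \<Longrightarrow> linear_growth (A + \<bar>svg_expect r \<sigma> \<mu> h\<bar>) (B * \<sigma>) (centred s)"
  unfolding centred_def by (rule linear_growth_shifted)

lemma integrable_svg_pdf_h: "integrable lborel (\<lambda>x. svg_pdf r \<sigma> \<mu> x * (h x - c))"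
  by (rule integrable_svg_pdf_mult[OF r \<sigma> linear_growth_half_lines])

lemma svg_expect_diff_const: "svg_expect r \<sigma> \<mu> (\<lambda>x. h x - c) = svg_expect r \<sigma> \<mu> h - c"
  using integrable_svg_pdf_h[of 0] integrable_svg_pdf[OF r \<sigma>]
  by (simp add: svg_expect_def right_diff_distrib integral_svg_pdf[OF r \<sigma>])

lemma green_upper_centred_0: "green_upper r (centred 1) 0 + green_upper r (centred (- 1)) 0 = 0"
proof -
  let ?m = "svg_expect r \<sigma> \<mu> h"
  have "svg_expect r \<sigma> \<mu> (\<lambda>x. h x - ?m) = 0" by (simp add: svg_expect_diff_const)
  then show ?thesis
    unfolding centred_def using green_upper_one_0_pos[OF r]
    using svg_expect_eq_green_upper[OF r \<sigma> linear_growth_half_lines, of ?m] by simp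
qed

lemma svg_stein_formula_eq_green:
  assumes x: "x \<noteq> \<mu>"
  shows "svg_stein_formula r \<sigma> \<mu> h x = sgn (x - \<mu>) / \<sigma> * green r (centred (sgn (x - \<mu>))) (\<bar>x - \<mu>\<bar> / \<sigma>)"
proof (cases "x > \<mu>")
  case True
  then have "(x - \<mu>) / \<sigma> > 0" "\<mu> + \<sigma> * ((x - \<mu>) / \<sigma>) = x" using \<sigma> by simp_all
  with svg_stein_formula_right[OF r \<sigma>, of "(x - \<mu>) / \<sigma>" \<mu> h] True show ?thesis
    unfolding centred_def by simp
next
  case False
  let ?z = "(\<mu> - x) / \<sigma>"
  have z: "?z > 0" "\<mu> - \<sigma> * ?z = x" "2 * \<mu> - (\<mu> + \<sigma> * t) = \<mu> - \<sigma> * t" for t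
    using False x \<sigma> by simp_all
  have "svg_stein_formula r \<sigma> \<mu> h (\<mu> - \<sigma> * ?z) = - svg_stein_formula r \<sigma> \<mu> (\<lambda>t. h (2 * \<mu> - t)) (\<mu> + \<sigma> * ?z)"
    using integrable_svg_pdf_h[of 0] by (intro svg_stein_formula_reflect r \<sigma>) simp
  also have "\<dots> = - green r (\<lambda>t. h (\<mu> - \<sigma> * t) - svg_expect r \<sigma> \<mu> h) ?z / \<sigma>"
    unfolding svg_stein_formula_right[OF r \<sigma> z(1)] svg_expect_reflect z(3) by simp
  finally show ?thesis using False x unfolding z(2) centred_def by simp
qed

lemma svg_stein_formula_at_mu:
  "(svg_stein_formula r \<sigma> \<mu> h \<longlongrightarrow> - (nbessel_I r 0 * green_upper r (centred 1) 0) / \<sigma>) (at \<mu>)"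
proof -
  have lim: "(svg_stein_formula r \<sigma> \<mu> h \<longlongrightarrow> s / \<sigma> * - (nbessel_I r 0 * green_upper r (centred s) 0))
      (at \<mu> within {t. s * (t - \<mu>) > 0})" if s: "\<bar>s\<bar> = 1" for s
  proof (rule Lim_transform_eventually)
    let ?F = "at \<mu> within {t. s * (t - \<mu>) > 0}"
    have "((\<lambda>t. \<bar>t - \<mu>\<bar> / \<sigma>) \<longlongrightarrow> 0) ?F" using \<sigma> by (auto intro!: tendsto_eq_intros)
    moreover have "\<forall>\<^sub>F t in ?F. \<bar>t - \<mu>\<bar> / \<sigma> \<in> {0<..} \<and> \<bar>t - \<mu>\<bar> / \<sigma> \<noteq> 0"
      unfolding eventually_at_filter using \<sigma> by (intro always_eventually) auto
    ultimately have "filterlim (\<lambda>t. \<bar>t - \<mu>\<bar> / \<sigma>) (at_right 0) ?F" unfolding filterlim_at by blast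
    then show "((\<lambda>t. s / \<sigma> * green r (centred s) (\<bar>t - \<mu>\<bar> / \<sigma>)) \<longlongrightarrow>
        s / \<sigma> * - (nbessel_I r 0 * green_upper r (centred s) 0)) ?F"
      by (intro tendsto_intros filterlim_compose[OF green_at_0[OF r linear_growth_centred[OF s]]])
    have "s / \<sigma> * green r (centred s) (\<bar>t - \<mu>\<bar> / \<sigma>) = svg_stein_formula r \<sigma> \<mu> h t" if "s * (t - \<mu>) > 0" for t
    proof -
      have "sgn (t - \<mu>) = s" using that s by (auto simp: sgn_if zero_less_mult_iff)
      moreover have "t \<noteq> \<mu>" using that by auto
      ultimately show ?thesis by (simp add: svg_stein_formula_eq_green)
    qed
    then show "\<forall>\<^sub>F t in ?F. s / \<sigma> * green r (centred s) (\<bar>t - \<mu>\<bar> / \<sigma>) = svg_stein_formula r \<sigma> \<mu> h t"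
      unfolding eventually_at_filter by (intro always_eventually) auto
  qed
  have "green_upper r (centred (- 1)) 0 = - green_upper r (centred 1) 0"
    using green_upper_centred_0 by linarith
  then show ?thesis
    using lim[of 1] lim[of "- 1"] by (simp add: filterlim_at_split greaterThan_def lessThan_def)
qed

lemma svg_stein_sol_eq_formula: "x \<noteq> \<mu> \<Longrightarrow> svg_stein_sol r \<sigma> \<mu> h x = svg_stein_formula r \<sigma> \<mu> h x"
  by (simp add: svg_stein_sol_def)

lemma has_nth_deriv_svg_stein_sol_iff:
  assumes x: "x \<noteq> \<mu>"
  shows "has_nth_deriv (svg_stein_sol r \<sigma> \<mu> h) n x D \<longleftrightarrow>
    has_nth_deriv (green r (centred (sgn (x - \<mu>)))) n (\<bar>x - \<mu>\<bar> / \<sigma>) ((sgn (x - \<mu>) * \<sigma>) ^ Suc n * D)"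
proof -
  define s where "s = sgn (x - \<mu>)"
  have s: "s = 1 \<or> s = - 1" "s * (x - \<mu>) = \<bar>x - \<mu>\<bar>"
    unfolding s_def using x by (auto simp: sgn_if abs_if)
  have "\<forall>\<^sub>F t in nhds x. t \<in> {t. s * (t - \<mu>) > 0}"
    using x s(2) by (intro eventually_nhds_in_open open_Collect_less continuous_intros) auto
  then have "\<forall>\<^sub>F t in nhds x. svg_stein_sol r \<sigma> \<mu> h t = s / \<sigma> * green r (centred s) (- (s * \<mu> / \<sigma>) + s / \<sigma> * t)"
  proof eventually_elim
    case (elim t)
    have "sgn (t - \<mu>) = s" "\<bar>t - \<mu>\<bar> / \<sigma> = - (s * \<mu> / \<sigma>) + s / \<sigma> * t"
      using elim s(1) by (auto simp: sgn_if abs_if zero_less_mult_iff diff_divide_distrib)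
    moreover have "t \<noteq> \<mu>" using elim by auto
    ultimately show ?case by (simp add: svg_stein_sol_eq_formula svg_stein_formula_eq_green)
  qed
  then have "has_nth_deriv (svg_stein_sol r \<sigma> \<mu> h) n x D \<longleftrightarrow>
      has_nth_deriv (\<lambda>t. s / \<sigma> * green r (centred s) (- (s * \<mu> / \<sigma>) + s / \<sigma> * t)) n x D"
    by (rule has_nth_deriv_cong_ev)
  also have "\<dots> \<longleftrightarrow> has_nth_deriv (green r (centred s)) n (- (s * \<mu> / \<sigma>) + s / \<sigma> * x) (D / (s / \<sigma> * (s / \<sigma>) ^ n))"
    using s(1) \<sigma> by (intro has_nth_deriv_affine_iff) auto
  also have "- (s * \<mu> / \<sigma>) + s / \<sigma> * x = \<bar>x - \<mu>\<bar> / \<sigma>"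
    unfolding s(2)[symmetric] by (simp add: right_diff_distrib diff_divide_distrib)
  also have "D / (s / \<sigma> * (s / \<sigma>) ^ n) = (s * \<sigma>) ^ Suc n * D"
    using s(1) \<sigma> by (auto simp: power_divide power_mult_distrib divide_simps simp flip: power_mult_distrib)
  finally show ?thesis unfolding s_def .
qed

end

subsection \<open>Bounds for the Stein solution\<close>

context svg_test_function
begin

lemma abs_sgn_power_mult: "x \<noteq> \<mu> \<Longrightarrow> \<bar>(sgn (x - \<mu>) * \<sigma>) ^ n * D\<bar> = \<sigma> ^ n * \<bar>D\<bar>"
  using \<sigma> by (simp add: abs_mult power_abs abs_sgn_eq)

lemma abs_mult_nth_deriv_svg_stein_sol_le:
  assumes C: "C \<ge> 0"
    and bound: "\<And>s z D. \<bar>s\<bar> = 1 \<Longrightarrow> z > 0 \<Longrightarrow> has_nth_deriv (green r (centred s)) n z D \<Longrightarrow> \<bar>z * D\<bar> \<le> C"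
    and D: "has_nth_deriv (svg_stein_sol r \<sigma> \<mu> h) n x D"
  shows "\<bar>(x - \<mu>) * D\<bar> \<le> C / \<sigma> ^ n"
proof (cases "x = \<mu>")
  case False
  have "\<bar>\<bar>x - \<mu>\<bar> / \<sigma> * ((sgn (x - \<mu>) * \<sigma>) ^ Suc n * D)\<bar> \<le> C"
    using D False \<sigma> unfolding has_nth_deriv_svg_stein_sol_iff[OF False]
    by (intro bound[of "sgn (x - \<mu>)"]) (auto simp: abs_sgn_eq)
  also have "\<bar>\<bar>x - \<mu>\<bar> / \<sigma> * ((sgn (x - \<mu>) * \<sigma>) ^ Suc n * D)\<bar> = \<bar>x - \<mu>\<bar> / \<sigma> * (\<sigma> ^ Suc n * \<bar>D\<bar>)"
    unfolding abs_mult[of "\<bar>x - \<mu>\<bar> / \<sigma>"] abs_sgn_power_mult[OF False] using \<sigma> by simp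
  finally show ?thesis using \<sigma> by (simp add: abs_mult pos_le_divide_eq mult_ac)
qed (use C \<sigma> in simp)

lemma abs_nth_deriv_svg_stein_sol_le:
  assumes diff: "\<And>s z. \<bar>s\<bar> = 1 \<Longrightarrow> z > 0 \<Longrightarrow> \<exists>D. has_nth_deriv (green r (centred s)) (Suc n) z D \<and> \<bar>D\<bar> \<le> C"
    and D: "has_nth_deriv (svg_stein_sol r \<sigma> \<mu> h) (Suc n) x D"
  shows "\<bar>D\<bar> \<le> C / \<sigma> ^ Suc (Suc n)"
proof -
  have off_mu: "\<exists>E. has_nth_deriv (svg_stein_sol r \<sigma> \<mu> h) (Suc n) t E \<and> \<bar>E\<bar> \<le>
      C / \<sigma> ^ Suc (Suc n)" if "t \<noteq> \<mu>" for t
  proof -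
    define s where "s = sgn (t - \<mu>)"
    have s: "\<bar>s\<bar> = 1" "s * \<sigma> \<noteq> 0" unfolding s_def using that \<sigma> by (auto simp: abs_sgn_eq sgn_eq_0_iff)
    have "\<bar>t - \<mu>\<bar> / \<sigma> > 0" using that \<sigma> by simp
    from diff[OF s(1) this] obtain D
      where D: "has_nth_deriv (green r (centred s)) (Suc n) (\<bar>t - \<mu>\<bar> / \<sigma>) D" "\<bar>D\<bar> \<le> C" by blast
    have "has_nth_deriv (svg_stein_sol r \<sigma> \<mu> h) (Suc n) t (D / (s * \<sigma>) ^ Suc (Suc n))"
      unfolding has_nth_deriv_svg_stein_sol_iff[OF that] s_def[symmetric]
      using D(1) s(2) by (simp del: has_nth_deriv.simps power_Suc)
    moreover have "\<bar>D / (s * \<sigma>) ^ Suc (Suc n)\<bar> \<le> C / \<sigma> ^ Suc (Suc n)"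
      using D(2) s(1) \<sigma> by (simp add: abs_mult power_abs divide_right_mono del: power_Suc)
    ultimately show ?thesis by blast
  qed
  show ?thesis
  proof (cases "x = \<mu>")
    case True
    show ?thesis
    proof (rule abs_nth_deriv_le_of_punctured[OF D])
      show "\<forall>\<^sub>F t in at x. \<exists>E. has_nth_deriv (svg_stein_sol r \<sigma> \<mu> h) (Suc n) t E \<and> \<bar>E\<bar> \<le> C / \<sigma> ^ Suc (Suc n)"
        unfolding eventually_at_filter using off_mu True by (intro always_eventually) blast
    qed
  next
    case False
    from off_mu[OF this] has_nth_deriv_unique[OF D] show ?thesis by blast
  qed
qed

lemma abs_svg_stein_sol_le:
  assumes bound: "\<And>s z. \<bar>s\<bar> = 1 \<Longrightarrow> z > 0 \<Longrightarrow> \<bar>green r (centred s) z\<bar> \<le> C"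
  shows "\<bar>svg_stein_sol r \<sigma> \<mu> h x\<bar> \<le> C / \<sigma>"
proof -
  have off_mu: "\<bar>svg_stein_formula r \<sigma> \<mu> h t\<bar> \<le> C / \<sigma>" if "t \<noteq> \<mu>" for t
    using bound[of "sgn (t - \<mu>)" "\<bar>t - \<mu>\<bar> / \<sigma>"] that \<sigma>
    by (simp add: svg_stein_formula_eq_green abs_mult abs_sgn_eq divide_right_mono)
  show ?thesis
  proof (cases "x = \<mu>")
    case True
    then have "svg_stein_sol r \<sigma> \<mu> h x = - (nbessel_I r 0 * green_upper r (centred 1) 0) / \<sigma>"
      unfolding svg_stein_sol_def using tendsto_Lim[OF _ svg_stein_formula_at_mu] by simp
    moreover have "\<forall>\<^sub>F t in at \<mu>. \<bar>svg_stein_formula r \<sigma> \<mu> h t\<bar> \<le> C / \<sigma>"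
      unfolding eventually_at_filter using off_mu by (intro always_eventually) blast
    ultimately show ?thesis
      using tendsto_upperbound[OF tendsto_rabs[OF svg_stein_formula_at_mu]] by simp
  qed (simp add: svg_stein_sol_eq_formula off_mu)
qed

end

lemma svg_stein_sol_sharp_bounds:
  assumes r: "r > 0" and \<sigma>: "\<sigma> > 0" and [measurable]: "h \<in> borel_measurable borel"
    and M: "\<And>x. \<bar>h x - svg_expect r \<sigma> \<mu> h\<bar> \<le> M"
  shows "\<bar>(x - \<mu>) * svg_stein_sol r \<sigma> \<mu> h x\<bar> \<le> (1 + 1 / (2 * r)) * M"
    and "has_nth_deriv (svg_stein_sol r \<sigma> \<mu> h) 1 x D \<Longrightarrow> \<bar>(x - \<mu>) * D\<bar> \<le> 1 / \<sigma> * (1 + 1 / (2 * r)) * M"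
    and "has_nth_deriv (svg_stein_sol r \<sigma> \<mu> h) 2 x D \<Longrightarrow> \<bar>(x - \<mu>) * D\<bar> \<le> 1 / \<sigma>\<^sup>2 * (4 + 1 / (2 * r)) * M"
proof -
  have "\<bar>h x\<bar> \<le> M + \<bar>svg_expect r \<sigma> \<mu> h\<bar> + 0 * \<bar>x - \<mu>\<bar>" for x using M[of x] by linarith
  then interpret svg_test_function r \<sigma> \<mu> "M + \<bar>svg_expect r \<sigma> \<mu> h\<bar>" 0 h
    using r \<sigma> by unfold_locales auto
  have M_nonneg: "M \<ge> 0" using M[of 0] by linarith
  have growth: "linear_growth M 0 (centred s)" for s
    unfolding linear_growth_def centred_def using M M_nonneg by auto
  note half_line = abs_mult_green_le[OF r growth] abs_mult_green_deriv_1_le[OF r growth]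
      abs_mult_green_deriv_2_le[OF r growth]
  have nonneg: "(1 + 1 / (2 * r)) * M \<ge> 0" "(4 + 1 / (2 * r)) * M \<ge> 0" using r M_nonneg by auto
  show "\<bar>(x - \<mu>) * svg_stein_sol r \<sigma> \<mu> h x\<bar> \<le> (1 + 1 / (2 * r)) * M"
    using abs_mult_nth_deriv_svg_stein_sol_le[OF nonneg(1), of 0 x "svg_stein_sol r \<sigma> \<mu> h x"] half_line(1) by simp
  show "\<bar>(x - \<mu>) * D\<bar> \<le> 1 / \<sigma> * (1 + 1 / (2 * r)) * M" if "has_nth_deriv (svg_stein_sol r \<sigma> \<mu> h) 1 x D"
    using abs_mult_nth_deriv_svg_stein_sol_le[OF nonneg(1) half_line(2) that] by simp
  show "\<bar>(x - \<mu>) * D\<bar> \<le> 1 / \<sigma>\<^sup>2 * (4 + 1 / (2 * r)) * M" if "has_nth_deriv (svg_stein_sol r \<sigma> \<mu> h) 2 x D"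
    using abs_mult_nth_deriv_svg_stein_sol_le[OF nonneg(2) half_line(3) that] by simp
qed

locale svg_lipschitz_test_function =
  fixes r \<sigma> \<mu> L :: real and h :: "real \<Rightarrow> real"
  assumes r: "r > 0" and \<sigma>: "\<sigma> > 0" and lip: "L-lipschitz_on UNIV h"
begin

lemma abs_diff_le: "\<bar>h s - h t\<bar> \<le> L * \<bar>s - t\<bar>"
  using lipschitz_onD[OF lip, of s t] by (simp add: dist_real_def)

sublocale svg_test_function r \<sigma> \<mu> "\<bar>h \<mu>\<bar>" L h
proof
  show "\<bar>h x\<bar> \<le> \<bar>h \<mu>\<bar> + L * \<bar>x - \<mu>\<bar>" for x
    using abs_diff_le[of x \<mu>] by linarith
  show "h \<in> borel_measurable borel"
    by (intro borel_measurable_continuous_onI lipschitz_on_continuous_on[OF lip])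
qed (use r \<sigma> lipschitz_on_nonneg[OF lip] in auto)

lemma abs_svg_expect_diff_le: "\<bar>svg_expect r \<sigma> \<mu> h - h \<mu>\<bar> \<le> L * \<sigma> / nstruve 0 r 0"
proof -
  have pdf: "svg_pdf r \<sigma> \<mu> x \<ge> 0" for x
    unfolding svg_pdf_def using r \<sigma> by (intro mult_nonneg_nonneg bessel_K_nonneg) (auto simp: Gamma_real_nonneg)
  have "\<bar>svg_expect r \<sigma> \<mu> h - h \<mu>\<bar> = \<bar>LINT x|lborel. svg_pdf r \<sigma> \<mu> x * (h x - h \<mu>)\<bar>"
    using svg_expect_diff_const[of "h \<mu>"] unfolding svg_expect_def by simp
  also have "\<dots> \<le> (LINT x|lborel. L * (svg_pdf r \<sigma> \<mu> x * \<bar>x - \<mu>\<bar>))"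
    unfolding real_norm_def[symmetric]
  proof (rule Bochner_Integration.integral_norm_bound_integral)
    show "norm (svg_pdf r \<sigma> \<mu> x * (h x - h \<mu>)) \<le> L * (svg_pdf r \<sigma> \<mu> x * norm (x - \<mu>))" for x
      using mult_left_mono[OF abs_diff_le[of x \<mu>] pdf[of x]] pdf[of x] by (simp add: abs_mult mult_ac)
  qed (use integrable_svg_pdf_h integrable_svg_abs_deviation[OF r \<sigma>] in auto)
  also have "\<dots> = L * \<sigma> / nstruve 0 r 0"
    using svg_expect_abs_deviation[OF r \<sigma>, of \<mu>] unfolding svg_expect_def by simp
  finally show ?thesis .
qed

lemma lipschitz_centred:
  assumes "\<bar>s\<bar> = 1"
  shows "(L * \<sigma>)-lipschitz_on UNIV (centred s)"
proof (rule lipschitz_onI)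
  fix a b :: real
  have "dist (centred s a) (centred s b) \<le> L * \<bar>s * \<sigma> * (a - b)\<bar>"
    using abs_diff_le[of "\<mu> + s * \<sigma> * a" "\<mu> + s * \<sigma> * b"] by (simp add: centred_def dist_real_def algebra_simps)
  then show "dist (centred s a) (centred s b) \<le> L * \<sigma> * dist a b"
    using assms \<sigma> by (simp add: dist_real_def abs_mult mult.assoc)
qed (use B \<sigma> in simp)

lemma linear_growth_centred_lipschitz:
  assumes "\<bar>s\<bar> = 1"
  shows "linear_growth (L * \<sigma> / nstruve 0 r 0) (L * \<sigma>) (centred s)"
  unfolding linear_growth_def
proof (intro conjI allI impI)
  show "centred s \<in> borel_measurable borel"
    using linear_growthD(1)[OF linear_growth_centred[OF assms]] .
  fix t :: real assume "t > 0"
  then have "\<bar>h (\<mu> + s * \<sigma> * t) - h \<mu>\<bar> \<le> L * \<sigma> * t"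
    using abs_diff_le[of "\<mu> + s * \<sigma> * t" \<mu>] assms \<sigma> by (simp add: abs_mult mult.assoc)
  then show "\<bar>centred s t\<bar> \<le> L * \<sigma> / nstruve 0 r 0 + L * \<sigma> * t"
    using abs_svg_expect_diff_le unfolding centred_def by linarith
qed (use B \<sigma> nstruve_0_pos[OF r] in auto)

lemma lipschitz_rhs_bound_eq: "L * \<sigma> / nstruve 0 r 0 * nstruve 0 r 0 + 2 * (L * \<sigma>) = 3 * (L * \<sigma>)"
  using nstruve_0_pos[OF r] by simp

lemma abs_svg_stein_sol_lipschitz_le: "\<bar>svg_stein_sol r \<sigma> \<mu> h x\<bar> \<le> 2 * L"
  using abs_svg_stein_sol_le[OF abs_green_le_const[OF r linear_growth_centred_lipschitz]] \<sigma> nstruve_0_pos[OF r]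
  by simp

lemma abs_deriv_svg_stein_sol_lipschitz_le:
  shows "has_nth_deriv (svg_stein_sol r \<sigma> \<mu> h) 1 x D \<Longrightarrow> \<bar>D\<bar> \<le> 3 / \<sigma> * nstruve 0 (r + 1) 0 * L"
    and "has_nth_deriv (svg_stein_sol r \<sigma> \<mu> h) 2 x D \<Longrightarrow> \<bar>D\<bar> \<le> 6 / (\<sigma>\<^sup>2 * (r + 1)) * L"
proof -
  note hyps = r linear_growth_centred_lipschitz lipschitz_centred
  note half_line = lipschitz_green_deriv_1_le[OF hyps, unfolded lipschitz_rhs_bound_eq]
    lipschitz_green_deriv_2_le[OF hyps, unfolded lipschitz_rhs_bound_eq]
  have "\<exists>D. has_nth_deriv (green r (centred s)) (Suc 0) z D \<and> \<bar>D\<bar> \<le> nstruve 0 (r + 1) 0 * (3 * (L * \<sigma>))"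
    if "\<bar>s\<bar> = 1" "z > 0" for s z
    using half_line(1)[OF that(1,1,2)] lipschitz_green_deriv_1_iff[OF hyps(1) hyps(2,3)[OF that(1)] that(2)]
    unfolding One_nat_def by blast
  from abs_nth_deriv_svg_stein_sol_le[OF this]
  show "\<bar>D\<bar> \<le> 3 / \<sigma> * nstruve 0 (r + 1) 0 * L" if "has_nth_deriv (svg_stein_sol r \<sigma> \<mu> h) 1 x D"
    using that \<sigma> unfolding One_nat_def by (simp add: mult_ac del: has_nth_deriv.simps)
  have "\<exists>D. has_nth_deriv (green r (centred s)) (Suc (Suc 0)) z D \<and> \<bar>D\<bar> \<le> 2 / (r + 1) * (3 * (L * \<sigma>))"
    if "\<bar>s\<bar> = 1" "z > 0" for s z
    using half_line(2)[OF that(1,1,2)] lipschitz_green_deriv_2_iff[OF hyps(1) hyps(2,3)[OF that(1)] that(2)]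
    unfolding numeral_2_eq_2 by blast
  from abs_nth_deriv_svg_stein_sol_le[OF this]
  show "\<bar>D\<bar> \<le> 6 / (\<sigma>\<^sup>2 * (r + 1)) * L" if "has_nth_deriv (svg_stein_sol r \<sigma> \<mu> h) 2 x D"
    using that \<sigma> unfolding numeral_2_eq_2 by (simp add: mult_ac del: has_nth_deriv.simps)
qed

lemma abs_mult_deriv_svg_stein_sol_lipschitz_le:
  defines "f \<equiv> svg_stein_sol r \<sigma> \<mu> h"
  shows "has_nth_deriv f 1 x D \<Longrightarrow> \<bar>(x - \<mu>) * D\<bar> \<le> 3 * (1 + 1 / (2 * (r + 1))) * L"
    and "has_nth_deriv f 2 x D \<Longrightarrow> \<bar>(x - \<mu>) * D\<bar> \<le> 3 / \<sigma> * (1 + 1 / (2 * (r + 1))) * L"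
    and "has_nth_deriv f 3 x D \<Longrightarrow> \<bar>(x - \<mu>) * D\<bar> \<le> 3 / \<sigma>\<^sup>2 * (4 + 1 / (2 * (r + 1))) * L"
proof -
  note hyps = r linear_growth_centred_lipschitz lipschitz_centred
  note half_line = lipschitz_mult_green_deriv_1_le[OF hyps, unfolded lipschitz_rhs_bound_eq]
    lipschitz_mult_green_deriv_2_le[OF hyps, unfolded lipschitz_rhs_bound_eq]
    lipschitz_mult_green_deriv_3_le[OF hyps, unfolded lipschitz_rhs_bound_eq]
  have nonneg: "(1 + 1 / (2 * (r + 1))) * (3 * (L * \<sigma>)) \<ge> 0" "(4 + 1 / (2 * (r + 1))) * (3 * (L * \<sigma>)) \<ge> 0"
    using r \<sigma> B by auto
  show "\<bar>(x - \<mu>) * D\<bar> \<le> 3 * (1 + 1 / (2 * (r + 1))) * L" if "has_nth_deriv f 1 x D"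
    using abs_mult_nth_deriv_svg_stein_sol_le[OF nonneg(1) half_line(1) that[unfolded f_def]] \<sigma>
    by (simp add: mult_ac)
  show "\<bar>(x - \<mu>) * D\<bar> \<le> 3 / \<sigma> * (1 + 1 / (2 * (r + 1))) * L" if "has_nth_deriv f 2 x D"
    using abs_mult_nth_deriv_svg_stein_sol_le[OF nonneg(1) half_line(2) that[unfolded f_def]] \<sigma>
    by (simp add: power2_eq_square mult_ac)
  show "\<bar>(x - \<mu>) * D\<bar> \<le> 3 / \<sigma>\<^sup>2 * (4 + 1 / (2 * (r + 1))) * L" if "has_nth_deriv f 3 x D"
    using abs_mult_nth_deriv_svg_stein_sol_le[OF nonneg(2) half_line(3) that[unfolded f_def]] \<sigma>
    by (simp add: power2_eq_square power3_eq_cube mult_ac)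
qed

end

subsection \<open>The constants of the theorem\<close>

lemma nstruve_0_le:
  assumes r: "r > 0"
  shows "nstruve 0 r 0 \<le> pi * Gamma (r / 2) / (2 * Gamma ((r + 1) / 2))"
proof -
  have "sqrt pi * 1 \<le> sqrt pi * sqrt pi"
    using pi_gt3 by (intro mult_left_mono) auto
  moreover have "Gamma (r / 2) / (2 * Gamma ((r + 1) / 2)) > 0"
    using r by (intro divide_pos_pos mult_pos_pos Gamma_real_pos) auto
  ultimately have "sqrt pi * (Gamma (r / 2) / (2 * Gamma ((r + 1) / 2))) \<le>
      pi * (Gamma (r / 2) / (2 * Gamma ((r + 1) / 2)))"
    by (intro mult_right_mono) auto
  then show ?thesis
    by (simp add: nstruve_0[OF r] Beta_def Gamma_one_half_real add_divide_distrib add.commute)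
qed

lemma svg_stein_sol_bounds_of_bounded:
  fixes r \<sigma> \<mu> :: real and h :: "real \<Rightarrow> real"
  assumes r: "r > 0" and \<sigma>: "\<sigma> > 0" and h: "bounded (range h)" "h \<in> borel_measurable borel"
  defines "f \<equiv> svg_stein_sol r \<sigma> \<mu> h" and "nh \<equiv> (SUP x. \<bar>h x - svg_expect r \<sigma> \<mu> h\<bar>)"
  shows "\<bar>(x - \<mu>) * f x\<bar> \<le> (3 / 2 + 1 / (2 * r)) * nh"
    and "has_nth_deriv f 1 x D \<Longrightarrow> \<bar>(x - \<mu>) * D\<bar> \<le> 1 / \<sigma> * (1 + 1 / (2 * r)) * nh"
    and "has_nth_deriv f 2 x D \<Longrightarrow> \<bar>(x - \<mu>) * D\<bar> \<le> 1 / (2 * \<sigma>\<^sup>2) * (9 + 1 / r) * nh"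
proof -
  obtain C where "\<And>x. \<bar>h x\<bar> \<le> C" using h(1) unfolding bounded_iff by auto
  then have "bdd_above (range (\<lambda>x. \<bar>h x - svg_expect r \<sigma> \<mu> h\<bar>))"
    by (intro bdd_aboveI2[where M = "C + \<bar>svg_expect r \<sigma> \<mu> h\<bar>"] order_trans[OF abs_triangle_ineq4] add_right_mono)
  then have nh: "\<bar>h x - svg_expect r \<sigma> \<mu> h\<bar> \<le> nh" for x
    unfolding nh_def by (rule cSUP_upper[OF UNIV_I])
  have nh_nonneg: "nh \<ge> 0" using nh[of 0] by linarith
  note sharp = svg_stein_sol_sharp_bounds[OF r \<sigma> h(2) nh, folded f_def]
  show "\<bar>(x - \<mu>) * f x\<bar> \<le> (3 / 2 + 1 / (2 * r)) * nh"
    by (rule order_trans[OF sharp(1) mult_right_mono[OF _ nh_nonneg]]) simp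
  show "\<bar>(x - \<mu>) * D\<bar> \<le> 1 / \<sigma> * (1 + 1 / (2 * r)) * nh" if "has_nth_deriv f 1 x D"
    using that by (rule sharp(2))
  have "1 / \<sigma>\<^sup>2 * (4 + 1 / (2 * r)) \<le> 1 / (2 * \<sigma>\<^sup>2) * (9 + 1 / r)"
    using r \<sigma> by (simp add: field_simps)
  then show "\<bar>(x - \<mu>) * D\<bar> \<le> 1 / (2 * \<sigma>\<^sup>2) * (9 + 1 / r) * nh" if "has_nth_deriv f 2 x D"
    by (rule order_trans[OF sharp(3)[OF that] mult_right_mono[OF _ nh_nonneg]])
qed

lemma svg_stein_sol_bounds_of_lipschitz:
  fixes r \<sigma> \<mu> L :: real and h :: "real \<Rightarrow> real"
  assumes r: "r > 0" and \<sigma>: "\<sigma> > 0" and lip: "L-lipschitz_on UNIV h"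
  defines "f \<equiv> svg_stein_sol r \<sigma> \<mu> h"
  shows "\<bar>f x\<bar> \<le> 7 / 2 * L"
    and "has_nth_deriv f 1 x D \<Longrightarrow>
      \<bar>D\<bar> \<le> 9 / (2 * \<sigma>) * (1 / (r + 1) + pi * Gamma ((r + 1) / 2) / (2 * Gamma (r / 2 + 1))) * L"
    and "has_nth_deriv f 2 x D \<Longrightarrow> \<bar>D\<bar> \<le> 9 / (\<sigma>\<^sup>2 * (r + 1)) * L"
    and "has_nth_deriv f 1 x D \<Longrightarrow> \<bar>(x - \<mu>) * D\<bar> \<le> 9 / 2 * (3 / 2 + 1 / (2 * (r + 1))) * L"
    and "has_nth_deriv f 2 x D \<Longrightarrow> \<bar>(x - \<mu>) * D\<bar> \<le> 9 / (2 * \<sigma>) * (1 + 1 / (2 * (r + 1))) * L"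
    and "has_nth_deriv f 3 x D \<Longrightarrow> \<bar>(x - \<mu>) * D\<bar> \<le> 9 / (4 * \<sigma>\<^sup>2) * (9 + 1 / (r + 1)) * L"
proof -
  interpret svg_lipschitz_test_function r \<sigma> \<mu> L h by unfold_locales (fact r \<sigma> lip)+
  note deriv_le = abs_deriv_svg_stein_sol_lipschitz_le[folded f_def]
    and mult_le = abs_mult_deriv_svg_stein_sol_lipschitz_le[folded f_def]
    and relax = order_trans[OF _ mult_right_mono[OF _ B]]
  have r1: "r + 1 > 0" using r by simp
  show "\<bar>f x\<bar> \<le> 7 / 2 * L"
    by (rule relax[OF abs_svg_stein_sol_lipschitz_le[folded f_def]]) simp
  have "(r + 1 + 1) / 2 = r / 2 + 1" by simp
  from nstruve_0_le[OF r1, unfolded this]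
  have "nstruve 0 (r + 1) 0 \<le> 1 / (r + 1) + pi * Gamma ((r + 1) / 2) / (2 * Gamma (r / 2 + 1))"
    using r1 by (intro add_increasing) auto
  then have "3 / \<sigma> * nstruve 0 (r + 1) 0 \<le>
      9 / (2 * \<sigma>) * (1 / (r + 1) + pi * Gamma ((r + 1) / 2) / (2 * Gamma (r / 2 + 1)))"
    using \<sigma> nstruve_0_pos[OF r1] by (intro mult_mono) (auto simp: field_simps)
  then show "\<bar>D\<bar> \<le> 9 / (2 * \<sigma>) * (1 / (r + 1) + pi * Gamma ((r + 1) / 2) / (2 * Gamma (r / 2 + 1))) * L"
    if "has_nth_deriv f 1 x D"
    by (rule relax[OF deriv_le(1)[OF that]])
  show "\<bar>D\<bar> \<le> 9 / (\<sigma>\<^sup>2 * (r + 1)) * L" if "has_nth_deriv f 2 x D"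
    using r1 by (intro relax[OF deriv_le(2)[OF that]] divide_right_mono) auto
  have "3 * (1 + 1 / (2 * (r + 1))) \<le> 9 / 2 * (3 / 2 + 1 / (2 * (r + 1)))"
    using r by (simp add: field_simps)
  then show "\<bar>(x - \<mu>) * D\<bar> \<le> 9 / 2 * (3 / 2 + 1 / (2 * (r + 1))) * L" if "has_nth_deriv f 1 x D"
    by (rule relax[OF mult_le(1)[OF that]])
  have "3 / \<sigma> * (1 + 1 / (2 * (r + 1))) \<le> 9 / (2 * \<sigma>) * (1 + 1 / (2 * (r + 1)))"
    using r1 \<sigma> by (intro mult_right_mono) (auto simp: field_simps)
  then show "\<bar>(x - \<mu>) * D\<bar> \<le> 9 / (2 * \<sigma>) * (1 + 1 / (2 * (r + 1))) * L" if "has_nth_deriv f 2 x D"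
    by (rule relax[OF mult_le(2)[OF that]])
  have "1 / \<sigma>\<^sup>2 * (3 * (4 + 1 / (2 * (r + 1)))) \<le> 1 / \<sigma>\<^sup>2 * (9 / 4 * (9 + 1 / (r + 1)))"
    using r by (intro mult_left_mono) (auto simp: field_simps)
  then have "3 / \<sigma>\<^sup>2 * (4 + 1 / (2 * (r + 1))) \<le> 9 / (4 * \<sigma>\<^sup>2) * (9 + 1 / (r + 1))"
    by (simp add: mult.commute)
  then show "\<bar>(x - \<mu>) * D\<bar> \<le> 9 / (4 * \<sigma>\<^sup>2) * (9 + 1 / (r + 1)) * L" if "has_nth_deriv f 3 x D"
    by (rule relax[OF mult_le(3)[OF that]])
qed

theorem theorem3p1:
  fixes r \<sigma> \<mu> L :: real and h :: "real \<Rightarrow> real"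
  assumes r: "r > 0" and \<sigma>: "\<sigma> > 0"
    and int: "integrable lborel (\<lambda>x. svg_pdf r \<sigma> \<mu> x * h x)"
  defines "f \<equiv> svg_stein_sol r \<sigma> \<mu> h"
    and "nh \<equiv> (SUP x. \<bar>h x - svg_expect r \<sigma> \<mu> h\<bar>)"
  shows
   "(bounded (range h) \<and> h \<in> borel_measurable borel \<longrightarrow>
       (\<forall>x. \<bar>(x - \<mu>) * f x\<bar> \<le> (3 / 2 + 1 / (2 * r)) * nh)
     \<and> (\<forall>x D. has_nth_deriv f 1 x D \<longrightarrow> \<bar>(x - \<mu>) * D\<bar> \<le> 1 / \<sigma> * (1 + 1 / (2 * r)) * nh)
     \<and> (\<forall>x D. has_nth_deriv f 2 x D \<longrightarrow> \<bar>(x - \<mu>) * D\<bar> \<le> 1 / (2 * \<sigma>\<^sup>2) * (9 + 1 / r) * nh))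
  \<and> (lipschitz_on L UNIV h \<longrightarrow>
       (\<forall>x. \<bar>f x\<bar> \<le> 7 / 2 * L)
     \<and> (\<forall>x D. has_nth_deriv f 1 x D \<longrightarrow>
          \<bar>D\<bar> \<le> 9 / (2 * \<sigma>) * (1 / (r + 1) + pi * Gamma ((r + 1) / 2) / (2 * Gamma (r / 2 + 1))) * L)
     \<and> (\<forall>x D. has_nth_deriv f 2 x D \<longrightarrow> \<bar>D\<bar> \<le> 9 / (\<sigma>\<^sup>2 * (r + 1)) * L)
     \<and> (\<forall>x D. has_nth_deriv f 1 x D \<longrightarrow> \<bar>(x - \<mu>) * D\<bar> \<le> 9 / 2 * (3 / 2 + 1 / (2 * (r + 1))) * L)
     \<and> (\<forall>x D. has_nth_deriv f 2 x D \<longrightarrow> \<bar>(x - \<mu>) * D\<bar> \<le> 9 / (2 * \<sigma>) * (1 + 1 / (2 * (r + 1))) * L)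
     \<and> (\<forall>x D. has_nth_deriv f 3 x D \<longrightarrow> \<bar>(x - \<mu>) * D\<bar> \<le> 9 / (4 * \<sigma>\<^sup>2) * (9 + 1 / (r + 1)) * L))"
  unfolding f_def nh_def
  using svg_stein_sol_bounds_of_bounded[OF r \<sigma>, where h = h and \<mu> = \<mu>]
    svg_stein_sol_bounds_of_lipschitz[OF r \<sigma>, where h = h and \<mu> = \<mu> and L = L]
  by blast

end
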